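(* Let $n\ge1$ and $a>0$. For every tempered distribution $f$ on $\mathbb{R}^n$, the windowed Fourier transform $T_af(x)$ extends to $\mathbb{C}^n$ as an entire function which satisfies, for some non-negative integer $m$ and some constant $C$, the estimate $$|T_af(x+iy)|\le C(1+x^2+y^2)^m e^{\frac12a^{-1}y^2}\qquad\text{for all }x,y\in\mathbb{R}^n.$$ Conversely, if an entire function $F$ on $\mathbb{C}^n$ satisfies such an estimate (that is, $|F(x+iy)|\le C(1+x^2+y^2)^me^{\frac12a^{-1}y^2}$ for all $x,y\in\mathbb{R}^n$, for some constant $C$ and some non-negative integer $m$), then $F=T_af$ for a tempered distribution $f$ on $\mathbb{R}^n$.
   Context: For $x\in\mathbb{R}^n$, $x^2=|x|^2=x_1^2+\cdots+x_n^2$. For a Schwartz function $g$, the windowed (short-time) Fourier transform with window $g$ is $V_g(f)(x,y)=(2\pi)^{-n/2}\int_{\mathbb{R}^n}f(u)g(u-y)e^{-ix\cdot u}\,du$. With the Gaussian window $\varphi_a(x)=c_ne^{-\frac12a|x|^2}$, where $c_n>0$ is a fixed constant, set $T_af(x)=V_{\varphi_a}(f)(x,0)$, i.e. $T_af(x)=(2\pi)^{-n/2}\int_{\mathbb{R}^n}f(u)\varphi_a(u)e^{-ix\cdot u}\,du$. For a tempered distribution $f$ the integral is interpreted as the (bilinear) pairing of $f$ with the Schwartz function $u\mapsto(2\pi)^{-n/2}\varphi_a(u)e^{-ix\cdot u}$. *)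

theory Defs
  imports "HOL-Analysis.Analysis"
begin

section \<open>Schwartz functions\<close>

definition partial :: "'n \<Rightarrow> (real^'n \<Rightarrow> complex) \<Rightarrow> real^'n \<Rightarrow> complex"
  where "partial i \<phi> x = vector_derivative (\<lambda>t. \<phi> (x + t *\<^sub>R axis i 1)) (at 0)"

text \<open>A mixed partial derivative is given by the list of the directions in which to differentiate;
  for smooth functions, the order of the list is irrelevant.\<close>

definition partials :: "'n list \<Rightarrow> (real^'n \<Rightarrow> complex) \<Rightarrow> real^'n \<Rightarrow> complex"
  where "partials \<beta> \<phi> = foldr partial \<beta> \<phi>"

definition smooth :: "(real^'n \<Rightarrow> complex) \<Rightarrow> bool"
  where "smooth \<phi> \<longleftrightarrow> (\<forall>\<beta> x. partials \<beta> \<phi> differentiable (at x))"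

definition monomial :: "('n::finite \<Rightarrow> nat) \<Rightarrow> real^'n \<Rightarrow> real"
  where "monomial \<alpha> x = (\<Prod>i\<in>UNIV. (x $ i) ^ \<alpha> i)"

definition schwartz :: "(real^'n \<Rightarrow> complex) set"
  where "schwartz = {\<phi>. smooth \<phi> \<and>
           (\<forall>\<alpha> \<beta>. bounded (range (\<lambda>x. monomial \<alpha> x *\<^sub>R partials \<beta> \<phi> x)))}"

definition schwartz_seminorm ::
    "('n::finite \<Rightarrow> nat) \<Rightarrow> 'n list \<Rightarrow> (real^'n \<Rightarrow> complex) \<Rightarrow> real"
  where "schwartz_seminorm \<alpha> \<beta> \<phi> = (SUP x. norm (monomial \<alpha> x *\<^sub>R partials \<beta> \<phi> x))"

definition schwartz_topology :: "(real^'n \<Rightarrow> complex) topology"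
  where "schwartz_topology = topology_generated_by
           {{\<psi> \<in> schwartz. schwartz_seminorm \<alpha> \<beta> (\<lambda>x. \<psi> x - \<phi> x) < \<epsilon>} | \<phi> \<alpha> \<beta> \<epsilon>.
              \<phi> \<in> schwartz \<and> \<epsilon> > 0}"

lemma partials_zero: "partials \<beta> (\<lambda>x. 0) = (\<lambda>x. 0)"
proof (induction \<beta>)
  case Nil
  show ?case by (simp add: partials_def)
next
  case (Cons i \<beta>)
  then show ?case by (simp add: partials_def partial_def fun_eq_iff)
qed

lemma topspace_schwartz_topology: "topspace schwartz_topology = schwartz"
proof
  show "topspace schwartz_topology \<subseteq> schwartz"
    by (auto simp: schwartz_topology_def)
  show "schwartz \<subseteq> topspace schwartz_topology"
  proof
    fix \<phi> :: "real^'n \<Rightarrow> complex"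
    assume \<phi>: "\<phi> \<in> schwartz"
    have "schwartz_seminorm (\<lambda>_. 0) [] (\<lambda>x. \<phi> x - \<phi> x) < 1"
      by (simp add: schwartz_seminorm_def partials_zero)
    moreover have "\<phi> \<in> {\<psi> \<in> schwartz. schwartz_seminorm (\<lambda>_. 0) [] (\<lambda>x. \<psi> x - \<phi> x) < 1}"
      using \<phi> calculation by blast
    ultimately show "\<phi> \<in> topspace schwartz_topology"
      unfolding schwartz_topology_def topology_generated_by_topspace
      using \<phi> zero_less_one by (intro UnionI CollectI exI conjI) (rule refl | assumption)+
  qed
qed

section \<open>Tempered distributions\<close>

text \<open>Distributions are represented by functionals on all functions; only their values on
  Schwartz functions are meaningful. \<^term>\<open>f \<phi>\<close> is the bilinear pairing of \<^term>\<open>f\<close>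
  with \<^term>\<open>\<phi>\<close>.\<close>

definition tempered_distribution :: "((real^'n \<Rightarrow> complex) \<Rightarrow> complex) \<Rightarrow> bool"
  where "tempered_distribution f \<longleftrightarrow>
           (\<forall>\<phi>\<in>schwartz. \<forall>\<psi>\<in>schwartz. f (\<lambda>u. \<phi> u + \<psi> u) = f \<phi> + f \<psi>) \<and>
           (\<forall>c. \<forall>\<phi>\<in>schwartz. f (\<lambda>u. c * \<phi> u) = c * f \<phi>) \<and>
           continuous_map schwartz_topology euclidean f"

section \<open>The windowed Fourier transform\<close>

text \<open>The integral in the definition of the transform is the pairing of the distribution
  \<^term>\<open>f\<close> with the remaining factors of the integrand, as a function of the integration
  variable \<^term>\<open>u\<close>.\<close>

definition windowed_fourier ::
    "(real^'n \<Rightarrow> complex) \<Rightarrow> ((real^'n \<Rightarrow> complex) \<Rightarrow> complex) \<Rightarrow> real^'n \<Rightarrow> real^'n \<Rightarrow> complex"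
  where "windowed_fourier g f x y =
           f (\<lambda>u. of_real ((2 * pi) powr (- (real CARD('n) / 2))) * g (u - y)
                    * exp (- \<i> * of_real (x \<bullet> u)))"

definition gaussian_window :: "real \<Rightarrow> real \<Rightarrow> real^'n \<Rightarrow> complex"
  where "gaussian_window c a x = of_real (c * exp (- (1/2) * a * (norm x)\<^sup>2))"

definition T_transform ::
    "real \<Rightarrow> real \<Rightarrow> ((real^'n \<Rightarrow> complex) \<Rightarrow> complex) \<Rightarrow> real^'n \<Rightarrow> complex"
  where "T_transform c a f x = windowed_fourier (gaussian_window c a) f x 0"

section \<open>Entire functions of several variables\<close>

definition entire :: "(complex^'n \<Rightarrow> complex) \<Rightarrow> bool"
  where "entire F \<longleftrightarrow>
           (\<forall>z. \<exists>D. (F has_derivative D) (at z) \<and> (\<forall>c v. D (c *s v) = c * D v))"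

definition complex_vec :: "real^'n \<Rightarrow> real^'n \<Rightarrow> complex^'n"
  where "complex_vec x y = (\<chi> j. of_real (x $ j) + \<i> * of_real (y $ j))"

definition growth_bound :: "real \<Rightarrow> (complex^'n \<Rightarrow> complex) \<Rightarrow> bool"
  where "growth_bound a F \<longleftrightarrow>
           (\<exists>(m::nat) (C::real). \<forall>x y. norm (F (complex_vec x y))
              \<le> C * (1 + (norm x)\<^sup>2 + (norm y)\<^sup>2) ^ m * exp (1/2 * inverse a * (norm y)\<^sup>2))"

end

theory Submission
  imports Defs "HOL-Complex_Analysis.Cauchy_Integral_Formula" "HOL-Probability.Characteristic_Functions"
    "HOL-Probability.Sinc_Integral"
begin

text \<open>For a tempered distribution \<open>f\<close>, the Gaussian \<open>u \<mapsto> exp (- a/2 * \<bar>u\<bar>\<^sup>2 - \<i> * (z \<bullet> u))\<close> depends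
  holomorphically on \<open>z = x + \<i> * y\<close> as an element of the Schwartz space, and completing the square
  bounds its Schwartz seminorms by a polynomial times \<open>exp (\<bar>y\<bar>\<^sup>2 / (2 * a))\<close>; pairing it with \<open>f\<close>
  gives the entire extension and its growth.

  Conversely, the growth bound says that \<open>V x y = exp (- \<bar>y\<bar>\<^sup>2 / (2 * a)) * F (x + \<i> * y)\<close> is
  polynomially bounded, whereas the windowed Fourier transform of a Schwartz function decays
  rapidly. Integrating \<open>V\<close> against the windowed Fourier transform of \<open>\<psi>\<close> therefore defines a tempered
  distribution. On the Gaussian with frequency \<open>w\<close> this integral is, after a translation, the
  integral of an entire function \<open>H\<close> with \<open>H 0 = F w\<close> against a rotation invariant Gaussian, which
  by the mean value property is a constant multiple of \<open>F w\<close>.\<close>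

section \<open>Smooth functions\<close>

text \<open>The modulus of the Gaussian with frequency \<open>x + \<i> * y\<close> peaks at
  \<open>u = y / a\<close> with height exp(|y|^2 / (2a)). Up to this height, a complex frequency
  therefore means a moved window, and a function on complex n-space becomes a candidate for a
  windowed transform on phase space; this is where the scaling \<open>y / a\<close> comes from.
  Integrating \<open>V\<close> against the transform of \<psi> is the usual synthesis of a
  distribution from its windowed transform.

  The obstacle is that \<open>V\<close> is not known to be such a transform, and synthesis followed
  by analysis alters a general function on phase space. Holomorphy of \<open>F\<close> makes it a
  fixed point, as in the reproducing formula of Fock space. The mean value property is applied to
  the circle acting on all coordinates at once, so Cauchy's formula in one variable is combined with
  the invariance of Lebesgue measure under rotations of pairs of vectors. Gaussians of real
  frequency are sufficient test functions, because the transform itself is a pairing with them; on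
  these the inner integral over \<open>u\<close> has a closed form.\<close>

lemma partials_Nil [simp]: "partials [] \<phi> = \<phi>"
  and partials_Cons: "partials (i # \<beta>) \<phi> = partial i (partials \<beta> \<phi>)"
  and partials_snoc: "partials (\<beta> @ [i]) \<phi> = partials \<beta> (partial i \<phi>)"
  by (simp_all add: partials_def)

lemma partial_eq_derivative:
  assumes "(\<phi> has_derivative D) (at x)"
  shows "partial i \<phi> x = D (axis i 1)"
proof -
  have "(\<phi> has_derivative D) (at (x + 0 *\<^sub>R axis i 1))"
    using assms by simp
  then have "((\<lambda>t::real. \<phi> (x + t *\<^sub>R axis i 1)) has_derivative (\<lambda>t. D (t *\<^sub>R axis i 1))) (at 0)"
    by (rule has_derivative_compose[rotated]) (auto intro!: derivative_eq_intros)
  moreover have "D (t *\<^sub>R axis i 1) = t *\<^sub>R D (axis i 1)" for t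
    using assms by (simp add: has_derivative_bounded_linear linear_simps bounded_linear.linear linear_scale)
  ultimately have "((\<lambda>t::real. \<phi> (x + t *\<^sub>R axis i 1)) has_vector_derivative D (axis i 1)) (at 0)"
    by (simp add: has_vector_derivative_def)
  then show ?thesis
    unfolding partial_def by (rule vector_derivative_at)
qed

lemma partial_has_vector_derivative:
  assumes "\<phi> differentiable (at (x + t *\<^sub>R axis i 1))"
  shows "((\<lambda>t. \<phi> (x + t *\<^sub>R axis i 1)) has_vector_derivative partial i \<phi> (x + t *\<^sub>R axis i 1)) (at t)"
proof -
  obtain D where D: "(\<phi> has_derivative D) (at (x + t *\<^sub>R axis i 1))"
    using assms by (auto simp: differentiable_def)
  then have "((\<lambda>t::real. \<phi> (x + t *\<^sub>R axis i 1)) has_derivative (\<lambda>t. D (t *\<^sub>R axis i 1))) (at t)"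
    by (rule has_derivative_compose[rotated]) (auto intro!: derivative_eq_intros)
  moreover have "D (t *\<^sub>R axis i 1) = t *\<^sub>R D (axis i 1)" for t
    using D by (simp add: has_derivative_bounded_linear linear_simps bounded_linear.linear linear_scale)
  ultimately show ?thesis
    using partial_eq_derivative[OF D] by (simp add: has_vector_derivative_def)
qed

lemma partial_add:
  assumes "\<phi> differentiable (at x)" "\<psi> differentiable (at x)"
  shows "partial i (\<lambda>x. \<phi> x + \<psi> x) x = partial i \<phi> x + partial i \<psi> x"
proof -
  obtain D E where D: "(\<phi> has_derivative D) (at x)" "(\<psi> has_derivative E) (at x)"
    using assms by (auto simp: differentiable_def)
  show ?thesis
    using partial_eq_derivative[OF has_derivative_add[OF D], of i]
    by (simp add: partial_eq_derivative[OF D(1)] partial_eq_derivative[OF D(2)])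
qed

lemma partial_mult:
  assumes "\<phi> differentiable (at x)" "\<psi> differentiable (at x)"
  shows "partial i (\<lambda>x. \<phi> x * \<psi> x) x = partial i \<phi> x * \<psi> x + \<phi> x * partial i \<psi> x"
proof -
  obtain D E where D: "(\<phi> has_derivative D) (at x)" "(\<psi> has_derivative E) (at x)"
    using assms by (auto simp: differentiable_def)
  show ?thesis
    using partial_eq_derivative[OF has_derivative_mult[OF D], of i]
    by (simp add: partial_eq_derivative[OF D(1)] partial_eq_derivative[OF D(2)])
qed

lemma partial_const [simp]: "partial i (\<lambda>x. k) = (\<lambda>x. 0)"
  by (simp add: partial_def fun_eq_iff)

text \<open>The iterated partials of \<phi> never have to be computed: a set of differentiable
  functions closed under \<open>partial\<close> contains all of them. Later instances of
  \<open>X\<close> are an algebra of functions, the constants, and Gaussians times symbols.\<close>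

lemma smooth_coinduct:
  assumes "\<phi> \<in> X"
    and "\<And>\<psi> x. \<psi> \<in> X \<Longrightarrow> \<psi> differentiable (at x)"
    and "\<And>\<psi> i. \<psi> \<in> X \<Longrightarrow> partial i \<psi> \<in> X"
  shows "smooth \<phi>"
proof -
  have "partials \<beta> \<phi> \<in> X" for \<beta>
    using assms(1,3) by (induction \<beta>) (auto simp: partials_Cons)
  then show ?thesis
    using assms(2) by (auto simp: smooth_def)
qed

lemma smooth_differentiable: "smooth \<phi> \<Longrightarrow> \<phi> differentiable (at x)"
  unfolding smooth_def by (metis partials_Nil)

lemma smooth_partial: "smooth \<phi> \<Longrightarrow> smooth (partial i \<phi>)"
  unfolding smooth_def by (metis partials_snoc)

lemma smooth_partials: "smooth \<phi> \<Longrightarrow> smooth (partials \<beta> \<phi>)"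
  by (induction \<beta>) (auto simp: partials_Cons smooth_partial)

lemma smooth_continuous: "smooth \<phi> \<Longrightarrow> continuous_on S \<phi>"
  by (auto intro: continuous_at_imp_continuous_on differentiable_imp_continuous_within smooth_differentiable)

text \<open>Products of smooth functions alone are not closed under \<open>partial\<close>, because
  the product rule yields sums of products. The generated algebra is closed and serves as the
  invariant set in \<open>smooth_coinduct\<close>.\<close>

inductive_set smooth_algebra :: "(real^'n \<Rightarrow> complex) set" where
  base: "smooth \<phi> \<Longrightarrow> \<phi> \<in> smooth_algebra"
| add: "\<phi> \<in> smooth_algebra \<Longrightarrow> \<psi> \<in> smooth_algebra \<Longrightarrow> (\<lambda>x. \<phi> x + \<psi> x) \<in> smooth_algebra"
| mult: "\<phi> \<in> smooth_algebra \<Longrightarrow> \<psi> \<in> smooth_algebra \<Longrightarrow> (\<lambda>x. \<phi> x * \<psi> x) \<in> smooth_algebra"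

lemma smooth_algebra_differentiable: "\<phi> \<in> smooth_algebra \<Longrightarrow> \<phi> differentiable (at x)"
  by (induction rule: smooth_algebra.induct)
    (auto simp: smooth_differentiable intro!: differentiable_add differentiable_mult)

lemma smooth_algebra_partial: "\<phi> \<in> smooth_algebra \<Longrightarrow> partial i \<phi> \<in> smooth_algebra"
proof (induction rule: smooth_algebra.induct)
  case (base \<phi>)
  then show ?case by (simp add: smooth_partial smooth_algebra.base)
next
  case (add \<phi> \<psi>)
  then have "partial i (\<lambda>x. \<phi> x + \<psi> x) = (\<lambda>x. partial i \<phi> x + partial i \<psi> x)"
    by (auto simp: fun_eq_iff partial_add smooth_algebra_differentiable)
  then show ?case
    using add by (simp add: smooth_algebra.add)
next
  case (mult \<phi> \<psi>)
  then have "partial i (\<lambda>x. \<phi> x * \<psi> x) = (\<lambda>x. partial i \<phi> x * \<psi> x + \<phi> x * partial i \<psi> x)"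
    by (auto simp: fun_eq_iff partial_mult smooth_algebra_differentiable)
  then show ?case
    using mult by (auto intro!: smooth_algebra.add smooth_algebra.mult)
qed

lemma smooth_algebra_smooth: "\<phi> \<in> smooth_algebra \<Longrightarrow> smooth \<phi>"
  by (rule smooth_coinduct[where X = smooth_algebra])
    (auto simp: smooth_algebra_differentiable smooth_algebra_partial)

lemma smooth_add: "smooth \<phi> \<Longrightarrow> smooth \<psi> \<Longrightarrow> smooth (\<lambda>x. \<phi> x + \<psi> x)"
  by (rule smooth_algebra_smooth, rule smooth_algebra.add; rule smooth_algebra.base)

lemma smooth_mult: "smooth \<phi> \<Longrightarrow> smooth \<psi> \<Longrightarrow> smooth (\<lambda>x. \<phi> x * \<psi> x)"
  by (rule smooth_algebra_smooth, rule smooth_algebra.mult; rule smooth_algebra.base)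

lemma smooth_const: "smooth (\<lambda>x. k)"
  by (rule smooth_coinduct[where X = "range (\<lambda>k x. k)"]) auto

lemma smooth_cmult: "smooth \<phi> \<Longrightarrow> smooth (\<lambda>x. k * \<phi> x)"
  by (simp add: smooth_const smooth_mult)

lemma partials_add:
  assumes "smooth \<phi>" "smooth \<psi>"
  shows "partials \<beta> (\<lambda>x. \<phi> x + \<psi> x) = (\<lambda>x. partials \<beta> \<phi> x + partials \<beta> \<psi> x)"
  by (induction \<beta>)
    (simp_all add: partials_Cons fun_eq_iff[of "partial _ _"] assms partial_add smooth_partials smooth_differentiable)

lemma partials_cmult:
  assumes "smooth \<phi>"
  shows "partials \<beta> (\<lambda>x. k * \<phi> x) = (\<lambda>x. k * partials \<beta> \<phi> x)"
  by (induction \<beta>)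
    (simp_all add: partials_Cons fun_eq_iff[of "partial _ _"] assms partial_mult smooth_partials smooth_differentiable)

lemma partial_translate: "partial i (\<lambda>x. \<phi> (x - v)) = (\<lambda>x. partial i \<phi> (x - v))"
  by (auto simp: partial_def fun_eq_iff algebra_simps)

lemma partials_translate: "partials \<beta> (\<lambda>x. \<phi> (x - v)) = (\<lambda>x. partials \<beta> \<phi> (x - v))"
  by (induction \<beta>) (auto simp: partials_Cons partial_translate)

lemma smooth_translate:
  assumes "smooth \<phi>"
  shows "smooth (\<lambda>x. \<phi> (x - v))"
  unfolding smooth_def partials_translate
proof (intro allI)
  fix \<beta> x
  have "(partials \<beta> \<phi> \<circ> (\<lambda>x. x - v)) differentiable (at x)"
    by (rule differentiable_chain_at) (use assms in \<open>auto simp: smooth_def\<close>)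
  then show "(\<lambda>x. partials \<beta> \<phi> (x - v)) differentiable (at x)"
    by (simp add: o_def)
qed

section \<open>Schwartz functions\<close>

lemma schwartz_smooth: "\<phi> \<in> schwartz \<Longrightarrow> smooth \<phi>"
  by (simp add: schwartz_def)

lemma schwartz_seminorm_bound:
  assumes "\<phi> \<in> schwartz"
  shows "norm (monomial \<alpha> x *\<^sub>R partials \<beta> \<phi> x) \<le> schwartz_seminorm \<alpha> \<beta> \<phi>"
proof -
  have "bounded (range (\<lambda>x. monomial \<alpha> x *\<^sub>R partials \<beta> \<phi> x))"
    using assms by (auto simp: schwartz_def)
  then have "bdd_above (range (\<lambda>x. norm (monomial \<alpha> x *\<^sub>R partials \<beta> \<phi> x)))"
    by (auto simp: bounded_iff bdd_above_def)
  then show ?thesis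
    unfolding schwartz_seminorm_def by (intro cSUP_upper) auto
qed

lemma schwartz_seminorm_le:
  assumes "\<And>x. norm (monomial \<alpha> x *\<^sub>R partials \<beta> \<phi> x) \<le> B"
  shows "schwartz_seminorm \<alpha> \<beta> \<phi> \<le> B"
  unfolding schwartz_seminorm_def using assms by (intro cSUP_least) auto

lemma schwartz_seminorm_nonneg: "\<phi> \<in> schwartz \<Longrightarrow> schwartz_seminorm \<alpha> \<beta> \<phi> \<ge> 0"
  using schwartz_seminorm_bound order_trans norm_ge_zero by blast

lemma abs_monomial_le: "\<bar>monomial \<alpha> x\<bar> \<le> (1 + (norm x)\<^sup>2) ^ sum \<alpha> UNIV"
proof -
  have *: "t \<le> 1 + t\<^sup>2" for t :: real
    using sum_power2_ge_zero[of "t - 1/2" 0] by (simp add: power2_eq_square algebra_simps)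
  have "\<bar>x $ i\<bar> \<le> 1 + (norm x)\<^sup>2" for i
    using component_le_norm_cart[of x i] *[of "norm x"] by linarith
  then have "(\<Prod>i\<in>UNIV. \<bar>x $ i\<bar> ^ \<alpha> i) \<le> (\<Prod>i\<in>UNIV. (1 + (norm x)\<^sup>2) ^ \<alpha> i)"
    by (intro prod_mono) (auto intro: power_mono)
  also have "\<dots> = (1 + (norm x)\<^sup>2) ^ sum \<alpha> UNIV"
    by (simp add: power_sum)
  finally show ?thesis
    by (simp add: monomial_def abs_prod power_abs)
qed

text \<open>Radial weights replace monomials in all later decay estimates: they are positive,
  multiply easily and behave well under translation.\<close>

lemma schwartzI:
  assumes "smooth \<phi>"
    and "\<And>N \<beta>. \<exists>B. \<forall>x. (1 + (norm x)\<^sup>2) ^ N * norm (partials \<beta> \<phi> x) \<le> B"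
  shows "\<phi> \<in> schwartz"
proof -
  have "bounded (range (\<lambda>x. monomial \<alpha> x *\<^sub>R partials \<beta> \<phi> x))" for \<alpha> \<beta>
  proof -
    obtain B where "(1 + (norm x)\<^sup>2) ^ sum \<alpha> UNIV * norm (partials \<beta> \<phi> x) \<le> B" for x
      using assms(2) by blast
    then have "norm (monomial \<alpha> x *\<^sub>R partials \<beta> \<phi> x) \<le> B" for x
      using mult_right_mono[OF abs_monomial_le, of "norm (partials \<beta> \<phi> x)" \<alpha> x]
      by (simp) (meson order_trans)
    then show ?thesis
      unfolding bounded_iff by blast
  qed
  then show ?thesis
    using assms(1) by (auto simp: schwartz_def)
qed

text \<open>A combination of the original seminorms that bounds the supremum of the radially
  weighted derivative without being that supremum. In this form its domination by finitely many
  Schwartz seminorms is immediate. The indices and the constant are those of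
  \<open>weight_le_monomials\<close>.\<close>

definition decay_seminorm :: "nat \<Rightarrow> 'n::finite list \<Rightarrow> (real^'n \<Rightarrow> complex) \<Rightarrow> real" where
  "decay_seminorm N \<beta> \<phi> = (1 + real CARD('n)) ^ N *
     (schwartz_seminorm (\<lambda>_. 0) \<beta> \<phi> + (\<Sum>i\<in>UNIV. schwartz_seminorm (\<lambda>k. if k = i then 2 * N else 0) \<beta> \<phi>))"

text \<open>The largest squared coordinate \<open>M\<close> controls |x|^2 at the price of the
  dimension, and \<open>M ^ N\<close> is one of the summands on the right. Even exponents keep the
  other summands nonnegative.\<close>

lemma weight_le_monomials:
  fixes x :: "real^'n"
  shows "(1 + (norm x)\<^sup>2) ^ N \<le> (1 + real CARD('n)) ^ N * (1 + (\<Sum>i\<in>UNIV. (x $ i) ^ (2 * N)))"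
proof -
  define M where "M = Max (range (\<lambda>i. (x $ i)\<^sup>2))"
  have M: "(x $ i)\<^sup>2 \<le> M" for i
    by (simp add: M_def)
  have "M \<in> range (\<lambda>i. (x $ i)\<^sup>2)"
    unfolding M_def by (rule Max_in) auto
  then obtain j where j: "M = (x $ j)\<^sup>2" by auto
  have "(norm x)\<^sup>2 = (\<Sum>i\<in>UNIV. (x $ i)\<^sup>2)"
    unfolding power2_norm_eq_inner inner_vec_def by (simp add: power2_eq_square)
  also have "\<dots> \<le> (\<Sum>i\<in>(UNIV::'n set). M)"
    by (intro sum_mono M)
  finally have 1: "(norm x)\<^sup>2 \<le> real CARD('n) * M" by simp
  have "1 + (norm x)\<^sup>2 \<le> (1 + real CARD('n)) * max 1 M"
  proof -
    have "real CARD('n) * M \<le> real CARD('n) * max 1 M"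
      by (intro mult_left_mono) auto
    then show ?thesis
      using 1 unfolding distrib_right mult_1 by linarith
  qed
  then have "(1 + (norm x)\<^sup>2) ^ N \<le> ((1 + real CARD('n)) * max 1 M) ^ N"
    by (intro power_mono) auto
  also have "\<dots> = (1 + real CARD('n)) ^ N * max 1 M ^ N"
    by (simp add: power_mult_distrib)
  also have "max 1 M ^ N \<le> 1 + M ^ N"
    using j by (auto simp: max_def)
  also have "M ^ N = (x $ j) ^ (2 * N)"
    by (simp add: j power_mult)
  also have "\<dots> \<le> (\<Sum>i\<in>UNIV. (x $ i) ^ (2 * N))"
    by (rule member_le_sum) auto
  finally show ?thesis
    by (simp add: mult_left_mono)
qed

lemma decay_seminorm_bound:
  fixes \<phi> :: "real^'n \<Rightarrow> complex"
  assumes "\<phi> \<in> schwartz"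
  shows "(1 + (norm x)\<^sup>2) ^ N * norm (partials \<beta> \<phi> x) \<le> decay_seminorm N \<beta> \<phi>"
proof -
  have "(1 + (norm x)\<^sup>2) ^ N * norm (partials \<beta> \<phi> x)
      \<le> (1 + real CARD('n)) ^ N * ((1 + (\<Sum>i\<in>UNIV. (x $ i) ^ (2 * N))) * norm (partials \<beta> \<phi> x))"
    using mult_right_mono[OF weight_le_monomials[of x N], of "norm (partials \<beta> \<phi> x)"] by (simp add: mult.assoc)
  also have "\<dots> \<le> decay_seminorm N \<beta> \<phi>"
    unfolding decay_seminorm_def
  proof (intro mult_left_mono)
    have m: "monomial (\<lambda>k. if k = i then 2 * N else 0) x = (x $ i) ^ (2 * N)" for i
      unfolding monomial_def by (subst prod.remove[of _ i]) (auto intro!: prod.neutral)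
    have "norm (partials \<beta> \<phi> x) \<le> schwartz_seminorm (\<lambda>_. 0) \<beta> \<phi>"
      using schwartz_seminorm_bound[OF assms, of "\<lambda>_. 0" x \<beta>] by (simp add: monomial_def)
    moreover have "(x $ i) ^ (2 * N) * norm (partials \<beta> \<phi> x)
        \<le> schwartz_seminorm (\<lambda>k. if k = i then 2 * N else 0) \<beta> \<phi>" for i
      using schwartz_seminorm_bound[OF assms, of "\<lambda>k. if k = i then 2 * N else 0" x \<beta>]
      by (simp add: m)
    ultimately show "(1 + (\<Sum>i\<in>UNIV. (x $ i) ^ (2 * N))) * norm (partials \<beta> \<phi> x)
      \<le> schwartz_seminorm (\<lambda>_. 0) \<beta> \<phi> + (\<Sum>i\<in>UNIV. schwartz_seminorm (\<lambda>k. if k = i then 2 * N else 0) \<beta> \<phi>)"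
      by (auto simp: algebra_simps sum_distrib_left intro!: add_mono sum_mono)
  qed auto
  finally show ?thesis .
qed

lemma decay_seminorm_nonneg: "\<phi> \<in> schwartz \<Longrightarrow> decay_seminorm N \<beta> \<phi> \<ge> 0"
  using decay_seminorm_bound[of \<phi> 0 N \<beta>] norm_ge_zero[of "partials \<beta> \<phi> 0"] by (simp del: norm_ge_zero)

section \<open>Vector space structure of the Schwartz space\<close>

lemma schwartz_add:
  assumes "\<phi> \<in> schwartz" "\<psi> \<in> schwartz"
  shows "(\<lambda>x. \<phi> x + \<psi> x) \<in> schwartz"
proof (rule schwartzI)
  fix N \<beta>
  have "(1 + (norm x)\<^sup>2) ^ N * norm (partials \<beta> (\<lambda>x. \<phi> x + \<psi> x) x)
      \<le> decay_seminorm N \<beta> \<phi> + decay_seminorm N \<beta> \<psi>" for x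
  proof -
    have "(1 + (norm x)\<^sup>2) ^ N * norm (partials \<beta> \<phi> x + partials \<beta> \<psi> x)
      \<le> (1 + (norm x)\<^sup>2) ^ N * (norm (partials \<beta> \<phi> x) + norm (partials \<beta> \<psi> x))"
      by (intro mult_left_mono norm_triangle_ineq) auto
    also have "\<dots> \<le> decay_seminorm N \<beta> \<phi> + decay_seminorm N \<beta> \<psi>"
      unfolding distrib_left by (intro add_mono decay_seminorm_bound assms)
    finally show ?thesis
      using assms by (simp add: partials_add schwartz_smooth)
  qed
  then show "\<exists>B. \<forall>x. (1 + (norm x)\<^sup>2) ^ N * norm (partials \<beta> (\<lambda>x. \<phi> x + \<psi> x) x) \<le> B"
    by blast
qed (use assms in \<open>auto intro: smooth_add schwartz_smooth\<close>)

lemma schwartz_cmult: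
  assumes "\<phi> \<in> schwartz"
  shows "(\<lambda>x. k * \<phi> x) \<in> schwartz"
proof (rule schwartzI)
  fix N \<beta>
  have "(1 + (norm x)\<^sup>2) ^ N * norm (partials \<beta> (\<lambda>x. k * \<phi> x) x)
      \<le> norm k * decay_seminorm N \<beta> \<phi>" for x
    using mult_left_mono[OF decay_seminorm_bound[OF assms, of x N \<beta>], of "norm k"] assms
    by (simp add: partials_cmult schwartz_smooth norm_mult algebra_simps)
  then show "\<exists>B. \<forall>x. (1 + (norm x)\<^sup>2) ^ N * norm (partials \<beta> (\<lambda>x. k * \<phi> x) x) \<le> B"
    by blast
qed (use assms in \<open>auto intro: smooth_cmult schwartz_smooth\<close>)

lemma schwartz_diff: "\<phi> \<in> schwartz \<Longrightarrow> \<psi> \<in> schwartz \<Longrightarrow> (\<lambda>x. \<phi> x - \<psi> x) \<in> schwartz"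
  using schwartz_add[of \<phi> "\<lambda>x. -1 * \<psi> x"] schwartz_cmult[of \<psi> "-1"] by simp

lemma schwartz_seminorm_add:
  assumes "\<phi> \<in> schwartz" "\<psi> \<in> schwartz"
  shows "schwartz_seminorm \<alpha> \<beta> (\<lambda>x. \<phi> x + \<psi> x) \<le> schwartz_seminorm \<alpha> \<beta> \<phi> + schwartz_seminorm \<alpha> \<beta> \<psi>"
proof (rule schwartz_seminorm_le)
  fix x
  have "norm (monomial \<alpha> x *\<^sub>R partials \<beta> (\<lambda>x. \<phi> x + \<psi> x) x)
      \<le> norm (monomial \<alpha> x *\<^sub>R partials \<beta> \<phi> x) + norm (monomial \<alpha> x *\<^sub>R partials \<beta> \<psi> x)"
    using assms by (simp only: partials_add schwartz_smooth scaleR_add_right norm_triangle_ineq)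
  also have "\<dots> \<le> schwartz_seminorm \<alpha> \<beta> \<phi> + schwartz_seminorm \<alpha> \<beta> \<psi>"
    by (intro add_mono schwartz_seminorm_bound assms)
  finally show "norm (monomial \<alpha> x *\<^sub>R partials \<beta> (\<lambda>x. \<phi> x + \<psi> x) x)
      \<le> schwartz_seminorm \<alpha> \<beta> \<phi> + schwartz_seminorm \<alpha> \<beta> \<psi>" .
qed

lemma schwartz_seminorm_cmult_le:
  assumes "\<phi> \<in> schwartz"
  shows "schwartz_seminorm \<alpha> \<beta> (\<lambda>x. k * \<phi> x) \<le> norm k * schwartz_seminorm \<alpha> \<beta> \<phi>"
proof (rule schwartz_seminorm_le)
  fix x
  show "norm (monomial \<alpha> x *\<^sub>R partials \<beta> (\<lambda>x. k * \<phi> x) x) \<le> norm k * schwartz_seminorm \<alpha> \<beta> \<phi>"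
    using mult_left_mono[OF schwartz_seminorm_bound[OF assms, of \<alpha> x \<beta>], of "norm k"] assms
    by (simp add: partials_cmult schwartz_smooth norm_mult algebra_simps)
qed

section \<open>Finite sums of seminorms and domination by them\<close>

definition seminorm_sum :: "(('n::finite \<Rightarrow> nat) \<times> 'n list) list \<Rightarrow> (real^'n \<Rightarrow> complex) \<Rightarrow> real" where
  "seminorm_sum ps \<phi> = (\<Sum>(\<alpha>, \<beta>)\<leftarrow>ps. schwartz_seminorm \<alpha> \<beta> \<phi>)"

text \<open>For the modulus of a linear functional this amounts to continuity, by
  \<open>tempered_distribution_iff\<close>. It is stated for arbitrary real functions
  \<open>p\<close> so that bounds can be assembled from sums and nonnegative multiples. Index lists
  rather than sets make concatenation additive, even with repeated indices.\<close>

definition seminorm_dominated :: "((real^'n \<Rightarrow> complex) \<Rightarrow> real) \<Rightarrow> bool" where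
  "seminorm_dominated p \<longleftrightarrow> (\<exists>C ps. \<forall>\<phi>\<in>schwartz. p \<phi> \<le> C * seminorm_sum ps \<phi>)"

lemma seminorm_sum_nonneg: "\<phi> \<in> schwartz \<Longrightarrow> seminorm_sum ps \<phi> \<ge> 0"
  unfolding seminorm_sum_def by (intro sum_list_nonneg) (auto simp: schwartz_seminorm_nonneg)

lemma seminorm_sum_append: "seminorm_sum (ps @ qs) \<phi> = seminorm_sum ps \<phi> + seminorm_sum qs \<phi>"
  by (simp add: seminorm_sum_def)

lemma seminorm_dominated_mono:
  assumes "seminorm_dominated q" "\<And>\<phi>. \<phi> \<in> schwartz \<Longrightarrow> p \<phi> \<le> q \<phi>"
  shows "seminorm_dominated p"
  using assms unfolding seminorm_dominated_def by (meson order_trans)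

lemma seminorm_dominated_zero: "seminorm_dominated (\<lambda>\<phi>. 0)"
  unfolding seminorm_dominated_def by (intro exI[of _ 0]) auto

lemma seminorm_dominated_add:
  assumes "seminorm_dominated p" "seminorm_dominated q"
  shows "seminorm_dominated (\<lambda>\<phi>. p \<phi> + q \<phi>)"
proof -
  obtain C ps D qs where *: "\<And>\<phi>. \<phi> \<in> schwartz \<Longrightarrow> p \<phi> \<le> C * seminorm_sum ps \<phi>"
    "\<And>\<phi>. \<phi> \<in> schwartz \<Longrightarrow> q \<phi> \<le> D * seminorm_sum qs \<phi>"
    using assms unfolding seminorm_dominated_def by metis
  have "p \<phi> + q \<phi> \<le> (\<bar>C\<bar> + \<bar>D\<bar>) * seminorm_sum (ps @ qs) \<phi>" if "\<phi> \<in> schwartz" for \<phi>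
  proof -
    have "C * seminorm_sum ps \<phi> \<le> (\<bar>C\<bar> + \<bar>D\<bar>) * seminorm_sum ps \<phi>"
      "D * seminorm_sum qs \<phi> \<le> (\<bar>C\<bar> + \<bar>D\<bar>) * seminorm_sum qs \<phi>"
      using that by (auto intro!: mult_right_mono seminorm_sum_nonneg)
    then show ?thesis
      using *[OF that] by (simp add: seminorm_sum_append algebra_simps)
  qed
  then show ?thesis
    unfolding seminorm_dominated_def by blast
qed

lemma seminorm_dominated_cmult:
  assumes "seminorm_dominated p" "c \<ge> 0"
  shows "seminorm_dominated (\<lambda>\<phi>. c * p \<phi>)"
  using assms unfolding seminorm_dominated_def by (metis mult.assoc mult_left_mono)

lemma seminorm_dominated_sum:
  assumes "finite I" "\<And>i. i \<in> I \<Longrightarrow> seminorm_dominated (p i)"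
  shows "seminorm_dominated (\<lambda>\<phi>. \<Sum>i\<in>I. p i \<phi>)"
  using assms by (induction I) (auto intro: seminorm_dominated_zero seminorm_dominated_add)

lemma seminorm_dominated_sum_list:
  assumes "\<And>i. i \<in> set xs \<Longrightarrow> seminorm_dominated (p i)"
  shows "seminorm_dominated (\<lambda>\<phi>. \<Sum>i\<leftarrow>xs. p i \<phi>)"
  using assms by (induction xs) (auto intro: seminorm_dominated_zero seminorm_dominated_add)

lemma seminorm_dominated_schwartz_seminorm: "seminorm_dominated (schwartz_seminorm \<alpha> \<beta>)"
  unfolding seminorm_dominated_def by (intro exI[of _ 1] exI[of _ "[(\<alpha>, \<beta>)]"]) (simp add: seminorm_sum_def)

lemma seminorm_dominated_decay_seminorm: "seminorm_dominated (decay_seminorm N \<beta>)"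
  unfolding decay_seminorm_def
  by (intro seminorm_dominated_cmult seminorm_dominated_add seminorm_dominated_sum
      seminorm_dominated_schwartz_seminorm) auto

section \<open>Continuity of linear functionals\<close>

text \<open>The generating sets restrict one seminorm each, around arbitrary centres. Intersections
  are handled by concatenating index lists, and a generating set is recentred at \<phi> by the
  triangle inequality.\<close>

lemma schwartz_open_contains_ball:
  fixes \<phi> :: "real^'n \<Rightarrow> complex"
  assumes "openin schwartz_topology U" "\<phi> \<in> U"
  shows "\<exists>ps \<epsilon>. \<epsilon> > 0 \<and> (\<forall>\<psi>\<in>schwartz. seminorm_sum ps (\<lambda>x. \<psi> x - \<phi> x) < \<epsilon> \<longrightarrow> \<psi> \<in> U)"
proof -
  let ?S = "{{\<psi> \<in> schwartz. schwartz_seminorm \<alpha> \<beta> (\<lambda>x. \<psi> x - \<phi> x) < \<epsilon>} | \<phi> \<alpha> \<beta> \<epsilon>.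
              \<phi> \<in> (schwartz :: (real^'n \<Rightarrow> complex) set) \<and> \<epsilon> > 0}"
  have sub: "\<phi> \<in> U \<Longrightarrow> \<phi> \<in> schwartz" if "openin schwartz_topology U" for U :: "(real^'n \<Rightarrow> complex) set" and \<phi>
    using openin_subset[OF that] by (auto simp: topspace_schwartz_topology)
  have "generate_topology_on ?S U"
    using assms(1) unfolding schwartz_topology_def openin_topology_generated_by_iff .
  then show ?thesis
    using assms(2)
  proof (induction arbitrary: \<phi> rule: generate_topology_on.induct)
    case Empty
    then show ?case by simp
  next
    case (Int A B)
    \<comment> \<open>Membership in \<open>schwartz\<close> makes both partial sums nonnegative, so
      that each is bounded by the sum over \<open>ps @ qs\<close>.\<close>
    have "\<phi> \<in> schwartz"
      using Int.prems sub[of A \<phi>, unfolded schwartz_topology_def openin_topology_generated_by_iff, OF Int.hyps(1)]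
      by blast
    obtain ps \<epsilon> where
      1: "\<epsilon> > 0" "\<And>\<psi>. \<psi> \<in> schwartz \<Longrightarrow> seminorm_sum ps (\<lambda>x. \<psi> x - \<phi> x) < \<epsilon> \<Longrightarrow> \<psi> \<in> A"
      using Int.IH(1) Int.prems by blast
    obtain qs \<delta> where
      2: "\<delta> > 0" "\<And>\<psi>. \<psi> \<in> schwartz \<Longrightarrow> seminorm_sum qs (\<lambda>x. \<psi> x - \<phi> x) < \<delta> \<Longrightarrow> \<psi> \<in> B"
      using Int.IH(2) Int.prems by blast
    have "\<psi> \<in> A \<inter> B" if "\<psi> \<in> schwartz" "seminorm_sum (ps @ qs) (\<lambda>x. \<psi> x - \<phi> x) < min \<epsilon> \<delta>" for \<psi>
    proof -
      have "seminorm_sum ps (\<lambda>x. \<psi> x - \<phi> x) \<ge> 0" "seminorm_sum qs (\<lambda>x. \<psi> x - \<phi> x) \<ge> 0"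
        using that \<open>\<phi> \<in> schwartz\<close> by (auto intro!: seminorm_sum_nonneg schwartz_diff)
      then show ?thesis
        using 1(2)[OF that(1)] 2(2)[OF that(1)] that(2) by (auto simp: seminorm_sum_append)
    qed
    then show ?case
      using 1(1) 2(1) by (intro exI[of _ "ps @ qs"] exI[of _ "min \<epsilon> \<delta>"]) auto
  next
    case (UN K)
    then show ?case by (meson UnionE UnionI)
  next
    case (Basis s)
    then obtain \<phi>0 \<alpha> \<beta> \<epsilon> where s: "\<phi>0 \<in> schwartz" "\<epsilon> > 0"
      "s = {\<psi> \<in> schwartz. schwartz_seminorm \<alpha> \<beta> (\<lambda>x. \<psi> x - \<phi>0 x) < \<epsilon>}"
      by blast
    let ?d = "schwartz_seminorm \<alpha> \<beta> (\<lambda>x. \<phi> x - \<phi>0 x)"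
    have d: "?d < \<epsilon>" "\<phi> \<in> schwartz" using Basis s by auto
    have "\<psi> \<in> s" if "\<psi> \<in> schwartz" "seminorm_sum [(\<alpha>, \<beta>)] (\<lambda>x. \<psi> x - \<phi> x) < \<epsilon> - ?d" for \<psi>
    proof -
      have "schwartz_seminorm \<alpha> \<beta> (\<lambda>x. (\<psi> x - \<phi> x) + (\<phi> x - \<phi>0 x))
          \<le> schwartz_seminorm \<alpha> \<beta> (\<lambda>x. \<psi> x - \<phi> x) + ?d"
        using that d s by (intro schwartz_seminorm_add schwartz_diff)
      then show ?thesis
        using that s by (simp add: seminorm_sum_def)
    qed
    then show ?case
      using d by (intro exI[of _ "[(\<alpha>, \<beta>)]"] exI[of _ "\<epsilon> - ?d"]) auto
  qed
qed

text \<open>A ball of a sum of seminorms contains an intersection of balls of the single seminorms;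
  half of the remaining radius is spent on each list entry. An open set between \<phi> and the ball
  is all that the continuity proof asks for.\<close>

lemma schwartz_ball_open:
  assumes "\<phi> \<in> schwartz" "\<epsilon> > 0"
  shows "\<exists>U. openin schwartz_topology U \<and> \<phi> \<in> U \<and>
    (\<forall>\<psi>\<in>U. \<psi> \<in> schwartz \<and> seminorm_sum ps (\<lambda>x. \<psi> x - \<phi> x) < \<epsilon>)"
  using assms(2)
proof (induction ps arbitrary: \<epsilon>)
  case Nil
  then show ?case
    using assms(1) openin_topspace[of schwartz_topology]
    by (intro exI[of _ schwartz]) (simp add: seminorm_sum_def topspace_schwartz_topology)
next
  case (Cons p ps)
  obtain \<alpha> \<beta> where p: "p = (\<alpha>, \<beta>)" by fastforce
  obtain U where U: "openin schwartz_topology U" "\<phi> \<in> U"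
    "\<And>\<psi>. \<psi> \<in> U \<Longrightarrow> \<psi> \<in> schwartz \<and> seminorm_sum ps (\<lambda>x. \<psi> x - \<phi> x) < \<epsilon> / 2"
    using Cons.IH[of "\<epsilon> / 2"] Cons.prems by auto
  let ?V = "{\<psi> \<in> schwartz. schwartz_seminorm \<alpha> \<beta> (\<lambda>x. \<psi> x - \<phi> x) < \<epsilon> / 2}"
  have V: "openin schwartz_topology ?V"
    unfolding schwartz_topology_def openin_topology_generated_by_iff
    using assms(1) Cons.prems by (intro generate_topology_on.Basis) (blast intro: half_gt_zero)
  have "schwartz_seminorm \<alpha> \<beta> (\<lambda>x. 0) = 0"
    by (simp add: schwartz_seminorm_def partials_zero)
  then show ?case
    using U V assms(1) Cons.prems
    by (intro exI[of _ "U \<inter> ?V"]) (fastforce simp: seminorm_sum_def p intro: openin_Int)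
qed

lemma tempered_distribution_add:
  "tempered_distribution f \<Longrightarrow> \<phi> \<in> schwartz \<Longrightarrow> \<psi> \<in> schwartz \<Longrightarrow> f (\<lambda>u. \<phi> u + \<psi> u) = f \<phi> + f \<psi>"
  by (simp add: tempered_distribution_def)

lemma tempered_distribution_cmult:
  "tempered_distribution f \<Longrightarrow> \<phi> \<in> schwartz \<Longrightarrow> f (\<lambda>u. k * \<phi> u) = k * f \<phi>"
  by (simp add: tempered_distribution_def)

text \<open>A neighbourhood of 0 on which |f| < 1 gives the bound by homogeneity; conversely,
  linearity carries the bound to differences. If \<open>f\<close> is not linear, both sides are
  false because of their first two conjuncts.\<close>

lemma tempered_distribution_iff:
  "tempered_distribution f \<longleftrightarrow>
    (\<forall>\<phi>\<in>schwartz. \<forall>\<psi>\<in>schwartz. f (\<lambda>u. \<phi> u + \<psi> u) = f \<phi> + f \<psi>) \<and>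
    (\<forall>k. \<forall>\<phi>\<in>schwartz. f (\<lambda>u. k * \<phi> u) = k * f \<phi>) \<and>
    seminorm_dominated (\<lambda>\<phi>. norm (f \<phi>))" (is "_ \<longleftrightarrow> ?A \<and> ?B \<and> ?C")
proof (cases "?A \<and> ?B")
  case True
  have scale: "f (\<lambda>u. k * \<phi> u) = k * f \<phi>" if "\<phi> \<in> schwartz" for \<phi> k
    using True that by blast
  have diff: "f (\<lambda>u. \<psi> u - \<phi> u) = f \<psi> - f \<phi>" if "\<phi> \<in> schwartz" "\<psi> \<in> schwartz" for \<phi> \<psi>
  proof -
    have add: "f (\<lambda>u. \<phi> u + \<psi> u) = f \<phi> + f \<psi>" if "\<phi> \<in> schwartz" "\<psi> \<in> schwartz" for \<phi> \<psi>
      using True that by blast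
    have "f (\<lambda>u. \<psi> u + -1 * \<phi> u) = f \<psi> + f (\<lambda>u. -1 * \<phi> u)"
      by (rule add[OF that(2) schwartz_cmult[OF that(1)]])
    then show ?thesis
      using scale[OF that(1), of "-1"] by simp
  qed
  have "continuous_map schwartz_topology euclidean f \<longleftrightarrow> ?C"
  proof
    assume cont: "continuous_map schwartz_topology euclidean f"
    have zero: "(\<lambda>_::real^'a. 0::complex) \<in> schwartz"
      by (intro schwartzI) (auto simp: smooth_const partials_zero)
    have f0: "f (\<lambda>_. 0) = 0"
      using scale[OF zero, of 0] by simp
    have "openin schwartz_topology {\<phi> \<in> schwartz. f \<phi> \<in> ball 0 1}"
      using openin_continuous_map_preimage[OF cont, of "ball 0 1"] by (simp add: topspace_schwartz_topology)
    then obtain ps \<epsilon> where *: "\<epsilon> > 0"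
      "\<And>\<psi>. \<psi> \<in> schwartz \<Longrightarrow> seminorm_sum ps \<psi> < \<epsilon> \<Longrightarrow> norm (f \<psi>) < 1"
      using schwartz_open_contains_ball[of "{\<phi> \<in> schwartz. f \<phi> \<in> ball 0 1}" "\<lambda>_. 0"] zero f0 by auto
    have "norm (f \<phi>) \<le> (1 / \<epsilon>) * seminorm_sum ps \<phi>" if \<phi>: "\<phi> \<in> schwartz" for \<phi>
    proof -
      have "norm (f \<phi>) * \<epsilon> \<le> seminorm_sum ps \<phi> + \<delta>" if \<delta>: "\<delta> > 0" for \<delta>
      proof -
        let ?s = "seminorm_sum ps \<phi>"
        have s: "?s \<ge> 0" using \<phi> by (rule seminorm_sum_nonneg)
        \<comment> \<open>Scaling by \<open>t\<close> moves \<phi> into the ball of radius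
          \<epsilon>. Adding \<delta> keeps the denominator positive when the seminorm sum of \<phi>
          is zero; it is removed again by \<open>field_le_epsilon\<close>.\<close>
        define t where "t = \<epsilon> / (?s + \<delta>)"
        have t: "t > 0" using s \<delta> * by (simp add: t_def)
        have "seminorm_sum ps (\<lambda>u. of_real t * \<phi> u) \<le> t * ?s"
          unfolding seminorm_sum_def sum_list_const_mult[symmetric]
          using schwartz_seminorm_cmult_le[OF \<phi>, of _ _ "of_real t"] t
          by (intro sum_list_mono) auto
        also have "\<dots> < \<epsilon>"
          using s \<delta> * by (simp add: t_def field_simps)
        finally have "norm (f (\<lambda>u. of_real t * \<phi> u)) < 1"
          using *(2) schwartz_cmult[OF \<phi>] by blast
        then have "t * norm (f \<phi>) < 1"
          using t by (simp add: scale[OF \<phi>] norm_mult)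
        then show ?thesis
          using s \<delta> by (simp add: t_def field_simps)
      qed
      then have "norm (f \<phi>) * \<epsilon> \<le> seminorm_sum ps \<phi>"
        by (rule field_le_epsilon)
      then show ?thesis
        using * by (simp add: field_simps)
    qed
    then show ?C
      unfolding seminorm_dominated_def by blast
  next
    assume ?C
    then obtain C ps where C: "\<And>\<phi>. \<phi> \<in> schwartz \<Longrightarrow> norm (f \<phi>) \<le> C * seminorm_sum ps \<phi>"
      by (auto simp: seminorm_dominated_def)
    have "openin schwartz_topology {\<phi> \<in> schwartz. f \<phi> \<in> V}" if "open V" for V
    proof (subst openin_subopen, safe)
      fix \<phi> assume \<phi>: "\<phi> \<in> schwartz" "f \<phi> \<in> V"
      then obtain e where e: "e > 0" "ball (f \<phi>) e \<subseteq> V"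
        using \<open>open V\<close> openE by blast
      obtain U where U: "openin schwartz_topology U" "\<phi> \<in> U"
        "\<And>\<psi>. \<psi> \<in> U \<Longrightarrow> \<psi> \<in> schwartz \<and> seminorm_sum ps (\<lambda>x. \<psi> x - \<phi> x) < e / (\<bar>C\<bar> + 1)"
        using schwartz_ball_open[OF \<phi>(1), of "e / (\<bar>C\<bar> + 1)" ps] e by auto
      have "f \<psi> \<in> V" if \<psi>: "\<psi> \<in> U" for \<psi>
      proof -
        let ?s = "seminorm_sum ps (\<lambda>x. \<psi> x - \<phi> x)"
        have \<psi>': "\<psi> \<in> schwartz" "?s < e / (\<bar>C\<bar> + 1)" "?s \<ge> 0"
          using U(3)[OF \<psi>] \<phi> by (auto intro!: seminorm_sum_nonneg schwartz_diff)
        have "norm (f \<psi> - f \<phi>) \<le> C * ?s"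
          using C[OF schwartz_diff[OF \<psi>'(1) \<phi>(1)]] diff[OF \<phi>(1) \<psi>'(1)] by simp
        also have "\<dots> \<le> (\<bar>C\<bar> + 1) * ?s"
          using \<psi>'(3) by (intro mult_right_mono) auto
        also have "\<dots> < e"
          using \<psi>'(2) by (simp add: field_simps)
        finally show ?thesis
          using e by (auto simp: dist_norm norm_minus_commute)
      qed
      then show "\<exists>T. openin schwartz_topology T \<and> \<phi> \<in> T \<and> T \<subseteq> {\<phi> \<in> schwartz. f \<phi> \<in> V}"
        using U by (intro exI[of _ U]) auto
    qed
    then show "continuous_map schwartz_topology euclidean f"
      by (simp add: continuous_map_def topspace_schwartz_topology)
  qed
  then show ?thesis
    using True by (simp add: tempered_distribution_def)
next
  case False
  then show ?thesis
    by (auto simp: tempered_distribution_def)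
qed

section \<open>Gaussians with complex frequency\<close>

text \<open>Bilinear, without conjugation, so that the Gaussian below depends holomorphically on
  \<open>z\<close>; for real \<open>z\<close> it is the inner product.\<close>

definition cdot :: "complex^'n \<Rightarrow> real^'n \<Rightarrow> complex" where
  "cdot z u = (\<Sum>i\<in>UNIV. z $ i * of_real (u $ i))"

text \<open>The kernel of the transform with its constants removed and the frequency made complex.
  At \<open>z = 0\<close> it is the bare window, and in this role it reappears in
  \<open>inversion_integral\<close>.\<close>

definition gauss_exp :: "real \<Rightarrow> complex^'n \<Rightarrow> real^'n \<Rightarrow> complex" where
  "gauss_exp a z u = exp (of_real (- (a / 2) * (norm u)\<^sup>2) - \<i> * cdot z u)"

lemma cdot_add: "cdot (z + h) u = cdot z u + cdot h u"
  by (simp add: cdot_def distrib_right sum.distrib)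

lemma gauss_exp_add: "gauss_exp a (z + h) u = gauss_exp a z u * exp (- \<i> * cdot h u)"
proof -
  have "of_real (- (a / 2) * (norm u)\<^sup>2) - \<i> * cdot (z + h) u
      = (of_real (- (a / 2) * (norm u)\<^sup>2) - \<i> * cdot z u) + (- \<i> * cdot h u)"
    by (simp add: cdot_add algebra_simps)
  then show ?thesis
    by (simp only: gauss_exp_def exp_add)
qed

lemma norm_cdot_le: "norm (cdot h u) \<le> norm h * norm u"
proof -
  have "norm (cdot h u) \<le> (\<Sum>i\<in>UNIV. norm (h $ i) * norm (u $ i))"
    unfolding cdot_def by (rule order_trans[OF norm_sum]) (simp add: norm_mult)
  also have "\<dots> \<le> norm h * norm u"
    using L2_set_mult_ineq[of "\<lambda>i. norm (h $ i)" "\<lambda>i. norm (u $ i)" UNIV] by (simp add: norm_vec_def)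
  finally show ?thesis .
qed

lemma cdot_axis: "cdot z (axis i 1) = z $ i"
proof -
  have "cdot z (axis i 1) = (\<Sum>j\<in>UNIV. if j = i then z $ i else 0)"
    unfolding cdot_def by (intro sum.cong) (auto simp: axis_def)
  then show ?thesis by simp
qed

lemma has_derivative_cdot: "(cdot z has_derivative cdot z) (at u)"
  unfolding cdot_def[abs_def]
  by (auto intro!: derivative_eq_intros simp: bounded_linear_vec_nth bounded_linear_of_real
      intro: bounded_linear_imp_has_derivative bounded_linear_compose)

lemma has_derivative_gauss_exp:
  "(gauss_exp a z has_derivative (\<lambda>v. gauss_exp a z u * (- of_real (a * (u \<bullet> v)) - \<i> * cdot z v))) (at u)"
proof -
  have "((\<lambda>u. of_real (- (a / 2) * (u \<bullet> u)) - \<i> * cdot z u) has_derivative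
      (\<lambda>v. of_real (- (a / 2) * (u \<bullet> v + v \<bullet> u)) - \<i> * cdot z v)) (at u)"
    by (intro has_derivative_diff has_derivative_of_real has_derivative_mult_right has_derivative_inner
        has_derivative_ident has_derivative_cdot)
  from has_derivative_compose[OF this DERIV_exp[unfolded has_field_derivative_def]]
  show ?thesis
    by (simp add: gauss_exp_def[abs_def] power2_norm_eq_inner inner_commute)
qed

lemma partial_gauss_exp:
  "partial i (gauss_exp a z) u = gauss_exp a z u * (- of_real (a * u $ i) - \<i> * z $ i)"
  by (simp add: partial_eq_derivative[OF has_derivative_gauss_exp] cdot_axis inner_axis)

lemma norm_gauss_exp:
  "norm (gauss_exp a z u) = exp (- (a / 2) * (norm u)\<^sup>2 + (\<chi> i. Im (z $ i)) \<bullet> u)"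
  by (simp add: gauss_exp_def cdot_def inner_vec_def Im_sum)

text \<open>\<open>symbol_class k\<close> consists of functions of order \<open>\<bar>h\<bar>^k\<close> for small \<open>h\<close>. Its members of order 2 include
  the second-order Taylor remainder of \<open>exp (- \<i> * cdot h u)\<close> in \<open>h\<close>, and the closure of the
  class under the partial derivatives in \<open>u\<close> gives estimates of its Schwartz seminorms.\<close>

inductive symbol_class :: "nat \<Rightarrow> (complex^'n \<Rightarrow> complex^'n \<Rightarrow> real^'n \<Rightarrow> complex) \<Rightarrow> bool" where
  zero: "symbol_class k (\<lambda>z h u. 0)"
| const: "symbol_class 0 (\<lambda>z h u. c)"
| space: "symbol_class 0 (\<lambda>z h u. of_real (u $ i))"
| frequency: "symbol_class 0 (\<lambda>z h u. z $ i)"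
| increment: "symbol_class (Suc 0) (\<lambda>z h u. h $ i)"
| pairing: "symbol_class (Suc 0) (\<lambda>z h u. cdot h u)"
| exp0: "symbol_class 0 (\<lambda>z h u. exp (- \<i> * cdot h u))"
| exp1: "symbol_class (Suc 0) (\<lambda>z h u. exp (- \<i> * cdot h u) - 1)"
| exp2: "symbol_class 2 (\<lambda>z h u. exp (- \<i> * cdot h u) - 1 + \<i> * cdot h u)"
| weaken: "symbol_class (Suc k) g \<Longrightarrow> symbol_class k g"
| add: "symbol_class k f \<Longrightarrow> symbol_class k g \<Longrightarrow> symbol_class k (\<lambda>z h u. f z h u + g z h u)"
| mult: "symbol_class j f \<Longrightarrow> symbol_class k g \<Longrightarrow> symbol_class (j + k) (\<lambda>z h u. f z h u * g z h u)"

lemma has_derivative_exp_cdot: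
  "((\<lambda>u. exp (- \<i> * cdot h u)) has_derivative (\<lambda>v. - \<i> * cdot h v * exp (- \<i> * cdot h u))) (at u)"
proof -
  have "((\<lambda>u. - \<i> * cdot h u) has_derivative (\<lambda>v. - \<i> * cdot h v)) (at u)"
    by (intro has_derivative_mult_right has_derivative_cdot)
  from has_derivative_compose[OF this DERIV_exp[unfolded has_field_derivative_def]]
  show ?thesis by (simp add: mult.commute)
qed

lemma symbol_class_differentiable: "symbol_class k g \<Longrightarrow> g z h differentiable (at u)"
proof (induction rule: symbol_class.induct)
  case (space i)
  have "((\<lambda>u::real^'a. complex_of_real (u $ i)) has_derivative (\<lambda>u. of_real (u $ i))) (at u)"
    by (intro has_derivative_of_real bounded_linear_imp_has_derivative bounded_linear_vec_nth)
  then show ?case by (auto simp: differentiable_def)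
next
  case pairing
  then show ?case using has_derivative_cdot by (auto simp: differentiable_def)
next
  case exp0
  then show ?case using has_derivative_exp_cdot by (auto simp: differentiable_def)
next
  case exp1
  then show ?case using has_derivative_diff[OF has_derivative_exp_cdot has_derivative_const]
    by (auto simp: differentiable_def)
next
  case exp2
  show ?case
    unfolding differentiable_def
    by (rule exI, rule has_derivative_add[OF has_derivative_diff[OF has_derivative_exp_cdot has_derivative_const]
        has_derivative_mult_right[OF has_derivative_cdot]])
qed (auto intro: differentiable_add differentiable_mult)

text \<open>A partial derivative lowers an exponential remainder by one Taylor order but brings out
  a factor \<open>h $ i\<close>: \<open>exp2\<close> leads to \<open>h $ i\<close> times
  \<open>exp1\<close>, and \<open>exp1\<close> to \<open>h $ i\<close> times \<open>exp0\<close>.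
  The total order in \<open>h\<close> is thus preserved, which is why all three are
  generators.\<close>

lemma symbol_class_partial: "symbol_class k g \<Longrightarrow> symbol_class k (\<lambda>z h. partial i (g z h))"
proof (induction rule: symbol_class.induct)
  case (space j)
  have "((\<lambda>u::real^'a. complex_of_real (u $ j)) has_derivative (\<lambda>u. of_real (u $ j))) (at u)" for u
    by (intro has_derivative_of_real bounded_linear_imp_has_derivative bounded_linear_vec_nth)
  from partial_eq_derivative[OF this, of i]
  have "partial i (\<lambda>u::real^'a. complex_of_real (u $ j)) = (\<lambda>u. of_real (axis i 1 $ j))"
    by (auto simp: fun_eq_iff)
  then show ?case by (simp add: symbol_class.const)
next
  case pairing
  have "partial i (cdot h) = (\<lambda>u. h $ i)" for h :: "complex^'a"
    by (simp add: fun_eq_iff partial_eq_derivative[OF has_derivative_cdot] cdot_axis)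
  then show ?case by (simp add: symbol_class.increment)
next
  case exp0
  have eq: "partial i (\<lambda>u. exp (- \<i> * cdot h u)) = (\<lambda>u. - \<i> * (h $ i * exp (- \<i> * cdot h u)))" for h :: "complex^'a"
    by (rule ext, rule trans[OF partial_eq_derivative[OF has_derivative_exp_cdot]]) (simp add: cdot_axis)
  have "symbol_class (0 + (Suc 0 + 0)) (\<lambda>z h u. - \<i> * ((h::complex^'a) $ i * exp (- \<i> * cdot h u)))"
    by (intro symbol_class.mult symbol_class.const symbol_class.increment symbol_class.exp0)
  then show ?case unfolding eq by (auto intro: symbol_class.weaken)
next
  case exp1
  have eq: "partial i (\<lambda>u. exp (- \<i> * cdot h u) - 1) = (\<lambda>u. - \<i> * (h $ i * exp (- \<i> * cdot h u)))" for h :: "complex^'a"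
    by (rule ext, rule trans[OF partial_eq_derivative[OF has_derivative_diff[OF has_derivative_exp_cdot has_derivative_const]]])
      (simp add: cdot_axis)
  have "symbol_class (0 + (Suc 0 + 0)) (\<lambda>z h u. - \<i> * ((h::complex^'a) $ i * exp (- \<i> * cdot h u)))"
    by (intro symbol_class.mult symbol_class.const symbol_class.increment symbol_class.exp0)
  then show ?case unfolding eq by simp
next
  case exp2
  have eq: "partial i (\<lambda>u. exp (- \<i> * cdot h u) - 1 + \<i> * cdot h u)
      = (\<lambda>u. - \<i> * (h $ i * (exp (- \<i> * cdot h u) - 1)))" for h :: "complex^'a"
    by (rule ext, rule trans[OF partial_eq_derivative[OF has_derivative_add[OF has_derivative_diff[OF
        has_derivative_exp_cdot has_derivative_const] has_derivative_mult_right[OF has_derivative_cdot]]]])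
      (simp add: cdot_axis algebra_simps)
  have "symbol_class (0 + (Suc 0 + Suc 0)) (\<lambda>z h u. - \<i> * ((h::complex^'a) $ i * (exp (- \<i> * cdot h u) - 1)))"
    by (intro symbol_class.mult symbol_class.const symbol_class.increment symbol_class.exp1)
  then show ?case unfolding eq by (simp add: numeral_2_eq_2)
next
  case (add k f g)
  have "partial i (\<lambda>u. f z h u + g z h u) = (\<lambda>u. partial i (f z h) u + partial i (g z h) u)" for z h
    using add.hyps by (auto simp: fun_eq_iff partial_add symbol_class_differentiable)
  then show ?case using add.IH by (simp add: symbol_class.add)
next
  case (mult j f k g)
  have "partial i (\<lambda>u. f z h u * g z h u) = (\<lambda>u. partial i (f z h) u * g z h u + f z h u * partial i (g z h) u)" for z h
    using mult.hyps by (auto simp: fun_eq_iff partial_mult symbol_class_differentiable)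
  then show ?case using mult by (auto intro!: symbol_class.add symbol_class.mult)
qed (auto intro: symbol_class.zero symbol_class.weaken)

text \<open>Powers of a single base make weights multiply by adding exponents. The exponential
  covers \<open>exp (- \<i> * cdot h u)\<close> for complex \<open>h\<close>; since |h| is kept
  inside it, the weight is polynomial in |z| and |u| at \<open>h = 0\<close>, which the growth
  estimate exploits.\<close>

definition symbol_weight :: "nat \<Rightarrow> complex^'n \<Rightarrow> complex^'n \<Rightarrow> real^'n \<Rightarrow> real" where
  "symbol_weight N z h u = ((1 + norm z) * (1 + norm u) * exp (norm h * norm u)) ^ N"

lemma symbol_weight_base_ge_1: "1 \<le> (1 + norm z) * (1 + norm u) * exp (norm h * norm u)"
proof -
  have "1 * 1 * 1 \<le> (1 + norm z) * (1 + norm u) * exp (norm h * norm u)"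
    by (intro mult_mono) auto
  then show ?thesis by simp
qed

lemma symbol_weight_mono: "N \<le> M \<Longrightarrow> symbol_weight N z h u \<le> symbol_weight M z h u"
  unfolding symbol_weight_def by (intro power_increasing symbol_weight_base_ge_1)

lemma symbol_weight_ge_1: "symbol_weight N z h u \<ge> 1"
  using symbol_weight_mono[of 0 N z h u] by (simp add: symbol_weight_def)

text \<open>The restriction \<open>norm h \<le> 1\<close> allows the order to be lowered, since then
  |h|^(k+1) is at most |h|^k. The exponential remainders are bounded by Taylor's formula, and the
  weight absorbs everything that is not a power of |h|.\<close>

lemma symbol_class_bound:
  assumes "symbol_class k g"
  shows "\<exists>C N. C \<ge> 0 \<and> (\<forall>z h u. norm h \<le> 1 \<longrightarrow> norm (g z h u) \<le> C * norm h ^ k * symbol_weight N z h u)"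
  using assms
proof (induction rule: symbol_class.induct)
  case (zero k)
  then show ?case by (intro exI[of _ 0]) auto
next
  case (const c)
  then show ?case by (intro exI[of _ "norm c"] exI[of _ 0]) (auto simp: symbol_weight_def)
next
  case (space i)
  have "norm u \<le> symbol_weight 1 z h u" for z h u
  proof -
    have "1 * norm u * 1 \<le> (1 + norm z) * (1 + norm u) * exp (norm h * norm u)"
      by (intro mult_mono) auto
    then show ?thesis by (simp add: symbol_weight_def)
  qed
  then show ?case
    by (intro exI[of _ 1] exI[of _ 1]) (auto intro: order_trans[OF component_le_norm_cart])
next
  case (frequency i)
  have "norm z \<le> symbol_weight 1 z h u" for z h u
  proof -
    have "norm z * 1 * 1 \<le> (1 + norm z) * (1 + norm u) * exp (norm h * norm u)"
      by (intro mult_mono) auto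
    then show ?thesis by (simp add: symbol_weight_def)
  qed
  then show ?case
    by (intro exI[of _ 1] exI[of _ 1]) (auto intro: order_trans[OF Finite_Cartesian_Product.norm_nth_le])
next
  case (increment i)
  then show ?case
    by (intro exI[of _ 1] exI[of _ 0]) (auto simp: symbol_weight_def Finite_Cartesian_Product.norm_nth_le)
next
  case pairing
  have "norm (cdot h u) \<le> norm h * symbol_weight 1 z h u" for z h u
  proof -
    have "1 * norm u * 1 \<le> (1 + norm z) * (1 + norm u) * exp (norm h * norm u)"
      by (intro mult_mono) auto
    then show ?thesis
      using norm_cdot_le[of h u] mult_left_mono[of "norm u" "symbol_weight 1 z h u" "norm h"]
      by (simp add: symbol_weight_def)
  qed
  then show ?case
    by (intro exI[of _ 1] exI[of _ 1]) auto
next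
  case exp0
  have "norm (exp (- \<i> * cdot h u)) \<le> symbol_weight 1 z h u" for z h u
  proof -
    have "norm (exp (- \<i> * cdot h u)) \<le> exp (norm h * norm u)"
      by (rule order_trans[OF norm_exp]) (simp add: norm_mult norm_cdot_le)
    also have "\<dots> = 1 * 1 * exp (norm h * norm u)" by simp
    also have "\<dots> \<le> (1 + norm z) * (1 + norm u) * exp (norm h * norm u)"
      by (intro mult_mono) auto
    finally show ?thesis by (simp only: symbol_weight_def power_one_right)
  qed
  then show ?case
    by (intro exI[of _ 1] exI[of _ 1]) auto
next
  case exp1
  have "norm (exp (- \<i> * cdot h u) - 1) \<le> norm h * symbol_weight 1 z h u" for z h u
  proof -
    have "norm (exp (- \<i> * cdot h u) - 1) \<le> exp (norm (cdot h u)) * norm (cdot h u)"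
      using Taylor_exp_field[of "- \<i> * cdot h u" 0] by (simp add: norm_mult)
    also have "\<dots> \<le> exp (norm h * norm u) * (norm h * norm u)"
      by (intro mult_mono) (auto simp: norm_cdot_le)
    also have "\<dots> = norm h * (1 * norm u * exp (norm h * norm u))" by simp
    also have "\<dots> \<le> norm h * ((1 + norm z) * (1 + norm u) * exp (norm h * norm u))"
      by (intro mult_left_mono mult_mono) auto
    finally show ?thesis by (simp add: symbol_weight_def)
  qed
  then show ?case
    by (intro exI[of _ 1] exI[of _ 1]) auto
next
  case exp2
  have "norm (exp (- \<i> * cdot h u) - 1 + \<i> * cdot h u) \<le> (norm h)\<^sup>2 * symbol_weight 2 z h u" for z h u
  proof -
    have "norm (exp (- \<i> * cdot h u) - 1 + \<i> * cdot h u) \<le> exp (norm (cdot h u)) * (norm (cdot h u))\<^sup>2"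
      using Taylor_exp_field[of "- \<i> * cdot h u" 1] by (simp add: norm_mult numeral_2_eq_2 algebra_simps)
    also have "\<dots> \<le> exp (norm h * norm u) * (norm h * norm u)\<^sup>2"
      by (intro mult_mono power_mono) (auto simp: norm_cdot_le)
    also have "\<dots> = (norm h)\<^sup>2 * (1 * (norm u)\<^sup>2 * exp (norm h * norm u))" by (simp add: power_mult_distrib)
    also have "\<dots> \<le> (norm h)\<^sup>2 * ((1 + norm z)\<^sup>2 * (1 + norm u)\<^sup>2 * (exp (norm h * norm u))\<^sup>2)"
    proof (intro mult_left_mono mult_mono power_mono)
      show "exp (norm h * norm u) \<le> (exp (norm h * norm u))\<^sup>2"
        by (rule self_le_power) auto
    qed auto
    finally show ?thesis by (simp add: symbol_weight_def power_mult_distrib)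
  qed
  then show ?case
    by (intro exI[of _ 1] exI[of _ 2]) auto
next
  case (weaken k g)
  then obtain C N where C: "C \<ge> 0"
    "\<And>z h u. norm h \<le> 1 \<Longrightarrow> norm (g z h u) \<le> C * norm h ^ Suc k * symbol_weight N z h u" by blast
  have "norm (g z h u) \<le> C * norm h ^ k * symbol_weight N z h u" if "norm h \<le> 1" for z h u
  proof -
    have "C * norm h ^ Suc k * symbol_weight N z h u \<le> C * norm h ^ k * symbol_weight N z h u"
      using that C(1) symbol_weight_ge_1[of N z h u]
      by (intro mult_right_mono mult_left_mono power_decreasing) auto
    then show ?thesis using C(2)[OF that, of z u] by linarith
  qed
  then show ?case using C(1) by blast
next
  case (add k f g)
  then obtain C N D M where C: "C \<ge> 0" "D \<ge> 0"
    "\<And>z h u. norm h \<le> 1 \<Longrightarrow> norm (f z h u) \<le> C * norm h ^ k * symbol_weight N z h u"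
    "\<And>z h u. norm h \<le> 1 \<Longrightarrow> norm (g z h u) \<le> D * norm h ^ k * symbol_weight M z h u" by metis
  have "norm (f z h u + g z h u) \<le> (C + D) * norm h ^ k * symbol_weight (max N M) z h u" if "norm h \<le> 1" for z h u
  proof -
    have "C * norm h ^ k * symbol_weight N z h u \<le> C * norm h ^ k * symbol_weight (max N M) z h u"
      "D * norm h ^ k * symbol_weight M z h u \<le> D * norm h ^ k * symbol_weight (max N M) z h u"
      using C(1,2) by (auto intro!: mult_left_mono symbol_weight_mono)
    then show ?thesis
      using C(3,4)[OF that, of z u] norm_triangle_ineq[of "f z h u" "g z h u"] by (simp add: algebra_simps)
  qed
  then show ?case using C(1,2) by (intro exI[of _ "C + D"]) auto
next
  case (mult j f k g)
  then obtain C N D M where C: "C \<ge> 0" "D \<ge> 0"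
    "\<And>z h u. norm h \<le> 1 \<Longrightarrow> norm (f z h u) \<le> C * norm h ^ j * symbol_weight N z h u"
    "\<And>z h u. norm h \<le> 1 \<Longrightarrow> norm (g z h u) \<le> D * norm h ^ k * symbol_weight M z h u" by metis
  have "norm (f z h u * g z h u) \<le> (C * D) * norm h ^ (j + k) * symbol_weight (N + M) z h u" if "norm h \<le> 1" for z h u
  proof -
    have "norm (f z h u) * norm (g z h u)
        \<le> (C * norm h ^ j * symbol_weight N z h u) * (D * norm h ^ k * symbol_weight M z h u)"
      using C that symbol_weight_ge_1[of N z h u]
      by (intro mult_mono) (auto intro!: mult_nonneg_nonneg)
    then show ?thesis
      by (simp add: norm_mult power_add symbol_weight_def mult_ac)
  qed
  then show ?case using C(1,2) by (intro exI[of _ "C * D"]) auto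
qed

text \<open>Differentiating the Gaussian multiplies it by \<open>- a * u $ i - \<i> * z $ i\<close>,
  a symbol of order 0, so the order in \<open>h\<close> survives any number of derivatives. The
  symbol \<open>g'\<close> is chosen before \<open>z\<close> and \<open>h\<close>, so that a single
  symbol bound serves all of them.\<close>

lemma partials_gauss_exp_symbol:
  assumes "symbol_class k g"
  shows "\<exists>g'. symbol_class k g' \<and>
    (\<forall>z h. partials \<beta> (\<lambda>u. gauss_exp a z u * g z h u) = (\<lambda>u. gauss_exp a z u * g' z h u))"
proof (induction \<beta>)
  case Nil
  then show ?case using assms by auto
next
  case (Cons i \<beta>)
  then obtain g' where g': "symbol_class k g'"
    "\<And>z h. partials \<beta> (\<lambda>u. gauss_exp a z u * g z h u) = (\<lambda>u. gauss_exp a z u * g' z h u)" by blast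
  let ?q = "\<lambda>z h u. partial i (g' z h) u + (of_real (- a) * of_real (u $ i) + (- \<i>) * z $ i) * g' z h u"
  have "symbol_class (0 + k) (\<lambda>z h u. (of_real (- a) * of_real (u $ i) + (- \<i>) * z $ i) * g' z h u)"
    by (rule symbol_class.mult[OF symbol_class.add[OF symbol_class.mult[OF symbol_class.const symbol_class.space, simplified]
        symbol_class.mult[OF symbol_class.const symbol_class.frequency, simplified]] g'(1)])
  then have "symbol_class k ?q"
    using g'(1) by (auto intro!: symbol_class.add symbol_class_partial)
  moreover have "partial i (\<lambda>u. gauss_exp a z u * g' z h u) u = gauss_exp a z u * ?q z h u" for z h u
  proof -
    have "gauss_exp a z differentiable (at u)"
      using has_derivative_gauss_exp by (auto simp: differentiable_def)
    then show ?thesis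
      using symbol_class_differentiable[OF g'(1)]
      by (simp add: partial_mult partial_gauss_exp algebra_simps)
  qed
  ultimately show ?case
    using g'(2) by (intro exI[of _ ?q]) (auto simp: partials_Cons)
qed

lemma smooth_gauss_exp_symbol:
  assumes "symbol_class k g"
  shows "smooth (\<lambda>u. gauss_exp a z u * g z h u)"
proof -
  have "(\<lambda>u. gauss_exp a z u * g z h u) differentiable (at u)" if "symbol_class k g" for g u
  proof -
    have "gauss_exp a z differentiable (at u)"
      using has_derivative_gauss_exp by (auto simp: differentiable_def)
    then show ?thesis
      by (rule differentiable_mult[OF _ symbol_class_differentiable[OF that]])
  qed
  moreover have "\<exists>g'. symbol_class k g' \<and> partial i (\<lambda>u. gauss_exp a z u * g z h u) = (\<lambda>u. gauss_exp a z u * g' z h u)"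
    if "symbol_class k g" for g i
    using partials_gauss_exp_symbol[OF that, of "[i]" a] by (auto simp: partials_Cons)
  ultimately show ?thesis
    using assms by (intro smooth_coinduct[where X = "{\<lambda>u. gauss_exp a z u * g z h u | g. symbol_class k g}"]) blast+
qed

section \<open>Absorbing polynomial and exponential factors into a Gaussian\<close>

lemma linear_minus_square_le:
  fixes t K a :: real
  assumes "a > 0"
  shows "K * t - (a / 2) * t\<^sup>2 \<le> K\<^sup>2 / (2 * a)"
proof -
  have "(a * t - K)\<^sup>2 \<ge> 0" by simp
  then show ?thesis using assms by (simp add: field_simps power2_eq_square)
qed

lemma power_one_plus_le_exp: "t \<ge> 0 \<Longrightarrow> (1 + t) ^ N \<le> exp (real N * t)" for t :: real
  using power_mono[OF exp_ge_add_one_self[of t], of N] by (simp add: exp_of_nat_mult)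

lemma one_plus_square_le: "t \<ge> 0 \<Longrightarrow> (1 + t\<^sup>2) ^ M \<le> (1 + t) ^ (2 * M)" for t :: real
  unfolding power_mult by (intro power_mono) (auto simp: power2_eq_square algebra_simps)

text \<open>For fixed \<open>z\<close> a crude estimate suffices: every factor in |u| is at most the
  exponential of a multiple of |u|, and the Gaussian absorbs the sum of the exponents. What matters
  is the power of |h|, uniformly in \<open>u\<close>.\<close>

lemma gauss_exp_symbol_decay:
  assumes "symbol_class k g" "a > 0"
  shows "\<exists>B. \<forall>h u. norm h \<le> 1 \<longrightarrow>
    (1 + (norm u)\<^sup>2) ^ M * norm (partials \<beta> (\<lambda>u. gauss_exp a z u * g z h u) u) \<le> B * norm h ^ k"
proof -
  obtain g' where g': "symbol_class k g'"
    "\<And>z h. partials \<beta> (\<lambda>u. gauss_exp a z u * g z h u) = (\<lambda>u. gauss_exp a z u * g' z h u)"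
    using partials_gauss_exp_symbol[OF assms(1)] by blast
  obtain C N where C: "C \<ge> 0"
    "\<And>z h u. norm h \<le> 1 \<Longrightarrow> norm (g' z h u) \<le> C * norm h ^ k * symbol_weight N z h u"
    using symbol_class_bound[OF g'(1)] by blast
  define y where "y = (\<chi> i. Im (z $ i))"
  \<comment> \<open>\<open>2 * M\<close> comes from the radial weight, \<open>2 * N\<close> from the
    two factors \<open>1 + norm u\<close> and \<open>exp (norm h * norm u)\<close> of the symbol
    weight, each at most \<open>exp t\<close>, and \<open>norm y\<close> from the modulus of the
    Gaussian.\<close>
  define K where "K = real (2 * M + 2 * N) + norm y"
  have "(1 + (norm u)\<^sup>2) ^ M * norm (partials \<beta> (\<lambda>u. gauss_exp a z u * g z h u) u)
      \<le> (C * (1 + norm z) ^ N * exp (K\<^sup>2 / (2 * a))) * norm h ^ k" if h: "norm h \<le> 1" for h u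
  proof -
    define t where "t = norm u"
    have t: "t \<ge> 0" by (simp add: t_def)
    have "norm h * t \<le> t" using h t by (simp add: mult_left_le_one_le)
    then have "symbol_weight N z h u \<le> ((1 + norm z) * exp t * exp t) ^ N"
      unfolding symbol_weight_def t_def[symmetric] using t
      by (intro power_mono mult_mono) (auto intro: exp_ge_add_one_self)
    also have "\<dots> = (1 + norm z) ^ N * exp (real (2 * N) * t)"
      by (simp only: exp_of_nat_mult power_mult_distrib power_mult power2_eq_square mult.assoc)
    finally have 1: "symbol_weight N z h u \<le> (1 + norm z) ^ N * exp (real (2 * N) * t)" .
    have 2: "(1 + t\<^sup>2) ^ M \<le> exp (real (2 * M) * t)"
      using one_plus_square_le[OF t] power_one_plus_le_exp[OF t] order_trans by blast
    have "y \<bullet> u \<le> norm y * t"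
      unfolding t_def by (rule norm_cauchy_schwarz)
    then have 3: "norm (gauss_exp a z u) \<le> exp (norm y * t - (a / 2) * t\<^sup>2)"
      by (simp add: norm_gauss_exp y_def[symmetric] t_def)
    have "(1 + t\<^sup>2) ^ M * (norm (gauss_exp a z u) * norm (g' z h u))
        \<le> exp (real (2 * M) * t) * (exp (norm y * t - (a / 2) * t\<^sup>2) *
            (C * norm h ^ k * ((1 + norm z) ^ N * exp (real (2 * N) * t))))"
      using C(1) by (intro mult_mono 2 3 order_trans[OF C(2)[OF h]] 1 order_refl)
        (auto intro: order_trans[OF zero_le_one symbol_weight_ge_1])
    also have "\<dots> = C * (1 + norm z) ^ N * norm h ^ k *
        (exp (real (2 * M) * t) * exp (norm y * t - (a / 2) * t\<^sup>2) * exp (real (2 * N) * t))"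
      by (simp only: mult_ac)
    also have "exp (real (2 * M) * t) * exp (norm y * t - (a / 2) * t\<^sup>2) * exp (real (2 * N) * t)
        = exp (K * t - (a / 2) * t\<^sup>2)"
      unfolding exp_add[symmetric] by (simp add: K_def algebra_simps)
    also have "C * (1 + norm z) ^ N * norm h ^ k * exp (K * t - (a / 2) * t\<^sup>2)
        \<le> C * (1 + norm z) ^ N * norm h ^ k * exp (K\<^sup>2 / (2 * a))"
      using C(1) linear_minus_square_le[OF assms(2), of K t] by (intro mult_left_mono) auto
    finally show ?thesis
      by (simp add: g'(2) norm_mult t_def mult_ac)
  qed
  then show ?thesis by blast
qed

lemma gauss_exp_symbol_schwartz:
  assumes "symbol_class k g" "a > 0" "norm h \<le> 1"
  shows "(\<lambda>u. gauss_exp a z u * g z h u) \<in> schwartz"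
  using gauss_exp_symbol_decay[OF assms(1,2)] smooth_gauss_exp_symbol[OF assms(1)] assms(3)
  by (intro schwartzI) blast+

lemma gauss_exp_schwartz: "a > 0 \<Longrightarrow> gauss_exp a z \<in> schwartz"
  using gauss_exp_symbol_schwartz[OF symbol_class.const[of 1], of a 0 z] by simp

lemma seminorm_sum_gauss_exp_symbol:
  assumes "symbol_class k g" "a > 0"
  shows "\<exists>B. \<forall>h. norm h \<le> 1 \<longrightarrow> seminorm_sum ps (\<lambda>u. gauss_exp a z u * g z h u) \<le> B * norm h ^ k"
proof (induction ps)
  case Nil
  then show ?case by (intro exI[of _ 0]) (simp add: seminorm_sum_def)
next
  case (Cons p ps)
  obtain \<alpha> \<beta> where p: "p = (\<alpha>, \<beta>)" by fastforce
  obtain B where B: "\<And>h. norm h \<le> 1 \<Longrightarrow> seminorm_sum ps (\<lambda>u. gauss_exp a z u * g z h u) \<le> B * norm h ^ k"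
    using Cons by blast
  obtain D where D: "\<And>h u. norm h \<le> 1 \<Longrightarrow> (1 + (norm u)\<^sup>2) ^ sum \<alpha> UNIV *
      norm (partials \<beta> (\<lambda>u. gauss_exp a z u * g z h u) u) \<le> D * norm h ^ k"
    using gauss_exp_symbol_decay[OF assms] by blast
  have "schwartz_seminorm \<alpha> \<beta> (\<lambda>u. gauss_exp a z u * g z h u) \<le> D * norm h ^ k" if "norm h \<le> 1" for h
  proof (rule schwartz_seminorm_le)
    fix u
    show "norm (monomial \<alpha> u *\<^sub>R partials \<beta> (\<lambda>u. gauss_exp a z u * g z h u) u) \<le> D * norm h ^ k"
      using order_trans[OF mult_right_mono[OF abs_monomial_le norm_ge_zero] D[OF that]] by simp
  qed
  then have "seminorm_sum (p # ps) (\<lambda>u. gauss_exp a z u * g z h u) \<le> (D + B) * norm h ^ k" if "norm h \<le> 1" for h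
    using B[OF that] that by (simp add: seminorm_sum_def p distrib_right add_mono)
  then show ?case by blast
qed

section \<open>Growth of the seminorms in the complex frequency\<close>

lemma norm_complex_vec: "(norm (complex_vec x y))\<^sup>2 = (norm x)\<^sup>2 + (norm y)\<^sup>2"
  by (simp add: norm_vec_def L2_set_def sum_nonneg complex_vec_def cmod_power2 sum.distrib)

text \<open>Bounding \<open>y \<bullet> u\<close> by |y| |u| before absorbing the polynomials, as
  for fixed frequency, would leave an extra factor exponential in |y|. Here the square is completed
  exactly, and the polynomial weights are measured from the peak \<open>y / a\<close> of the
  modulus, which costs only powers of \<open>1 + norm z\<close>.\<close>

lemma seminorm_sum_gauss_exp_growth:
  fixes ps :: "(('n::finite \<Rightarrow> nat) \<times> 'n list) list"
  assumes "a > 0"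
  shows "\<exists>B m. \<forall>x y. seminorm_sum ps (gauss_exp a (complex_vec x y))
    \<le> B * (1 + (norm x)\<^sup>2 + (norm y)\<^sup>2) ^ m * exp ((norm y)\<^sup>2 / (2 * a))"
proof (induction ps)
  case Nil
  then show ?case by (intro exI[of _ 0]) (simp add: seminorm_sum_def)
next
  case (Cons p ps)
  obtain \<alpha> \<beta> where p: "p = (\<alpha>, \<beta>)" by fastforce
  obtain B m where B: "\<And>x y. seminorm_sum ps (gauss_exp a (complex_vec x y))
    \<le> B * (1 + (norm x)\<^sup>2 + (norm y)\<^sup>2) ^ m * exp ((norm y)\<^sup>2 / (2 * a))"
    using Cons by blast
  obtain g' :: "complex^'n \<Rightarrow> complex^'n \<Rightarrow> real^'n \<Rightarrow> complex" where g': "symbol_class 0 g'"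
    "\<And>z h. partials \<beta> (gauss_exp a z) = (\<lambda>u. gauss_exp a z u * g' z h u)"
    using partials_gauss_exp_symbol[OF symbol_class.const[of 1], of \<beta> a] by auto
  obtain C N where C: "C \<ge> 0"
    "\<And>z h u. norm h \<le> 1 \<Longrightarrow> norm (g' z h u) \<le> C * norm h ^ 0 * symbol_weight N z h u"
    using symbol_class_bound[OF g'(1)] by blast
  define M where "M = sum \<alpha> UNIV"
  \<comment> \<open>The total power of \<open>1 + norm u\<close>: \<open>2 * M\<close> from the
    monomial and \<open>N\<close> from the symbol weight at \<open>h = 0\<close>.\<close>
  define K where "K = 2 * M + N"
  define D where "D = C * 2 ^ (N + K) * (1 + 1 / a) ^ K * exp ((real K)\<^sup>2 / (2 * a))"
  have "norm (monomial \<alpha> u *\<^sub>R partials \<beta> (gauss_exp a (complex_vec x y)) u)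
    \<le> D * (1 + (norm x)\<^sup>2 + (norm y)\<^sup>2) ^ (N + K) * exp ((norm y)\<^sup>2 / (2 * a))" for x y u
  proof -
    define z where "z = complex_vec x y"
    define v where "v = u - (1 / a) *\<^sub>R y"
    have y: "(\<chi> i. Im (z $ i)) = y"
      by (simp add: z_def complex_vec_def vec_eq_iff)
    have "- (a / 2) * (norm u)\<^sup>2 + y \<bullet> u = (norm y)\<^sup>2 / (2 * a) - (a / 2) * (norm v)\<^sup>2"
      using assms by (simp add: v_def power2_norm_eq_inner inner_diff_left inner_diff_right inner_commute field_simps)
    then have 1: "norm (gauss_exp a z u) = exp ((norm y)\<^sup>2 / (2 * a)) * exp (- (a / 2) * (norm v)\<^sup>2)"
      by (simp add: norm_gauss_exp y exp_add[symmetric])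
    have yz: "norm y \<le> norm z"
      using norm_complex_vec[of x y] by (simp add: z_def power2_le_imp_le)
    have "norm u \<le> norm v + norm y / a"
      using norm_triangle_ineq[of v "(1 / a) *\<^sub>R y"] assms by (simp add: v_def)
    also have "norm y / a \<le> norm z / a"
      using yz assms by (simp add: divide_right_mono)
    finally have "norm u \<le> norm v + norm z / a" by simp
    moreover have "0 \<le> norm v / a" "0 \<le> norm v * norm z" "0 \<le> norm v * norm z / a" "0 \<le> norm z" "0 \<le> 1 / a"
      using assms by auto
    moreover have "(1 + 1 / a) * (1 + norm z) * (1 + norm v) = 1 + norm v + norm z + norm v * norm z +
        1 / a + norm v / a + norm z / a + norm v * norm z / a"
      by (simp add: algebra_simps add_divide_distrib)
    ultimately have 2: "1 + norm u \<le> (1 + 1 / a) * (1 + norm z) * (1 + norm v)"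
      by linarith
    have 3: "(1 + norm v) ^ K * exp (- (a / 2) * (norm v)\<^sup>2) \<le> exp ((real K)\<^sup>2 / (2 * a))"
    proof -
      have "(1 + norm v) ^ K * exp (- (a / 2) * (norm v)\<^sup>2) \<le> exp (real K * norm v) * exp (- (a / 2) * (norm v)\<^sup>2)"
        by (intro mult_right_mono power_one_plus_le_exp) auto
      also have "\<dots> \<le> exp ((real K)\<^sup>2 / (2 * a))"
        using linear_minus_square_le[OF assms, of "real K" "norm v"] by (simp add: exp_add[symmetric])
      finally show ?thesis .
    qed
    have 4: "1 + norm z \<le> 2 * (1 + (norm x)\<^sup>2 + (norm y)\<^sup>2)"
    proof -
      have "(norm z - 1)\<^sup>2 \<ge> 0" by simp
      then have "2 * norm z \<le> 1 + (norm z)\<^sup>2"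
        by (simp add: power2_diff)
      then have "norm z \<le> 1 + (norm z)\<^sup>2"
        using norm_ge_zero[of z] by linarith
      then have "norm z \<le> 1 + (norm x)\<^sup>2 + (norm y)\<^sup>2"
        using norm_complex_vec[of x y] by (simp add: z_def)
      then have "1 + norm z \<le> 1 + (1 + (norm x)\<^sup>2 + (norm y)\<^sup>2)" by simp
      also have "\<dots> \<le> (1 + (norm x)\<^sup>2 + (norm y)\<^sup>2) + (1 + (norm x)\<^sup>2 + (norm y)\<^sup>2)"
        by (intro add_right_mono) simp
      finally show ?thesis by simp
    qed
    have "norm (monomial \<alpha> u *\<^sub>R partials \<beta> (gauss_exp a z) u) \<le>
        (1 + norm u) ^ (2 * M) * (norm (gauss_exp a z u) * (C * ((1 + norm z) ^ N * (1 + norm u) ^ N)))"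
    proof -
      have "\<bar>monomial \<alpha> u\<bar> \<le> (1 + norm u) ^ (2 * M)"
        unfolding M_def by (rule order_trans[OF abs_monomial_le one_plus_square_le]) auto
      \<comment> \<open>The Gaussian itself does not involve \<open>h\<close>, so its symbol may be
        evaluated at \<open>h = 0\<close>, where the exponential in the weight is 1.\<close>
      moreover have "norm (g' z 0 u) \<le> C * ((1 + norm z) ^ N * (1 + norm u) ^ N)"
        using C(2)[of 0 z u] by (simp add: symbol_weight_def power_mult_distrib)
      ultimately show ?thesis
        unfolding g'(2)[of z 0] norm_scaleR norm_mult by (intro mult_mono) auto
    qed
    also have "\<dots> = C * (1 + norm z) ^ N * (1 + norm u) ^ K * norm (gauss_exp a z u)"
      by (simp add: K_def power_add mult_ac)
    also have "\<dots> \<le> C * (1 + norm z) ^ N * ((1 + 1 / a) * (1 + norm z) * (1 + norm v)) ^ K * norm (gauss_exp a z u)"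
      using C(1) 2 by (intro mult_right_mono mult_left_mono power_mono) auto
    also have "\<dots> = C * (1 + 1 / a) ^ K * (1 + norm z) ^ (N + K) * exp ((norm y)\<^sup>2 / (2 * a)) *
        ((1 + norm v) ^ K * exp (- (a / 2) * (norm v)\<^sup>2))"
      by (simp add: 1 power_mult_distrib power_add mult_ac)
    also have "\<dots> \<le> C * (1 + 1 / a) ^ K * (2 * (1 + (norm x)\<^sup>2 + (norm y)\<^sup>2)) ^ (N + K) *
        exp ((norm y)\<^sup>2 / (2 * a)) * exp ((real K)\<^sup>2 / (2 * a))"
      using C(1) assms by (intro mult_mono 3 power_mono 4 order_refl) auto
    also have "\<dots> = D * (1 + (norm x)\<^sup>2 + (norm y)\<^sup>2) ^ (N + K) * exp ((norm y)\<^sup>2 / (2 * a))"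
      by (simp only: D_def power_mult_distrib mult_ac)
    finally show ?thesis by (simp add: z_def)
  qed
  then have D: "schwartz_seminorm \<alpha> \<beta> (gauss_exp a (complex_vec x y))
      \<le> D * (1 + (norm x)\<^sup>2 + (norm y)\<^sup>2) ^ (N + K) * exp ((norm y)\<^sup>2 / (2 * a))" for x y
    by (rule schwartz_seminorm_le)
  \<comment> \<open>The two bounds have different exponents and constants of unknown sign. Absolute
    values and the sum of the exponents dominate both, because the base is at least 1.\<close>
  have "seminorm_sum (p # ps) (gauss_exp a (complex_vec x y))
      \<le> (\<bar>D\<bar> + \<bar>B\<bar>) * (1 + (norm x)\<^sup>2 + (norm y)\<^sup>2) ^ (N + K + m) * exp ((norm y)\<^sup>2 / (2 * a))" for x y
  proof -
    let ?s = "1 + (norm x)\<^sup>2 + (norm y)\<^sup>2" and ?e = "exp ((norm y)\<^sup>2 / (2 * a))"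
    have "D * ?s ^ (N + K) * ?e \<le> \<bar>D\<bar> * ?s ^ (N + K + m) * ?e" "B * ?s ^ m * ?e \<le> \<bar>B\<bar> * ?s ^ (N + K + m) * ?e"
      by (intro mult_right_mono mult_mono power_increasing; auto)+
    then have "schwartz_seminorm \<alpha> \<beta> (gauss_exp a (complex_vec x y)) + seminorm_sum ps (gauss_exp a (complex_vec x y))
        \<le> \<bar>D\<bar> * ?s ^ (N + K + m) * ?e + \<bar>B\<bar> * ?s ^ (N + K + m) * ?e"
      by (intro add_mono order_trans[OF D] order_trans[OF B])
    then show ?thesis
      by (simp only: seminorm_sum_def p distrib_right list.map sum_list.Cons prod.case)
  qed
  then show ?case by blast
qed

section \<open>The transform of a tempered distribution\<close>

text \<open>Membership and value are proved together, since additivity of \<open>f\<close> is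
  available only on Schwartz functions.\<close>

lemma tempered_distribution_sum:
  assumes "tempered_distribution f" "finite I" "\<And>i. i \<in> I \<Longrightarrow> \<phi> i \<in> schwartz"
  shows "(\<lambda>u. \<Sum>i\<in>I. k i * \<phi> i u) \<in> schwartz \<and> f (\<lambda>u. \<Sum>i\<in>I. k i * \<phi> i u) = (\<Sum>i\<in>I. k i * f (\<phi> i))"
  using assms(2,3)
proof (induction I rule: finite_induct)
  case empty
  have "(\<lambda>_::real^'a. 0::complex) \<in> schwartz"
    by (intro schwartzI) (auto simp: smooth_const partials_zero)
  moreover note tempered_distribution_cmult[OF assms(1) calculation, of 0]
  ultimately show ?case by simp
next
  case (insert i I)
  then have 1: "\<phi> i \<in> schwartz" "(\<lambda>u. k i * \<phi> i u) \<in> schwartz" "(\<lambda>u. \<Sum>i\<in>I. k i * \<phi> i u) \<in> schwartz"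
    by (auto intro: schwartz_cmult)
  note tempered_distribution_add[OF assms(1) 1(2,3)]
  moreover note tempered_distribution_cmult[OF assms(1) 1(1), of "k i"]
  ultimately show ?case
    using insert 1 schwartz_add[OF 1(2,3)] by simp
qed

text \<open>The first-order Taylor term of the Gaussian in \<open>h\<close> is a combination of
  Schwartz functions with coefficients proportional to \<open>h $ i\<close>, so its image
  \<open>D h\<close> under \<open>f\<close> is complex linear in \<open>h\<close>. The remainder
  \<open>R h\<close> has seminorms of order |h|^2, and the continuity bound of \<open>f\<close>
  passes this on.\<close>

lemma entire_pairing_gauss_exp:
  fixes f :: "(real^'n \<Rightarrow> complex) \<Rightarrow> complex"
  assumes f: "tempered_distribution f" and a: "a > 0"
  shows "entire (\<lambda>z. f (gauss_exp a z))"
  unfolding entire_def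
proof
  fix z :: "complex^'n"
  define \<phi> where "\<phi> i u = gauss_exp a z u * of_real (u $ i)" for i u
  define D where "D h = (\<Sum>i\<in>UNIV. (- \<i> * h $ i) * f (\<phi> i))" for h
  have \<phi>: "\<phi> i \<in> schwartz" for i
    unfolding \<phi>_def[abs_def] using gauss_exp_symbol_schwartz[OF symbol_class.space a, of 0] by simp
  define R where "R h u = gauss_exp a z u * (exp (- \<i> * cdot h u) - 1 + \<i> * cdot h u)" for h u
  have R: "R h \<in> schwartz" if "norm h \<le> 1" for h
    unfolding R_def[abs_def] using gauss_exp_symbol_schwartz[OF symbol_class.exp2 a that] by simp
  obtain ps C where C: "\<And>\<phi>. \<phi> \<in> schwartz \<Longrightarrow> norm (f \<phi>) \<le> C * seminorm_sum ps \<phi>"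
    using f unfolding tempered_distribution_iff seminorm_dominated_def by blast
  obtain B where B: "\<And>h. norm h \<le> 1 \<Longrightarrow> seminorm_sum ps (R h) \<le> B * (norm h)\<^sup>2"
    using seminorm_sum_gauss_exp_symbol[OF symbol_class.exp2 a, of ps z] unfolding R_def[abs_def] by blast
  have expand: "f (gauss_exp a (z + h)) - f (gauss_exp a z) - D h = f (R h)" if h: "norm h \<le> 1" for h
  proof -
    have "cdot h u * gauss_exp a z u = (\<Sum>i\<in>UNIV. h $ i * \<phi> i u)" for u
      unfolding cdot_def sum_distrib_right \<phi>_def by (simp add: mult_ac)
    then have "gauss_exp a (z + h) = (\<lambda>u. R h u + (gauss_exp a z u + (\<Sum>i\<in>UNIV. (- \<i> * h $ i) * \<phi> i u)))"
      unfolding fun_eq_iff gauss_exp_add[of a z h] R_def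
      by (auto simp: algebra_simps sum_negf sum_distrib_left[symmetric])
    moreover note S = tempered_distribution_sum[OF f finite \<phi>, where I = UNIV and k = "\<lambda>i. - \<i> * h $ i"]
    have "f (\<lambda>u. R h u + (gauss_exp a z u + (\<Sum>i\<in>UNIV. (- \<i> * h $ i) * \<phi> i u))) =
        f (R h) + f (\<lambda>u. gauss_exp a z u + (\<Sum>i\<in>UNIV. (- \<i> * h $ i) * \<phi> i u))"
      by (rule tempered_distribution_add[OF f R[OF h] schwartz_add[OF gauss_exp_schwartz[OF a] conjunct1[OF S]]])
    moreover have "f (\<lambda>u. gauss_exp a z u + (\<Sum>i\<in>UNIV. (- \<i> * h $ i) * \<phi> i u)) =
        f (gauss_exp a z) + f (\<lambda>u. \<Sum>i\<in>UNIV. (- \<i> * h $ i) * \<phi> i u)"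
      by (rule tempered_distribution_add[OF f gauss_exp_schwartz[OF a] conjunct1[OF S]])
    ultimately show ?thesis
      using S by (simp add: D_def)
  qed
  have "bounded_linear D"
    unfolding D_def[abs_def] linear_conv_bounded_linear[symmetric]
    by (rule linearI) (simp_all add: algebra_simps sum.distrib scaleR_sum_right sum_subtractf sum_negf)
  moreover have "((\<lambda>h. norm (f (gauss_exp a (z + h)) - f (gauss_exp a z) - D h) / norm h) \<longlongrightarrow> 0) (at 0)"
  proof (rule Lim_null_comparison)
    show "\<forall>\<^sub>F h in at 0. norm (norm (f (gauss_exp a (z + h)) - f (gauss_exp a z) - D h) / norm h)
        \<le> \<bar>C\<bar> * \<bar>B\<bar> * norm h"
    proof (rule eventually_mono[OF eventually_at_ball[OF zero_less_one]])
      fix h :: "complex^'n" assume "h \<in> ball 0 1 \<and> h \<in> UNIV"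
      then have h: "norm h \<le> 1" by simp
      have "norm (f (R h)) \<le> C * seminorm_sum ps (R h)" using C R h by blast
      also have "\<dots> \<le> \<bar>C\<bar> * seminorm_sum ps (R h)"
        using seminorm_sum_nonneg[OF R[OF h]] by (intro mult_right_mono) auto
      also have "seminorm_sum ps (R h) \<le> \<bar>B\<bar> * (norm h)\<^sup>2"
        by (rule order_trans[OF B[OF h] mult_right_mono]) auto
      finally have "norm (f (R h)) \<le> \<bar>C\<bar> * (\<bar>B\<bar> * (norm h)\<^sup>2)" by (simp add: mult_left_mono)
      then show "norm (norm (f (gauss_exp a (z + h)) - f (gauss_exp a z) - D h) / norm h)
        \<le> \<bar>C\<bar> * \<bar>B\<bar> * norm h"
        unfolding expand[OF h] by (cases "h = 0") (simp_all add: field_simps power2_eq_square)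
    qed
    show "((\<lambda>h::complex^'n. \<bar>C\<bar> * \<bar>B\<bar> * norm h) \<longlongrightarrow> 0) (at 0)"
      by (auto intro!: tendsto_eq_intros)
  qed
  ultimately have "((\<lambda>z. f (gauss_exp a z)) has_derivative D) (at z)"
    unfolding has_derivative_at by blast
  moreover have "D (c *s v) = c * D v" for c v
    by (simp add: D_def sum_distrib_left mult_ac)
  ultimately show "\<exists>D. ((\<lambda>z. f (gauss_exp a z)) has_derivative D) (at z) \<and> (\<forall>c v. D (c *s v) = c * D v)"
    by blast
qed

lemma growth_bound_pairing_gauss_exp:
  assumes f: "tempered_distribution f" and a: "a > 0"
  shows "growth_bound a (\<lambda>z. f (gauss_exp a z))"
proof -
  obtain ps C where C: "\<And>\<phi>. \<phi> \<in> schwartz \<Longrightarrow> norm (f \<phi>) \<le> C * seminorm_sum ps \<phi>"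
    using f unfolding tempered_distribution_iff seminorm_dominated_def by blast
  obtain B m where B: "\<And>x y. seminorm_sum ps (gauss_exp a (complex_vec x y))
    \<le> B * (1 + (norm x)\<^sup>2 + (norm y)\<^sup>2) ^ m * exp ((norm y)\<^sup>2 / (2 * a))"
    using seminorm_sum_gauss_exp_growth[OF a] by blast
  have "norm (f (gauss_exp a (complex_vec x y)))
    \<le> (\<bar>C\<bar> * B) * (1 + (norm x)\<^sup>2 + (norm y)\<^sup>2) ^ m * exp (1/2 * inverse a * (norm y)\<^sup>2)" for x y
  proof -
    let ?s = "seminorm_sum ps (gauss_exp a (complex_vec x y))"
    have "norm (f (gauss_exp a (complex_vec x y))) \<le> C * ?s"
      using C gauss_exp_schwartz[OF a] by blast
    also have "\<dots> \<le> \<bar>C\<bar> * ?s"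
      using seminorm_sum_nonneg[OF gauss_exp_schwartz[OF a]] by (intro mult_right_mono) auto
    also have "\<dots> \<le> \<bar>C\<bar> * (B * (1 + (norm x)\<^sup>2 + (norm y)\<^sup>2) ^ m * exp ((norm y)\<^sup>2 / (2 * a)))"
      by (intro mult_left_mono B) auto
    also have "(norm y)\<^sup>2 / (2 * a) = 1/2 * inverse a * (norm y)\<^sup>2"
      by (simp add: field_simps)
    finally show ?thesis by (simp add: mult_ac)
  qed
  then show ?thesis
    unfolding growth_bound_def by blast
qed

definition transform_const :: "real \<Rightarrow> 'n::finite itself \<Rightarrow> real" where
  "transform_const c _ = (2 * pi) powr (- (real CARD('n) / 2)) * c"

lemma T_transform_eq:
  fixes f :: "(real^'n \<Rightarrow> complex) \<Rightarrow> complex"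
  assumes "tempered_distribution f" "a > 0"
  shows "T_transform c a f x = of_real (transform_const c TYPE('n)) * f (gauss_exp a (complex_vec x 0))"
proof -
  have "T_transform c a f x = f (\<lambda>u. of_real (transform_const c TYPE('n)) * gauss_exp a (complex_vec x 0) u)"
  proof -
    have "cdot (complex_vec x 0) u = of_real (x \<bullet> u)" for u
      by (simp add: cdot_def complex_vec_def inner_vec_def)
    then have "gauss_exp a (complex_vec x 0) u
        = of_real (exp (- (1/2) * a * (norm u)\<^sup>2)) * exp (- \<i> * of_real (x \<bullet> u))" for u
      unfolding gauss_exp_def exp_of_real[symmetric] exp_add[symmetric] by simp
    then show ?thesis
      by (simp add: T_transform_def windowed_fourier_def gaussian_window_def transform_const_def mult.assoc)
  qed
  then show ?thesis
    by (simp only: tempered_distribution_cmult[OF assms(1) gauss_exp_schwartz[OF assms(2)]])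
qed

lemma entire_cmult: "entire F \<Longrightarrow> entire (\<lambda>z. k * F z)"
  unfolding entire_def
proof
  fix z
  assume "\<forall>z. \<exists>D. (F has_derivative D) (at z) \<and> (\<forall>c v. D (c *s v) = c * D v)"
  then obtain D where D: "(F has_derivative D) (at z)" "\<And>c v. D (c *s v) = c * D v" by blast
  show "\<exists>D. ((\<lambda>z. k * F z) has_derivative D) (at z) \<and> (\<forall>c v. D (c *s v) = c * D v)"
    by (intro exI[of _ "\<lambda>v. k * D v"] conjI has_derivative_mult_right D(1)) (simp add: D(2) mult.left_commute)
qed

lemma growth_bound_cmult:
  assumes "growth_bound a F"
  shows "growth_bound a (\<lambda>z. k * F z)"
proof -
  obtain m C where "\<And>x y. norm (F (complex_vec x y))
      \<le> C * (1 + (norm x)\<^sup>2 + (norm y)\<^sup>2) ^ m * exp (1/2 * inverse a * (norm y)\<^sup>2)"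
    using assms unfolding growth_bound_def by blast
  then have "norm (k * F (complex_vec x y))
      \<le> (norm k * C) * (1 + (norm x)\<^sup>2 + (norm y)\<^sup>2) ^ m * exp (1/2 * inverse a * (norm y)\<^sup>2)" for x y
    by (simp add: norm_mult mult.assoc mult_left_mono)
  then show ?thesis
    unfolding growth_bound_def by blast
qed

lemma T_transform_entire_growth:
  fixes f :: "(real^'n \<Rightarrow> complex) \<Rightarrow> complex"
  assumes "tempered_distribution f" "a > 0"
  shows "\<exists>F. entire F \<and> (\<forall>x. F (complex_vec x 0) = T_transform c a f x) \<and> growth_bound a F"
  using entire_pairing_gauss_exp[OF assms] growth_bound_pairing_gauss_exp[OF assms] T_transform_eq[OF assms]
  by (intro exI[of _ "\<lambda>z. of_real (transform_const c TYPE('n)) * f (gauss_exp a z)"])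
    (auto intro: entire_cmult growth_bound_cmult)

section \<open>Measure-preserving maps\<close>

lemma nn_integral_lborel_translate:
  fixes c :: "'a::euclidean_space"
  assumes "g \<in> borel_measurable borel"
  shows "(\<integral>\<^sup>+x. g (x + c) \<partial>lborel) = (\<integral>\<^sup>+x. g x \<partial>lborel)"
proof -
  have "(\<integral>\<^sup>+x. g x \<partial>lborel) = (\<integral>\<^sup>+x. g x \<partial>distr lborel borel ((+) c))"
    by (simp add: lborel_distr_plus)
  also have "\<dots> = (\<integral>\<^sup>+x. g (x + c) \<partial>lborel)"
    using assms by (simp add: nn_integral_distr add.commute)
  finally show ?thesis by simp
qed

definition lborel_preserving :: "('a::euclidean_space \<Rightarrow> 'a) \<Rightarrow> bool" where
  "lborel_preserving T \<longleftrightarrow> T \<in> borel_measurable borel \<and> distr lborel borel T = lborel"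

lemma lborel_preservingI:
  assumes "T \<in> borel_measurable borel"
    and "\<And>A. A \<in> sets borel \<Longrightarrow> (\<integral>\<^sup>+p. indicator A (T p) \<partial>lborel) = (\<integral>\<^sup>+p. indicator A p \<partial>lborel)"
  shows "lborel_preserving T"
  unfolding lborel_preserving_def
proof (intro conjI measure_eqI)
  fix A assume "A \<in> sets (distr lborel borel T)"
  then have A: "A \<in> sets borel" by simp
  have "emeasure (distr lborel borel T) A = (\<integral>\<^sup>+p. indicator A p \<partial>distr lborel borel T)"
    using A by simp
  also have "\<dots> = (\<integral>\<^sup>+p. indicator A (T p) \<partial>lborel)"
    using assms(1) A by (intro nn_integral_distr) auto
  also have "\<dots> = emeasure lborel A"
    using assms(2)[OF A] A by simp
  finally show "emeasure (distr lborel borel T) A = emeasure lborel A" .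
qed (use assms in auto)

lemma lborel_preserving_comp:
  assumes "lborel_preserving S" "lborel_preserving T"
  shows "lborel_preserving (\<lambda>x. S (T x))"
proof -
  have [measurable]: "S \<in> borel_measurable borel" "T \<in> borel_measurable borel"
    using assms by (auto simp: lborel_preserving_def)
  have "distr (distr lborel borel T) borel S = lborel"
    using assms by (simp add: lborel_preserving_def)
  then have "distr lborel borel (S \<circ> T) = lborel"
    by (subst (asm) distr_distr) auto
  then show ?thesis
    by (simp add: lborel_preserving_def o_def)
qed

lemma integral_lborel_preserving:
  fixes f :: "'a::euclidean_space \<Rightarrow> 'b::{banach, second_countable_topology}"
  assumes "lborel_preserving T" "f \<in> borel_measurable borel"
  shows "(LINT x|lborel. f (T x)) = (LINT x|lborel. f x)"
proof -
  have "(LINT x|lborel. f x) = (LINT x|distr lborel borel T. f x)"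
    using assms by (simp add: lborel_preserving_def)
  also have "\<dots> = (LINT x|lborel. f (T x))"
    using assms by (intro integral_distr) (auto simp: lborel_preserving_def)
  finally show ?thesis by simp
qed

lemma integrable_lborel_preserving:
  fixes f :: "'a::euclidean_space \<Rightarrow> 'b::{banach, second_countable_topology}"
  assumes "lborel_preserving T" "f \<in> borel_measurable borel"
  shows "integrable lborel (\<lambda>x. f (T x)) \<longleftrightarrow> integrable lborel f"
proof -
  have "integrable lborel f \<longleftrightarrow> integrable (distr lborel borel T) f"
    using assms by (simp add: lborel_preserving_def)
  also have "\<dots> \<longleftrightarrow> integrable lborel (\<lambda>x. f (T x))"
    using assms by (intro integrable_distr_eq) (auto simp: lborel_preserving_def)
  finally show ?thesis by simp
qed

lemma lborel_preserving_translate: "lborel_preserving (\<lambda>x. x + c)"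
  by (rule lborel_preservingI, simp, rule nn_integral_lborel_translate, simp)

text \<open>For each fixed second component the shear is a translation of the first, so iterated
  integration reduces the claim to translation invariance.\<close>

lemma lborel_preserving_shear_fst:
  "lborel_preserving (\<lambda>p::'a::euclidean_space \<times> 'a. (fst p + t *\<^sub>R snd p, snd p))"
proof (rule lborel_preservingI)
  fix A :: "('a \<times> 'a) set" assume A[measurable]: "A \<in> sets borel"
  let ?S = "\<lambda>p::'a \<times> 'a. (fst p + t *\<^sub>R snd p, snd p)"
  have m[measurable]: "indicator A \<in> borel_measurable (borel \<Otimes>\<^sub>M borel :: ('a \<times> 'a) measure)"
    using A by (simp add: borel_prod)
  have S: "?S \<in> measurable borel borel"
    by (intro borel_measurable_continuous_onI continuous_intros)
  have "(\<lambda>p. indicator A (?S p) :: ennreal) \<in> borel_measurable borel"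
    using measurable_compose[OF S, of "indicator A" borel] A by simp
  then have mS: "(\<lambda>p. indicator A (?S p) :: ennreal) \<in> borel_measurable (lborel \<Otimes>\<^sub>M lborel)"
    by (simp add: lborel_prod)
  have mA: "(indicator A :: _ \<Rightarrow> ennreal) \<in> borel_measurable (lborel \<Otimes>\<^sub>M lborel)"
    using A by (simp add: lborel_prod)
  have "(\<integral>\<^sup>+p. indicator A (?S p) \<partial>lborel) = (\<integral>\<^sup>+y. \<integral>\<^sup>+x. indicator A (x + t *\<^sub>R y, y) \<partial>lborel \<partial>lborel)"
    using lborel_pair.nn_integral_snd[OF mS] by (simp add: lborel_prod)
  also have "\<dots> = (\<integral>\<^sup>+y. \<integral>\<^sup>+x. indicator A (x, y) \<partial>lborel \<partial>lborel)"
    by (intro nn_integral_cong nn_integral_lborel_translate[where g = "\<lambda>x. indicator A (x, _)"]) measurable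
  also have "\<dots> = (\<integral>\<^sup>+p. indicator A p \<partial>lborel)"
    using lborel_pair.nn_integral_snd[OF mA] by (simp add: lborel_prod)
  finally show "(\<integral>\<^sup>+p. indicator A (?S p) \<partial>lborel) = (\<integral>\<^sup>+p. indicator A p \<partial>lborel)" .
qed (intro borel_measurable_continuous_onI continuous_intros)

lemma lborel_preserving_shear_snd:
  "lborel_preserving (\<lambda>p::'a::euclidean_space \<times> 'a. (fst p, snd p + t *\<^sub>R fst p))"
proof (rule lborel_preservingI)
  fix A :: "('a \<times> 'a) set" assume A[measurable]: "A \<in> sets borel"
  let ?S = "\<lambda>p::'a \<times> 'a. (fst p, snd p + t *\<^sub>R fst p)"
  have m[measurable]: "indicator A \<in> borel_measurable (borel \<Otimes>\<^sub>M borel :: ('a \<times> 'a) measure)"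
    using A by (simp add: borel_prod)
  have S: "?S \<in> measurable borel borel"
    by (intro borel_measurable_continuous_onI continuous_intros)
  have "(\<lambda>p. indicator A (?S p) :: ennreal) \<in> borel_measurable borel"
    using measurable_compose[OF S, of "indicator A" borel] A by simp
  then have mS: "(\<lambda>p. indicator A (?S p) :: ennreal) \<in> borel_measurable (lborel \<Otimes>\<^sub>M lborel)"
    by (simp add: lborel_prod)
  have mA: "(indicator A :: _ \<Rightarrow> ennreal) \<in> borel_measurable (lborel \<Otimes>\<^sub>M lborel)"
    using A by (simp add: lborel_prod)
  have "(\<integral>\<^sup>+p. indicator A (?S p) \<partial>lborel) = (\<integral>\<^sup>+x. \<integral>\<^sup>+y. indicator A (x, y + t *\<^sub>R x) \<partial>lborel \<partial>lborel)"
    using lborel.nn_integral_fst[OF mS] by (simp add: lborel_prod)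
  also have "\<dots> = (\<integral>\<^sup>+x. \<integral>\<^sup>+y. indicator A (x, y) \<partial>lborel \<partial>lborel)"
    by (intro nn_integral_cong nn_integral_lborel_translate[where g = "\<lambda>y. indicator A (_, y)"]) measurable
  also have "\<dots> = (\<integral>\<^sup>+p. indicator A p \<partial>lborel)"
    using lborel.nn_integral_fst[OF mA] by (simp add: lborel_prod)
  finally show "(\<integral>\<^sup>+p. indicator A (?S p) \<partial>lborel) = (\<integral>\<^sup>+p. indicator A p \<partial>lborel)" .
qed (intro borel_measurable_continuous_onI continuous_intros)

text \<open>Multiplication by \<open>exp (\<i> * \<theta>)\<close> on complex vectors, written for
  the pair of real and imaginary parts; see \<open>complex_vec_rotation\<close>.\<close>

definition rotation :: "real \<Rightarrow> 'a::real_vector \<times> 'a \<Rightarrow> 'a \<times> 'a" where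
  "rotation \<theta> p = (cos \<theta> *\<^sub>R fst p - sin \<theta> *\<^sub>R snd p, sin \<theta> *\<^sub>R fst p + cos \<theta> *\<^sub>R snd p)"

lemma rotation_rotation: "rotation \<alpha> (rotation \<beta> p) = rotation (\<alpha> + \<beta>) p"
  by (simp add: rotation_def cos_add sin_add algebra_simps)

text \<open>A rotation by an angle other than \<open>\<pi>\<close> is a composition of three shears, with the
  coefficients \<open>- tan (\<theta> / 2)\<close>, \<open>sin \<theta>\<close> and \<open>- tan (\<theta> / 2)\<close>.\<close>

lemma lborel_preserving_rotation: "lborel_preserving (rotation \<theta> :: 'a::euclidean_space \<times> 'a \<Rightarrow> _)"
proof -
  have *: "lborel_preserving (rotation \<theta> :: 'a \<times> 'a \<Rightarrow> _)" if nz: "cos (\<theta> / 2) \<noteq> 0" for \<theta>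
  proof -
    define s c \<tau> where "s = sin (\<theta> / 2)" "c = cos (\<theta> / 2)" "\<tau> = s / c"
    have sc: "s\<^sup>2 + c\<^sup>2 = 1" by (simp add: s_c_\<tau>_def)
    have sin: "sin \<theta> = 2 * s * c" and cos: "cos \<theta> = 1 - 2 * s\<^sup>2"
      using sin_double[of "\<theta> / 2"] cos_double_sin[of "\<theta> / 2"] by (simp_all add: s_c_\<tau>_def)
    have c: "c \<noteq> 0" using nz by (simp add: s_c_\<tau>_def)
    have 1: "1 - sin \<theta> * \<tau> = cos \<theta>"
      using c by (simp add: sin cos s_c_\<tau>_def(3) power2_eq_square)
    have 2: "\<tau> + \<tau> * cos \<theta> = sin \<theta>"
    proof -
      have "1 + cos \<theta> = 2 * c\<^sup>2" using sc by (simp add: cos)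
      then have "\<tau> * (1 + cos \<theta>) = sin \<theta>"
        using c by (simp add: sin s_c_\<tau>_def(3) power2_eq_square)
      then show ?thesis by (simp add: distrib_left)
    qed
    define X where "X k p = (fst p + k *\<^sub>R snd p, snd p)" for k and p :: "'a \<times> 'a"
    define Y where "Y k p = (fst p, snd p + k *\<^sub>R fst p)" for k and p :: "'a \<times> 'a"
    have "rotation \<theta> p = X (- \<tau>) (Y (sin \<theta>) (X (- \<tau>) p))" for p
    proof -
      have y: "snd p + sin \<theta> *\<^sub>R (fst p - \<tau> *\<^sub>R snd p) = sin \<theta> *\<^sub>R fst p + cos \<theta> *\<^sub>R snd p"
        by (simp add: 1[symmetric] algebra_simps)
      have "fst p - \<tau> *\<^sub>R snd p - \<tau> *\<^sub>R (sin \<theta> *\<^sub>R fst p + cos \<theta> *\<^sub>R snd p)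
          = (1 - sin \<theta> * \<tau>) *\<^sub>R fst p - (\<tau> + \<tau> * cos \<theta>) *\<^sub>R snd p"
        by (simp add: algebra_simps)
      then show ?thesis
        using y by (simp add: rotation_def X_def Y_def 1 2)
    qed
    then have eq: "rotation \<theta> = (\<lambda>p. X (- \<tau>) (Y (sin \<theta>) (X (- \<tau>) p)))"
      by (rule ext)
    have X: "lborel_preserving (X (- \<tau>))"
      unfolding X_def[abs_def] by (rule lborel_preserving_shear_fst)
    have Y: "lborel_preserving (Y (sin \<theta>))"
      unfolding Y_def[abs_def] by (rule lborel_preserving_shear_snd)
    show ?thesis
      unfolding eq by (rule lborel_preserving_comp[OF X lborel_preserving_comp[OF Y X]])
  qed
  show ?thesis
  proof (cases "cos (\<theta> / 2) = 0")
    case True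
    \<comment> \<open>Here \<open>tan (\<theta> / 2)\<close> does not exist. The square of
      \<open>cos (\<theta> / 4)\<close> is 1/2, however, so the rotation by half the angle is
      already covered and is applied twice.\<close>
    have "cos (\<theta> / 2) = 2 * (cos (\<theta> / 2 / 2))\<^sup>2 - 1"
      using cos_double_cos[of "\<theta> / 2 / 2"] by simp
    then have "lborel_preserving (rotation (\<theta> / 2) :: 'a \<times> 'a \<Rightarrow> _)"
      using True by (intro *) auto
    note lborel_preserving_comp[OF this this]
    then show ?thesis by (simp add: rotation_rotation)
  qed (rule *)
qed

text \<open>Every \<open>T t\<close> preserves the integral, so Fubini allows the average over
  \<open>t\<close> to be taken inside; joint continuity supplies measurability on the product.
  Rotations will give the mean value argument, and translations along an axis integration by
  parts.\<close>

lemma integral_average: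
  fixes f :: "'a::euclidean_space \<Rightarrow> complex"
  assumes f: "integrable lborel f" "continuous_on UNIV f"
    and T: "\<And>t. lborel_preserving (T t)" "continuous_on UNIV (\<lambda>q. T (fst q) (snd q))"
  shows "(LINT p|lborel. (LINT t|lborel. indicator {0..1::real} t *\<^sub>R f (T t p))) = (LINT p|lborel. f p)"
proof -
  let ?g = "\<lambda>q. indicator {0..1::real} (fst q) *\<^sub>R f (T (fst q) (snd q))"
  have mf: "f \<in> borel_measurable borel"
    using f(2) by (rule borel_measurable_continuous_onI)
  have "(\<lambda>q. f (T (fst q) (snd q))) \<in> borel_measurable borel"
    by (intro borel_measurable_continuous_onI continuous_on_compose2[OF f(2) T(2)]) auto
  then have [measurable]: "(\<lambda>q. f (T (fst q) (snd q))) \<in> borel_measurable (borel \<Otimes>\<^sub>M borel)"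
    by (simp add: borel_prod)
  have int: "integrable (lborel \<Otimes>\<^sub>M lborel) ?g"
  proof (rule lborel_pair.Fubini_integrable)
    have "(\<lambda>t. LINT p|lborel. norm (?g (t, p))) = (\<lambda>t. indicator {0..1} t *\<^sub>R (LINT p|lborel. norm (f p)))"
    proof
      fix t
      have "(LINT p|lborel. norm (f (T t p))) = (LINT p|lborel. norm (f p))"
        using T(1) mf by (intro integral_lborel_preserving[where f = "\<lambda>x. norm (f x)"]) auto
      then show "(LINT p|lborel. norm (?g (t, p))) = indicator {0..1} t *\<^sub>R (LINT p|lborel. norm (f p))"
        by (simp add: indicator_def)
    qed
    then show "integrable lborel (\<lambda>t. LINT p|lborel. norm (?g (t, p)))"
      by simp
    show "AE t in lborel. integrable lborel (\<lambda>p. ?g (t, p))"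
      using integrable_lborel_preserving[OF T(1) mf] f(1) by auto
  qed measurable
  have "(LINT p|lborel. (LINT t|lborel. ?g (t, p))) = (LINT t|lborel. (LINT p|lborel. ?g (t, p)))"
    using lborel_pair.Fubini_integral[of "\<lambda>t p. ?g (t, p)"] int by (simp add: case_prod_beta')
  also have "\<dots> = (LINT t|lborel. indicator {0..1::real} t *\<^sub>R (LINT p|lborel. f p))"
    using integral_lborel_preserving[OF T(1) mf] by (intro Bochner_Integration.integral_cong) auto
  also have "\<dots> = (LINT p|lborel. f p)"
    by simp
  finally show ?thesis by simp
qed

section \<open>Integrals over products\<close>

text \<open>Lebesgue measure is by definition the image of the product of its coordinate measures,
  so the product formula for integrals applies.\<close>

lemma integral_lborel_prod_Basis:
  fixes f :: "'a::euclidean_space \<Rightarrow> real \<Rightarrow> complex"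
  assumes "\<And>b. b \<in> Basis \<Longrightarrow> integrable lborel (f b)"
  shows "integrable lborel (\<lambda>x::'a. \<Prod>b\<in>Basis. f b (x \<bullet> b))"
    and "(LINT x|lborel. (\<Prod>b\<in>Basis. f b (x \<bullet> b))) = (\<Prod>b\<in>Basis. LINT t|lborel. f b t)"
proof -
  interpret product_sigma_finite "\<lambda>b::'a. interval_measure (\<lambda>x. x)"
    by (simp add: product_sigma_finite_def lborel_eq_real[symmetric] lborel.sigma_finite_measure_axioms)
  have int: "integrable (interval_measure (\<lambda>x. x)) (f b)" if "b \<in> Basis" for b
    using assms[OF that] by (simp add: lborel_eq_real)
  have m: "f b \<in> borel_measurable borel" if "b \<in> Basis" for b
    using assms[OF that] by (auto dest: borel_measurable_integrable)
  have [measurable]: "(\<lambda>x::'a. \<Prod>b\<in>Basis. f b (x \<bullet> b)) \<in> borel_measurable borel"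
    using m by (intro borel_measurable_prod) (auto intro: measurable_compose[OF borel_measurable_inner])
  have eq: "(\<Prod>b\<in>Basis. f b ((\<Sum>b\<in>Basis. x b *\<^sub>R b) \<bullet> b)) = (\<Prod>b\<in>Basis. f b (x b))" for x :: "'a \<Rightarrow> real"
    by (intro prod.cong) auto
  show "integrable lborel (\<lambda>x::'a. \<Prod>b\<in>Basis. f b (x \<bullet> b))"
    unfolding lborel_def by (subst integrable_distr_eq) (auto simp: eq intro!: product_integrable_prod int)
  show "(LINT x|lborel. (\<Prod>b\<in>Basis. f b (x \<bullet> b))) = (\<Prod>b\<in>Basis. LINT t|lborel. f b t)"
    unfolding lborel_def[where 'a = 'a]
    by (subst integral_distr) (auto simp: eq lborel_eq_real intro!: product_integral_prod int)
qed

lemma integral_lborel_prod_cart: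
  fixes f :: "'n::finite \<Rightarrow> real \<Rightarrow> complex"
  assumes "\<And>i. integrable lborel (f i)"
  shows "integrable lborel (\<lambda>x::real^'n. \<Prod>i\<in>UNIV. f i (x $ i))"
    and "(LINT x|lborel. (\<Prod>i\<in>UNIV. f i ((x::real^'n) $ i))) = (\<Prod>i\<in>UNIV. LINT t|lborel. f i t)"
proof -
  define g where "g b = f (inv (\<lambda>i::'n. axis i (1::real)) b)" for b
  have inj: "inj (\<lambda>i::'n. axis i (1::real))"
    by (auto simp: inj_on_def axis_eq_axis)
  have g: "g (axis i 1) = f i" for i
    by (simp add: g_def inv_f_f[OF inj])
  have B: "(Basis :: (real^'n) set) = range (\<lambda>i. axis i 1)"
    by (auto simp: Basis_vec_def)
  have P: "(\<Prod>b\<in>Basis. h b) = (\<Prod>i\<in>UNIV. h (axis i 1))" for h :: "real^'n \<Rightarrow> complex"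
    unfolding B by (subst prod.reindex[OF inj]) simp
  have "integrable lborel (g b)" if "b \<in> Basis" for b
    using that assms by (auto simp: B g)
  then show "integrable lborel (\<lambda>x::real^'n. \<Prod>i\<in>UNIV. f i (x $ i))"
    "(LINT x|lborel. (\<Prod>i\<in>UNIV. f i ((x::real^'n) $ i))) = (\<Prod>i\<in>UNIV. LINT t|lborel. f i t)"
    using integral_lborel_prod_Basis[of g] by (simp_all add: P g inner_axis)
qed

text \<open>With the dimension as exponent, the weight is at most the product over the coordinates
  of 1 / (1 + t^2), which is integrable on the line.\<close>

definition decay_weight :: "real^'n \<Rightarrow> real" where
  "decay_weight x = inverse ((1 + (norm x)\<^sup>2) ^ CARD('n))"

lemma decay_weight_pos: "decay_weight x > 0"
  unfolding decay_weight_def by (simp add: add_pos_nonneg)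

lemma continuous_on_decay_weight: "continuous_on S decay_weight"
  unfolding decay_weight_def[abs_def]
  by (intro continuous_intros) (simp add: add_nonneg_eq_0_iff)

lemma borel_measurable_decay_weight [measurable]: "decay_weight \<in> borel_measurable borel"
  by (rule borel_measurable_continuous_onI[OF continuous_on_decay_weight])

lemma integrable_decay_weight: "integrable lborel (decay_weight :: real^'n \<Rightarrow> real)"
proof -
  have "integrable lborel (\<lambda>t::real. inverse (1 + t\<^sup>2))"
    using integrable_inverse_1_plus_square by (simp add: set_integrable_def)
  then have "integrable lborel (\<lambda>t::real. complex_of_real (inverse (1 + t\<^sup>2)))"
    by (rule integrable_of_real)
  from integral_lborel_prod_cart(1)[OF this]
  have "integrable lborel (\<lambda>x::real^'n. \<Prod>i\<in>UNIV. complex_of_real (inverse (1 + (x $ i)\<^sup>2)))" .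
  then show ?thesis
  proof (rule Bochner_Integration.integrable_bound)
    show "AE x in lborel. norm (decay_weight x) \<le> norm (\<Prod>i\<in>UNIV. complex_of_real (inverse (1 + ((x::real^'n) $ i)\<^sup>2)))"
    proof (rule AE_I2)
      fix x :: "real^'n"
      have "(\<Prod>i\<in>UNIV. 1 + (x $ i)\<^sup>2) \<le> (\<Prod>i\<in>(UNIV::'n set). 1 + (norm x)\<^sup>2)"
      proof (intro prod_mono conjI)
        fix i
        show "1 + (x $ i)\<^sup>2 \<le> 1 + (norm x)\<^sup>2"
          using power_mono[OF component_le_norm_cart[of x i] abs_ge_zero, of 2] by simp
      qed simp
      moreover have pos: "(\<Prod>i\<in>UNIV. 1 + (x $ i)\<^sup>2) > 0"
        by (intro prod_pos) (simp add: add_pos_nonneg)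
      ultimately have "decay_weight x \<le> inverse (\<Prod>i\<in>UNIV. 1 + (x $ i)\<^sup>2)"
        by (simp add: decay_weight_def le_imp_inverse_le)
      moreover have "norm (\<Prod>i\<in>UNIV. complex_of_real (inverse (1 + (x $ i)\<^sup>2))) = inverse (\<Prod>i\<in>UNIV. 1 + (x $ i)\<^sup>2)"
      proof -
        have "norm (\<Prod>i\<in>UNIV. complex_of_real (inverse (1 + (x $ i)\<^sup>2))) = \<bar>\<Prod>i\<in>UNIV. inverse (1 + (x $ i)\<^sup>2)\<bar>"
          by (simp only: of_real_prod[symmetric] norm_of_real)
        also have "(\<Prod>i\<in>UNIV. inverse (1 + (x $ i)\<^sup>2)) = inverse (\<Prod>i\<in>UNIV. 1 + (x $ i)\<^sup>2)"
          by (simp add: prod_inversef[symmetric] o_def)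
        also have "\<bar>\<dots>\<bar> = \<dots>"
          using pos by simp
        finally show ?thesis .
      qed
      ultimately show "norm (decay_weight x) \<le> norm (\<Prod>i\<in>UNIV. complex_of_real (inverse (1 + (x $ i)\<^sup>2)))"
        using decay_weight_pos[of x] by simp
    qed
  qed simp
qed

lemma integrable_decay_weight_pair:
  "integrable lborel (\<lambda>p::(real^'n) \<times> (real^'m). decay_weight (fst p) * decay_weight (snd p))"
  unfolding lborel_prod[symmetric]
proof (rule lborel_pair.Fubini_integrable)
  show "integrable lborel (\<lambda>x::real^'n. LINT y::real^'m|lborel. norm (decay_weight (fst (x, y)) * decay_weight (snd (x, y))))"
    by (simp add: abs_mult abs_of_pos[OF decay_weight_pos] integrable_decay_weight)
qed (auto simp: integrable_decay_weight)

text \<open>With \<open>c = sqrt (2 * A)\<close>, the substitution \<open>x = c * t\<close> turns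
  the integrand, up to a constant, into the standard normal density times a character. The value is
  read off the characteristic function of the normal distribution.\<close>

lemma integral_gaussian_1d:
  fixes A s :: real
  assumes "A > 0"
  shows "integrable lborel (\<lambda>t::real. exp (of_real (- A * t\<^sup>2) + \<i> * of_real (s * t)))"
    and "(LINT t|lborel. exp (of_real (- A * t\<^sup>2) + \<i> * of_real (s * t))) = of_real (sqrt (pi / A) * exp (- s\<^sup>2 / (4 * A)))"
proof -
  define c where "c = sqrt (2 * A)"
  have c: "c > 0" "c\<^sup>2 = 2 * A" using assms by (auto simp: c_def)
  define g where "g x = std_normal_density x *\<^sub>R iexp ((s / c) * x)" for x
  have m: "(\<lambda>x. iexp ((s / c) * x)) \<in> borel_measurable borel"
    by (intro borel_measurable_continuous_onI continuous_intros)
  have gi: "integrable lborel g"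
    unfolding g_def[abs_def]
    by (rule Bochner_Integration.integrable_bound[OF integrable_normal_density[OF zero_less_one, of 0]])
      (use m in \<open>auto simp: norm_mult\<close>)
  have "(LINT x|lborel. g x) = char std_normal_distribution (s / c)"
    unfolding char_def g_def using m by (subst integral_density) auto
  also have "\<dots> = of_real (exp (- (s / c)\<^sup>2 / 2))"
    by (simp add: char_std_normal_distribution)
  also have "- (s / c)\<^sup>2 / 2 = - s\<^sup>2 / (4 * A)"
    using c by (simp add: power_divide)
  finally have g: "(LINT x|lborel. g x) = of_real (exp (- s\<^sup>2 / (4 * A)))" .
  have eq: "g (0 + c * t) = of_real (1 / sqrt (2 * pi)) * exp (of_real (- A * t\<^sup>2) + \<i> * of_real (s * t))" for t
  proof -
    have "std_normal_density (c * t) = 1 / sqrt (2 * pi) * exp (- A * t\<^sup>2)"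
      using c by (simp add: std_normal_density_def power_mult_distrib)
    moreover have "exp (of_real (- A * t\<^sup>2) + \<i> * of_real (s * t)) = of_real (exp (- A * t\<^sup>2)) * iexp (s * t)"
      by (simp only: exp_add exp_of_real)
    ultimately show ?thesis
      using c by (simp add: g_def scaleR_conv_of_real)
  qed
  have nz: "complex_of_real (1 / sqrt (2 * pi)) \<noteq> 0" by simp
  have "integrable lborel (\<lambda>t. g (0 + c * t))"
    using gi c by (intro lborel_integrable_real_affine) auto
  then show "integrable lborel (\<lambda>t::real. exp (of_real (- A * t\<^sup>2) + \<i> * of_real (s * t)))"
    unfolding eq using nz integrable_mult_right[of "1 / complex_of_real (1 / sqrt (2 * pi))" lborel]
    by fastforce
  have "(LINT x|lborel. g x) = \<bar>c\<bar> *\<^sub>R (LINT t|lborel. g (0 + c * t))"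
    using c by (intro lborel_integral_real_affine) auto
  also have "\<dots> = of_real (c / sqrt (2 * pi)) * (LINT t|lborel. exp (of_real (- A * t\<^sup>2) + \<i> * of_real (s * t)))"
    unfolding eq using c by (simp add: scaleR_conv_of_real)
  finally have "(LINT t|lborel. exp (of_real (- A * t\<^sup>2) + \<i> * of_real (s * t))) =
      of_real (sqrt (2 * pi) / c) * of_real (exp (- s\<^sup>2 / (4 * A)))"
    using c g by (simp add: field_simps)
  moreover have "sqrt (2 * pi) / c = sqrt (pi / A)"
    unfolding c_def real_sqrt_divide[symmetric] by simp
  ultimately show "(LINT t|lborel. exp (of_real (- A * t\<^sup>2) + \<i> * of_real (s * t))) =
      of_real (sqrt (pi / A) * exp (- s\<^sup>2 / (4 * A)))"
    by simp
qed

lemma integral_gaussian: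
  fixes s :: "real^'n"
  assumes "A > 0"
  shows "(LINT u|lborel. exp (of_real (- A * (norm u)\<^sup>2) + \<i> * of_real (s \<bullet> u))) =
    of_real (sqrt (pi / A) ^ CARD('n) * exp (- (norm s)\<^sup>2 / (4 * A)))"
proof -
  have n: "(norm u)\<^sup>2 = (\<Sum>i\<in>UNIV. (u $ i)\<^sup>2)" for u :: "real^'n"
    unfolding power2_norm_eq_inner inner_vec_def by (simp add: power2_eq_square)
  have "exp (of_real (- A * (norm u)\<^sup>2) + \<i> * of_real (s \<bullet> u)) =
      (\<Prod>i\<in>UNIV. exp (of_real (- A * (u $ i)\<^sup>2) + \<i> * of_real (s $ i * u $ i)))" for u :: "real^'n"
    unfolding exp_sum[OF finite, symmetric] n inner_vec_def
    by (simp add: sum.distrib sum_subtractf sum_distrib_left sum_negf)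
  then have "(LINT u|lborel. exp (of_real (- A * (norm u)\<^sup>2) + \<i> * of_real (s \<bullet> u))) =
      (LINT u|lborel. (\<Prod>i\<in>UNIV. exp (of_real (- A * ((u::real^'n) $ i)\<^sup>2) + \<i> * of_real (s $ i * u $ i))))"
    by simp
  also have "\<dots> = (\<Prod>i\<in>UNIV. of_real (sqrt (pi / A) * exp (- (s $ i)\<^sup>2 / (4 * A))))"
    using integral_gaussian_1d[OF assms] by (subst integral_lborel_prod_cart(2)) auto
  also have "\<dots> = of_real (\<Prod>i\<in>UNIV. sqrt (pi / A) * exp (- (s $ i)\<^sup>2 / (4 * A)))"
    by simp
  also have "(\<Prod>i\<in>UNIV. sqrt (pi / A) * exp (- (s $ i)\<^sup>2 / (4 * A))) =
      sqrt (pi / A) ^ CARD('n) * exp (\<Sum>i\<in>UNIV. - (s $ i)\<^sup>2 / (4 * A))"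
    unfolding prod.distrib exp_sum[OF finite] by simp
  also have "(\<Sum>i\<in>UNIV. - (s $ i)\<^sup>2 / (4 * A)) = - (norm s)\<^sup>2 / (4 * A)"
    unfolding n by (simp add: sum_divide_distrib sum_negf)
  finally show ?thesis .
qed

section \<open>Gaussian means of entire functions\<close>

lemma complex_vec_rotation:
  "complex_vec (fst (rotation \<theta> p)) (snd (rotation \<theta> p)) = exp (\<i> * of_real \<theta>) *s complex_vec (fst p) (snd p)"
  by (simp add: complex_vec_def rotation_def vec_eq_iff complex_eq_iff Re_exp Im_exp algebra_simps)

lemma norm_rotation: "norm (rotation \<theta> p) = norm (p :: 'a::real_inner \<times> 'a)"
proof -
  have "(C *\<^sub>R x - S *\<^sub>R y) \<bullet> (C *\<^sub>R x - S *\<^sub>R y) + (S *\<^sub>R x + C *\<^sub>R y) \<bullet> (S *\<^sub>R x + C *\<^sub>R y)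
      = (S\<^sup>2 + C\<^sup>2) * (x \<bullet> x + y \<bullet> y)" for C S :: real and x y :: 'a
    by (simp add: inner_diff_left inner_diff_right inner_add_left inner_add_right inner_commute
        power2_eq_square algebra_simps)
  then have "rotation \<theta> p \<bullet> rotation \<theta> p = p \<bullet> p"
    by (simp add: inner_prod_def rotation_def)
  then show ?thesis by (simp add: norm_eq_sqrt_inner)
qed

lemma continuous_on_complex_vec: "continuous_on S (\<lambda>p. complex_vec (fst p) (snd p))"
  unfolding complex_vec_def by (intro continuous_intros)

lemma entire_continuous: "entire F \<Longrightarrow> continuous_on S F"
  unfolding entire_def by (meson continuous_at_imp_continuous_on has_derivative_continuous)

text \<open>Along the complex line through \<open>z\<close>, \<open>H\<close> becomes an entire
  function of one variable with value \<open>H 0\<close> at the origin, and Cauchy's formula gives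
  its mean over the unit circle.\<close>

lemma circle_mean_entire:
  fixes H :: "complex^'n \<Rightarrow> complex"
  assumes "entire H"
  shows "(LINT t|lborel. indicator {0..1::real} t *\<^sub>R H (exp (\<i> * of_real (2 * pi * t)) *s z)) = H 0"
proof -
  define g where "g s = H (s *s z)" for s
  have g: "(g has_field_derivative D z') (at s)" if "(H has_derivative D) (at (s *s z))" "\<And>c v. D (c *s v) = c * D v" "z' = z" for s D z'
  proof -
    have "((\<lambda>s. s *s z) has_derivative (\<lambda>s. s *s z)) (at s)"
      by (intro bounded_linear_imp_has_derivative)
        (simp add: linear_conv_bounded_linear[symmetric] linear_iff vec_eq_iff algebra_simps vector_scalar_mult_def)
    then have "((\<lambda>s. H (s *s z)) has_derivative (\<lambda>s. D (s *s z))) (at s)"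
      by (rule has_derivative_compose[where g = H and g' = D]) (rule that(1))
    \<comment> \<open>Complex homogeneity of the derivative enters here: it turns the real
      differential along the line into multiplication by a complex number.\<close>
    moreover have "(\<lambda>s. D z' * s) = (\<lambda>s. D (s *s z))"
      using that(2,3) by (simp add: fun_eq_iff mult.commute)
    ultimately show ?thesis
      by (simp only: g_def[abs_def] has_field_derivative_def)
  qed
  have hol: "g holomorphic_on UNIV"
    unfolding holomorphic_on_def field_differentiable_def
    using assms g unfolding entire_def by (metis (no_types, lifting))
  have cp: "circlepath 0 1 t = exp (2 * of_real pi * \<i> * of_real t)" for t
    by (simp add: circlepath)
  from hol have "((\<lambda>u. g u / (u - 0)) has_contour_integral (2 * of_real pi * \<i> * g 0)) (circlepath 0 1)"
    by (intro Cauchy_integral_circlepath_simple) (auto intro: holomorphic_on_subset)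
  then have "((\<lambda>t. g (exp (2 * of_real pi * \<i> * of_real t)) * (2 * of_real pi * \<i>)) has_integral 2 * of_real pi * \<i> * g 0) {0..1}"
    unfolding has_contour_integral_def
    by (rule has_integral_eq[rotated]) (simp add: vector_derivative_circlepath01 cp)
  then have "((\<lambda>t. g (exp (2 * of_real pi * \<i> * of_real t)) * (2 * of_real pi * \<i>) / (2 * of_real pi * \<i>))
      has_integral (2 * of_real pi * \<i> * g 0) / (2 * of_real pi * \<i>)) {0..1}"
    by (rule has_integral_divide)
  then have int: "((\<lambda>t. g (exp (\<i> * of_real (2 * pi * t)))) has_integral g 0) {0..1}"
    by (simp add: mult_ac)
  have "continuous_on {0..1::real} (\<lambda>t. g (exp (\<i> * of_real (2 * pi * t))))"
    by (intro continuous_on_compose2[OF holomorphic_on_imp_continuous_on[OF hol]] continuous_intros) auto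
  then have "(LINT t:{0..1::real}|lborel. g (exp (\<i> * of_real (2 * pi * t)))) = g 0"
    using int by (subst set_borel_integral_eq_integral(2)) (auto intro: borel_integrable_atLeastAtMost' integral_unique)
  then show ?thesis
    by (simp add: set_lebesgue_integral_def g_def)
qed

text \<open>The Gaussian is constant on the orbits of the rotations, so averaging over them affects
  only \<open>H\<close>, whose circle means all equal \<open>H 0\<close>.\<close>

lemma gaussian_mean_entire:
  fixes H :: "complex^'n \<Rightarrow> complex"
  assumes "entire H"
    and int: "integrable lborel (\<lambda>p::(real^'n) \<times> (real^'n). H (complex_vec (fst p) (snd p)) * of_real (exp (- b * (norm p)\<^sup>2)))"
  shows "(LINT p|lborel. H (complex_vec (fst p) (snd p)) * of_real (exp (- b * (norm p)\<^sup>2)))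
    = H 0 * of_real (LINT p::(real^'n) \<times> (real^'n)|lborel. exp (- b * (norm p)\<^sup>2))"
proof -
  let ?f = "\<lambda>p::(real^'n) \<times> (real^'n). H (complex_vec (fst p) (snd p)) * of_real (exp (- b * (norm p)\<^sup>2))"
  have "continuous_on UNIV ?f"
    by (intro continuous_intros continuous_on_compose2[OF entire_continuous[OF assms(1)] continuous_on_complex_vec]) auto
  moreover have "continuous_on UNIV (\<lambda>q::real \<times> (real^'n) \<times> (real^'n). rotation (2 * pi * fst q) (snd q))"
    unfolding rotation_def by (intro continuous_intros)
  ultimately have "(LINT p|lborel. ?f p) =
      (LINT p|lborel. (LINT t|lborel. indicator {0..1::real} t *\<^sub>R ?f (rotation (2 * pi * t) p)))"
    using int by (intro integral_average[symmetric] lborel_preserving_rotation)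
  also have "\<dots> = (LINT p|lborel. (LINT t|lborel. indicator {0..1::real} t *\<^sub>R
      H (exp (\<i> * of_real (2 * pi * t)) *s complex_vec (fst p) (snd p)) * of_real (exp (- b * (norm p)\<^sup>2))))"
    unfolding complex_vec_rotation norm_rotation by simp
  also have "\<dots> = (LINT p|lborel. H 0 * of_real (exp (- b * (norm (p :: (real^'n) \<times> (real^'n)))\<^sup>2)))"
    by (simp only: integral_mult_left_zero circle_mean_entire[OF assms(1)])
  also have "\<dots> = H 0 * of_real (LINT p::(real^'n) \<times> (real^'n)|lborel. exp (- b * (norm p)\<^sup>2))"
    by (simp only: integral_mult_right_zero integral_complex_of_real)
  finally show ?thesis .
qed

section \<open>Integration by parts\<close>

text \<open>Boundary terms at infinity are avoided: averaging over the translations by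
  \<open>t *\<^sub>R axis i 1\<close> with \<open>t\<close> between 0 and 1 turns the integrand into
  the difference between a unit translate of \<phi> and \<phi> itself, which integrates to 0 by
  translation invariance.\<close>

lemma integral_partial_eq_0:
  assumes "integrable lborel \<phi>" "integrable lborel (partial i \<phi>)"
    and "\<And>x. \<phi> differentiable (at x)" "continuous_on UNIV (partial i \<phi>)"
  shows "(LINT x|lborel. partial i \<phi> x) = 0"
proof -
  let ?e = "axis i 1 :: real^'a"
  have "continuous_on UNIV (\<lambda>q::real \<times> (real^'a). snd q + fst q *\<^sub>R ?e)"
    by (intro continuous_intros)
  then have "(LINT x|lborel. partial i \<phi> x) =
      (LINT x|lborel. (LINT t|lborel. indicator {0..1::real} t *\<^sub>R partial i \<phi> (x + t *\<^sub>R ?e)))"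
    using assms by (intro integral_average[symmetric, where T = "\<lambda>t x. x + t *\<^sub>R ?e"] lborel_preserving_translate)
  also have "\<dots> = (LINT x|lborel. \<phi> (x + ?e) - \<phi> x)"
  proof (intro Bochner_Integration.integral_cong refl)
    fix x
    have "continuous_on {0..1} (\<lambda>t. partial i \<phi> (x + t *\<^sub>R ?e))"
      by (intro continuous_on_compose2[OF assms(4)] continuous_intros) auto
    then have "(LINT t|lborel. indicator {0..1::real} t *\<^sub>R partial i \<phi> (x + t *\<^sub>R ?e)) = \<phi> (x + 1 *\<^sub>R ?e) - \<phi> (x + 0 *\<^sub>R ?e)"
      using partial_has_vector_derivative[OF assms(3)]
      by (intro integral_FTC_Icc) (auto intro: has_vector_derivative_at_within)
    then show "(LINT t|lborel. indicator {0..1::real} t *\<^sub>R partial i \<phi> (x + t *\<^sub>R ?e)) = \<phi> (x + ?e) - \<phi> x"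
      by simp
  qed
  also have "\<dots> = (LINT x|lborel. \<phi> (x + ?e)) - (LINT x|lborel. \<phi> x)"
    using assms(1) by (intro Bochner_Integration.integral_diff)
      (auto simp: integrable_lborel_preserving[OF lborel_preserving_translate, where f = \<phi>] dest: borel_measurable_integrable)
  also have "\<dots> = 0"
    using assms(1) by (simp add: integral_lborel_preserving[OF lborel_preserving_translate, where f = \<phi>] borel_measurable_integrable)
  finally show ?thesis .
qed

section \<open>Windowing and Fourier decay\<close>

lemma one_plus_norm_pos: "1 + (norm x)\<^sup>2 > 0"
  by (simp add: add_pos_nonneg)

lemma schwartz_partial: "\<phi> \<in> schwartz \<Longrightarrow> partial i \<phi> \<in> schwartz"
  by (rule schwartzI) (auto simp: partials_snoc[symmetric] smooth_partial schwartz_smooth intro: decay_seminorm_bound)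

lemma schwartz_partials: "\<phi> \<in> schwartz \<Longrightarrow> partials \<beta> \<phi> \<in> schwartz"
  by (induction \<beta>) (auto simp: partials_Cons schwartz_partial)

text \<open>The decay in \<open>u - v\<close> comes from \<open>q\<close> and its derivatives alone,
  which makes the bound uniform in \<open>v\<close>. The induction removes the innermost derivative,
  so that the product rule leaves products of the same shape, with \<open>partial i \<psi>\<close>
  or \<open>partial i q\<close> as a factor; hence \<open>q\<close> is generalized.\<close>

lemma partials_window_bound:
  fixes q :: "real^'n \<Rightarrow> complex"
  assumes "q \<in> schwartz"
  shows "\<exists>C Bs. C \<ge> 0 \<and> (\<forall>\<psi> u v. smooth \<psi> \<longrightarrow>
    norm (partials \<beta> (\<lambda>u. \<psi> u * q (u - v)) u) * (1 + (norm (u - v))\<^sup>2) ^ L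
      \<le> C * (\<Sum>\<gamma>\<leftarrow>Bs. norm (partials \<gamma> \<psi> u)))"
  using assms
proof (induction \<beta> arbitrary: q rule: rev_induct)
  case Nil
  have "norm (\<psi> u * q (u - v)) * (1 + (norm (u - v))\<^sup>2) ^ L \<le> decay_seminorm L [] q * norm (\<psi> u)" for \<psi> :: "real^'n \<Rightarrow> complex" and u v
    using mult_left_mono[OF decay_seminorm_bound[OF Nil, of "u - v" L "[]"], of "norm (\<psi> u)"]
    by (simp add: norm_mult mult_ac)
  then show ?case
    by (intro exI[of _ "decay_seminorm L [] q"] exI[of _ "[[]]"]) (simp add: decay_seminorm_nonneg Nil)
next
  case (snoc i \<beta>)
  obtain C Bs where C: "C \<ge> 0" "\<And>\<psi> u v. smooth \<psi> \<Longrightarrow>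
      norm (partials \<beta> (\<lambda>u. \<psi> u * q (u - v)) u) * (1 + (norm (u - v))\<^sup>2) ^ L
      \<le> C * (\<Sum>\<gamma>\<leftarrow>Bs. norm (partials \<gamma> \<psi> u))"
    using snoc.IH[OF snoc.prems] by blast
  obtain D Ds where D: "D \<ge> 0" "\<And>\<psi> u v. smooth \<psi> \<Longrightarrow>
      norm (partials \<beta> (\<lambda>u. \<psi> u * partial i q (u - v)) u) * (1 + (norm (u - v))\<^sup>2) ^ L
      \<le> D * (\<Sum>\<gamma>\<leftarrow>Ds. norm (partials \<gamma> \<psi> u))"
    using snoc.IH[OF schwartz_partial[OF snoc.prems]] by blast
  have "norm (partials (\<beta> @ [i]) (\<lambda>u. \<psi> u * q (u - v)) u) * (1 + (norm (u - v))\<^sup>2) ^ L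
      \<le> (C + D) * (\<Sum>\<gamma>\<leftarrow>map (\<lambda>\<gamma>. \<gamma> @ [i]) Bs @ Ds. norm (partials \<gamma> \<psi> u))"
    if \<psi>: "smooth \<psi>" for \<psi> u v
  proof -
    have q: "smooth (\<lambda>u. q (u - v))" "smooth (\<lambda>u. partial i q (u - v))"
      using snoc.prems by (auto intro: smooth_translate smooth_partial schwartz_smooth)
    have "partial i (\<lambda>u. \<psi> u * q (u - v)) = (\<lambda>u. partial i \<psi> u * q (u - v) + \<psi> u * partial i q (u - v))"
      using partial_mult[OF smooth_differentiable[OF \<psi>] smooth_differentiable[OF q(1)], of i]
      by (simp add: fun_eq_iff partial_translate)
    then have "partials (\<beta> @ [i]) (\<lambda>u. \<psi> u * q (u - v)) u =
        partials \<beta> (\<lambda>u. partial i \<psi> u * q (u - v)) u + partials \<beta> (\<lambda>u. \<psi> u * partial i q (u - v)) u"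
      using \<psi> q by (simp add: partials_snoc partials_add smooth_mult smooth_partial)
    then have "norm (partials (\<beta> @ [i]) (\<lambda>u. \<psi> u * q (u - v)) u) * (1 + (norm (u - v))\<^sup>2) ^ L \<le>
        norm (partials \<beta> (\<lambda>u. partial i \<psi> u * q (u - v)) u) * (1 + (norm (u - v))\<^sup>2) ^ L +
        norm (partials \<beta> (\<lambda>u. \<psi> u * partial i q (u - v)) u) * (1 + (norm (u - v))\<^sup>2) ^ L"
      unfolding distrib_right[symmetric] by (intro mult_right_mono) (auto intro: norm_triangle_ineq)
    also have "\<dots> \<le> C * (\<Sum>\<gamma>\<leftarrow>Bs. norm (partials \<gamma> (partial i \<psi>) u)) + D * (\<Sum>\<gamma>\<leftarrow>Ds. norm (partials \<gamma> \<psi> u))"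
      by (intro add_mono C(2) D(2) smooth_partial \<psi>)
    also have "\<dots> \<le> (C + D) * (\<Sum>\<gamma>\<leftarrow>Bs. norm (partials \<gamma> (partial i \<psi>) u)) + (C + D) * (\<Sum>\<gamma>\<leftarrow>Ds. norm (partials \<gamma> \<psi> u))"
      using C(1) D(1) by (intro add_mono mult_right_mono sum_list_nonneg) auto
    finally show ?thesis
      by (simp add: partials_snoc o_def distrib_left)
  qed
  then show ?case
    using C(1) D(1)
    by (intro exI[of _ "C + D"] exI[of _ "map (\<lambda>\<gamma>. \<gamma> @ [i]) Bs @ Ds"] conjI allI impI add_nonneg_nonneg)
qed

lemma peetre: "1 + (norm v)\<^sup>2 \<le> 2 * ((1 + (norm u)\<^sup>2) * (1 + (norm (u - v))\<^sup>2))" for u v :: "'a::real_inner"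
proof -
  have "norm v \<le> norm u + norm (u - v)"
    using norm_triangle_ineq4[of u "u - v"] by simp
  then have "(norm v)\<^sup>2 \<le> (norm u + norm (u - v))\<^sup>2"
    by (intro power_mono) auto
  also have "\<dots> \<le> 2 * (norm u)\<^sup>2 + 2 * (norm (u - v))\<^sup>2"
    using sum_squares_bound[of "norm u" "norm (u - v)"] by (simp add: power2_sum)
  finally have "1 + (norm v)\<^sup>2 \<le> 2 + 2 * (norm u)\<^sup>2 + 2 * (norm (u - v))\<^sup>2 + 2 * ((norm u)\<^sup>2 * (norm (u - v))\<^sup>2)"
    by (simp add: add_increasing2)
  then show ?thesis
    by (simp add: algebra_simps)
qed

text \<open>The test function decays in \<open>u\<close> and the window in \<open>u - v\<close>;
  \<open>peetre\<close> converts \<open>L\<close> powers of each into \<open>L\<close> powers of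
  decay in \<open>v\<close>, and \<open>M\<close> further powers of the test function's decay remain
  for \<open>u\<close>.\<close>

lemma window_decay:
  fixes q :: "real^'n \<Rightarrow> complex"
  assumes "q \<in> schwartz"
  shows "\<exists>p. seminorm_dominated p \<and> (\<forall>\<psi>\<in>schwartz. \<forall>u v.
    (1 + (norm v)\<^sup>2) ^ L * (1 + (norm u)\<^sup>2) ^ M * norm (partials \<beta> (\<lambda>u. \<psi> u * q (u - v)) u) \<le> p \<psi>)"
proof -
  obtain C Bs where C: "C \<ge> 0" "\<And>\<psi> u v. smooth \<psi> \<Longrightarrow>
      norm (partials \<beta> (\<lambda>u. \<psi> u * q (u - v)) u) * (1 + (norm (u - v))\<^sup>2) ^ L
      \<le> C * (\<Sum>\<gamma>\<leftarrow>Bs. norm (partials \<gamma> \<psi> u))"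
    using partials_window_bound[OF assms] by blast
  let ?p = "\<lambda>\<psi>. (2 ^ L * C) * (\<Sum>\<gamma>\<leftarrow>Bs. decay_seminorm (L + M) \<gamma> \<psi>)"
  have "seminorm_dominated ?p"
    using C(1) by (intro seminorm_dominated_cmult seminorm_dominated_sum_list seminorm_dominated_decay_seminorm) auto
  moreover have "(1 + (norm v)\<^sup>2) ^ L * (1 + (norm u)\<^sup>2) ^ M * norm (partials \<beta> (\<lambda>u. \<psi> u * q (u - v)) u) \<le> ?p \<psi>"
    if \<psi>: "\<psi> \<in> schwartz" for \<psi> u v
  proof -
    let ?n = "norm (partials \<beta> (\<lambda>u. \<psi> u * q (u - v)) u)"
    have "(1 + (norm v)\<^sup>2) ^ L * (1 + (norm u)\<^sup>2) ^ M * ?n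
        \<le> (2 * ((1 + (norm u)\<^sup>2) * (1 + (norm (u - v))\<^sup>2))) ^ L * (1 + (norm u)\<^sup>2) ^ M * ?n"
      by (intro mult_right_mono power_mono peetre) auto
    also have "\<dots> = 2 ^ L * (1 + (norm u)\<^sup>2) ^ (L + M) * (?n * (1 + (norm (u - v))\<^sup>2) ^ L)"
      by (simp add: power_mult_distrib power_add mult_ac)
    also have "\<dots> \<le> 2 ^ L * (1 + (norm u)\<^sup>2) ^ (L + M) * (C * (\<Sum>\<gamma>\<leftarrow>Bs. norm (partials \<gamma> \<psi> u)))"
      using \<psi> by (intro mult_left_mono C(2) schwartz_smooth) auto
    also have "\<dots> = (2 ^ L * C) * (\<Sum>\<gamma>\<leftarrow>Bs. (1 + (norm u)\<^sup>2) ^ (L + M) * norm (partials \<gamma> \<psi> u))"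
      unfolding sum_list_const_mult by (simp only: mult_ac)
    also have "\<dots> \<le> ?p \<psi>"
      using C(1) by (intro mult_left_mono sum_list_mono decay_seminorm_bound \<psi>) auto
    finally show ?thesis .
  qed
  ultimately show ?thesis by blast
qed

lemma schwartz_window:
  assumes "q \<in> schwartz" "\<psi> \<in> schwartz"
  shows "(\<lambda>u. \<psi> u * q (u - v)) \<in> schwartz"
proof (rule schwartzI)
  fix N \<beta>
  show "\<exists>B. \<forall>x. (1 + (norm x)\<^sup>2) ^ N * norm (partials \<beta> (\<lambda>u. \<psi> u * q (u - v)) x) \<le> B"
    using window_decay[OF assms(1), of 0 N \<beta>] assms(2) by auto
qed (rule smooth_mult[OF schwartz_smooth[OF assms(2)] smooth_translate[OF schwartz_smooth[OF assms(1)]]])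

section \<open>Fourier integrals of Schwartz functions\<close>

lemma schwartz_measurable: "\<phi> \<in> schwartz \<Longrightarrow> \<phi> \<in> borel_measurable borel"
  by (intro borel_measurable_continuous_onI smooth_continuous schwartz_smooth)

lemma schwartz_integrable:
  fixes \<phi> :: "real^'n \<Rightarrow> complex"
  assumes "\<phi> \<in> schwartz"
  shows "integrable lborel \<phi>"
proof (rule Bochner_Integration.integrable_bound)
  let ?B = "decay_seminorm CARD('n) [] \<phi>"
  show "integrable lborel (\<lambda>x::real^'n. ?B * decay_weight x)"
    by (intro integrable_mult_right integrable_decay_weight)
  have "norm (\<phi> x) \<le> norm (?B * decay_weight x)" for x
  proof -
    have "norm (\<phi> x) \<le> ?B * decay_weight x"
      using decay_seminorm_bound[OF assms, of x "CARD('n)" "[]"] one_plus_norm_pos[of x]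
      by (simp add: decay_weight_def field_simps)
    then show ?thesis by simp
  qed
  then show "AE x in lborel. norm (\<phi> x) \<le> norm (?B * decay_weight x)" by simp
qed (use schwartz_measurable[OF assms] in simp)

lemma integrable_mult_iexp_inner:
  fixes \<phi> :: "real^'n \<Rightarrow> complex"
  assumes "\<phi> \<in> schwartz"
  shows "integrable lborel (\<lambda>u. \<phi> u * exp (\<i> * of_real (x \<bullet> u)))"
proof (rule Bochner_Integration.integrable_bound[OF schwartz_integrable[OF assms]])
  have "(\<lambda>u. exp (\<i> * of_real (x \<bullet> u))) \<in> borel_measurable borel"
    by (intro borel_measurable_continuous_onI continuous_intros)
  then show "(\<lambda>u. \<phi> u * exp (\<i> * of_real (x \<bullet> u))) \<in> borel_measurable lborel"
    using schwartz_measurable[OF assms] by simp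
qed (simp add: norm_mult)

lemma partial_iexp_inner:
  "(\<lambda>u. exp (\<i> * of_real (x \<bullet> u))) differentiable (at u)"
  "partial i (\<lambda>u. exp (\<i> * of_real (x \<bullet> u))) u = \<i> * of_real (x $ i) * exp (\<i> * of_real (x \<bullet> u))"
proof -
  have "((\<lambda>u. \<i> * of_real (x \<bullet> u)) has_derivative (\<lambda>v. \<i> * of_real (x \<bullet> v))) (at u)"
    by (intro has_derivative_mult_right has_derivative_of_real has_derivative_inner_right has_derivative_ident)
  note D = has_derivative_compose[OF this DERIV_exp[unfolded has_field_derivative_def]]
  show "(\<lambda>u. exp (\<i> * of_real (x \<bullet> u))) differentiable (at u)"
    using D unfolding differentiable_def by blast
  show "partial i (\<lambda>u. exp (\<i> * of_real (x \<bullet> u))) u = \<i> * of_real (x $ i) * exp (\<i> * of_real (x \<bullet> u))"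
    by (rule trans[OF partial_eq_derivative[OF D]]) (simp add: inner_axis mult_ac)
qed

lemma integral_partial_mult_iexp:
  assumes "\<phi> \<in> schwartz"
  shows "(LINT u|lborel. partial i \<phi> u * exp (\<i> * of_real (x \<bullet> u))) =
    - (\<i> * of_real (x $ i)) * (LINT u|lborel. \<phi> u * exp (\<i> * of_real (x \<bullet> u)))"
proof -
  let ?e = "\<lambda>u. exp (\<i> * of_real (x \<bullet> u))"
  have eq: "partial i (\<lambda>u. \<phi> u * ?e u) = (\<lambda>u. partial i \<phi> u * ?e u + (\<i> * of_real (x $ i)) * (\<phi> u * ?e u))"
    using partial_mult[OF smooth_differentiable[OF schwartz_smooth[OF assms]] partial_iexp_inner(1)]
    by (simp add: fun_eq_iff partial_iexp_inner(2) mult_ac)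
  note int = integrable_mult_iexp_inner[OF assms, of x] integrable_mult_iexp_inner[OF schwartz_partial[OF assms], of i x]
  have "0 = (LINT u|lborel. partial i (\<lambda>u. \<phi> u * ?e u) u)"
  proof (rule integral_partial_eq_0[symmetric])
    show "integrable lborel (partial i (\<lambda>u. \<phi> u * ?e u))"
      unfolding eq using int by (intro Bochner_Integration.integrable_add integrable_mult_right)
    show "continuous_on UNIV (partial i (\<lambda>u. \<phi> u * ?e u))"
      unfolding eq using assms
      by (intro continuous_intros smooth_continuous schwartz_smooth schwartz_partial)
    show "(\<lambda>u. \<phi> u * ?e u) differentiable (at y)" for y
      by (rule differentiable_mult[OF smooth_differentiable[OF schwartz_smooth[OF assms]] partial_iexp_inner(1)])
  qed (rule int(1))
  also have "\<dots> = (LINT u|lborel. partial i \<phi> u * ?e u) + (\<i> * of_real (x $ i)) * (LINT u|lborel. \<phi> u * ?e u)"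
    unfolding eq using int by (subst Bochner_Integration.integral_add) (auto intro: integrable_mult_right)
  finally have "(LINT u|lborel. partial i \<phi> u * ?e u) + (\<i> * of_real (x $ i)) * (LINT u|lborel. \<phi> u * ?e u) = 0"
    by (rule sym)
  then show ?thesis
    by (simp only: mult_minus_left eq_neg_iff_add_eq_0)
qed

lemma integral_partials_mult_iexp:
  assumes "\<phi> \<in> schwartz"
  shows "(LINT u|lborel. partials (replicate N i) \<phi> u * exp (\<i> * of_real (x \<bullet> u))) =
    (- (\<i> * of_real (x $ i))) ^ N * (LINT u|lborel. \<phi> u * exp (\<i> * of_real (x \<bullet> u)))"
proof (induction N)
  case (Suc N)
  then show ?case
    by (simp add: partials_Cons integral_partial_mult_iexp schwartz_partials assms)
qed simp

text \<open>The character has the opposite sign to the one in \<open>windowed_fourier\<close>: the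
  result is to be integrated against a transform of that kind, and the phases have to cancel at
  equal frequencies.\<close>

definition window_integral :: "(real^'n \<Rightarrow> complex) \<Rightarrow> (real^'n \<Rightarrow> complex) \<Rightarrow> real^'n \<Rightarrow> real^'n \<Rightarrow> complex" where
  "window_integral q \<psi> x v = (LINT u|lborel. \<psi> u * q (u - v) * exp (\<i> * of_real (x \<bullet> u)))"

text \<open>Decay in \<open>x\<close> comes from repeated integration by parts in a single
  coordinate, because \<open>weight_le_monomials\<close> asks only for pure powers of coordinates.
  Decay in \<open>v\<close> comes from \<open>window_decay\<close>, whose weight in
  \<open>u\<close>, with the dimension as exponent, makes the integral converge.\<close>

lemma window_integral_decay:
  fixes q :: "real^'n \<Rightarrow> complex"
  assumes q: "q \<in> schwartz"
  shows "\<exists>p. seminorm_dominated p \<and> (\<forall>\<psi>\<in>schwartz. \<forall>x v.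
    (1 + (norm x)\<^sup>2) ^ N * (1 + (norm v)\<^sup>2) ^ L * norm (window_integral q \<psi> x v) \<le> p \<psi>)"
proof -
  let ?P = "\<lambda>\<beta> p. seminorm_dominated p \<and> (\<forall>\<psi>\<in>schwartz. \<forall>u v. (1 + (norm v)\<^sup>2) ^ L * (1 + (norm u)\<^sup>2) ^ CARD('n) *
      norm (partials \<beta> (\<lambda>u. \<psi> u * q (u - v)) u) \<le> p \<psi>)"
  \<comment> \<open>A bound is fixed for every list of directions at once; the empty list and
    \<open>2 * N\<close> copies of a single direction are the ones that enter
    \<open>r\<close>.\<close>
  have "\<exists>p. \<forall>\<beta>. ?P \<beta> (p \<beta>)"
    by (intro choice allI window_decay[OF q])
  then obtain p where p: "\<And>\<beta>. ?P \<beta> (p \<beta>)" by blast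
  define I where "I = (LINT u|lborel. decay_weight (u :: real^'n))"
  have I: "I \<ge> 0"
    unfolding I_def using decay_weight_pos by (intro integral_nonneg_AE) (auto intro: less_imp_le)
  have bound: "(1 + (norm v)\<^sup>2) ^ L * (\<bar>x $ i\<bar> ^ K * norm (window_integral q \<psi> x v)) \<le> I * p (replicate K i) \<psi>"
    if \<psi>: "\<psi> \<in> schwartz" for \<psi> x v i K
  proof -
    let ?h = "\<lambda>u. \<psi> u * q (u - v)"
    let ?W = "(1 + (norm v)\<^sup>2) ^ L"
    have h: "?h \<in> schwartz" by (rule schwartz_window[OF q \<psi>])
    have W: "?W > 0" by (intro zero_less_power one_plus_norm_pos)
    have "\<bar>x $ i\<bar> ^ K * norm (window_integral q \<psi> x v) =
        norm (LINT u|lborel. partials (replicate K i) ?h u * exp (\<i> * of_real (x \<bullet> u)))"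
      unfolding integral_partials_mult_iexp[OF h] window_integral_def by (simp add: norm_mult norm_power)
    also have "\<dots> \<le> (LINT u::real^'n|lborel. (p (replicate K i) \<psi> / ?W) * decay_weight u)"
    proof (rule Bochner_Integration.integral_norm_bound_integral)
      show "integrable lborel (\<lambda>u. partials (replicate K i) ?h u * exp (\<i> * of_real (x \<bullet> u)))"
        by (intro integrable_mult_iexp_inner schwartz_partials h)
      show "integrable lborel (\<lambda>u::real^'n. (p (replicate K i) \<psi> / ?W) * decay_weight u)"
        by (intro integrable_mult_right integrable_decay_weight)
      fix u
      show "norm (partials (replicate K i) ?h u * exp (\<i> * of_real (x \<bullet> u))) \<le> (p (replicate K i) \<psi> / ?W) * decay_weight u"
      proof -
        have "?W * (1 + (norm u)\<^sup>2) ^ CARD('n) * norm (partials (replicate K i) ?h u) \<le> p (replicate K i) \<psi>"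
          using p \<psi> by blast
        moreover have "(1 + (norm u)\<^sup>2) ^ CARD('n) > 0" by (intro zero_less_power one_plus_norm_pos)
        ultimately show ?thesis
          using W by (simp add: norm_mult decay_weight_def field_simps)
      qed
    qed
    also have "\<dots> = I * p (replicate K i) \<psi> / ?W"
      by (simp add: I_def)
    finally show ?thesis
      using W by (simp add: field_simps)
  qed
  define r where "r \<psi> = (1 + real CARD('n)) ^ N * I * (p [] \<psi> + (\<Sum>i\<in>UNIV. p (replicate (2 * N) i) \<psi>))" for \<psi>
  have "seminorm_dominated r"
    unfolding r_def[abs_def] using I p
    by (intro seminorm_dominated_cmult seminorm_dominated_add seminorm_dominated_sum) auto
  moreover have "(1 + (norm x)\<^sup>2) ^ N * (1 + (norm v)\<^sup>2) ^ L * norm (window_integral q \<psi> x v) \<le> r \<psi>"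
    if \<psi>: "\<psi> \<in> schwartz" for \<psi> x v
  proof -
    let ?w = "(1 + (norm v)\<^sup>2) ^ L * norm (window_integral q \<psi> x v)"
    have "(1 + (norm x)\<^sup>2) ^ N * ?w \<le> (1 + real CARD('n)) ^ N * (1 + (\<Sum>i\<in>UNIV. (x $ i) ^ (2 * N))) * ?w"
      by (intro mult_right_mono weight_le_monomials) auto
    also have "\<dots> = (1 + real CARD('n)) ^ N * (?w + (\<Sum>i\<in>UNIV. (x $ i) ^ (2 * N) * ?w))"
      by (simp only: mult.assoc distrib_right mult_1 sum_distrib_right)
    also have "\<dots> \<le> (1 + real CARD('n)) ^ N * (I * p [] \<psi> + (\<Sum>i\<in>UNIV. I * p (replicate (2 * N) i) \<psi>))"
    proof (intro mult_left_mono add_mono sum_mono)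
      show "?w \<le> I * p [] \<psi>"
        using bound[OF \<psi>, where K = 0] by simp
      fix i
      show "(x $ i) ^ (2 * N) * ?w \<le> I * p (replicate (2 * N) i) \<psi>"
        using bound[OF \<psi>, where K = "2 * N" and i = i, of v x] by (simp add: power_even_abs mult_ac)
    qed simp
    also have "\<dots> = r \<psi>"
      by (simp add: r_def distrib_left sum_distrib_left mult.assoc)
    finally show ?thesis by (simp add: mult.assoc)
  qed
  ultimately show ?thesis by blast
qed

lemma window_integral_measurable:
  fixes q \<psi> :: "real^'n \<Rightarrow> complex"
  assumes "q \<in> schwartz" "\<psi> \<in> schwartz"
  shows "(\<lambda>p. window_integral q \<psi> (fst p) (k *\<^sub>R snd p)) \<in> borel_measurable borel"
proof -
  have c: "continuous_on UNIV \<psi>" "continuous_on UNIV q"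
    using assms by (auto intro: smooth_continuous schwartz_smooth)
  have "(\<lambda>w. \<psi> (snd w) * q (snd w - k *\<^sub>R snd (fst w)) * exp (\<i> * of_real (fst (fst w) \<bullet> snd w)))
      \<in> borel_measurable (borel :: (((real^'n) \<times> (real^'n)) \<times> (real^'n)) measure)"
    by (intro borel_measurable_continuous_onI continuous_intros continuous_on_compose2[OF c(1)] continuous_on_compose2[OF c(2)]) auto
  then have "(\<lambda>(p, u). \<psi> u * q (u - k *\<^sub>R snd p) * exp (\<i> * of_real (fst p \<bullet> u)))
      \<in> borel_measurable ((borel :: ((real^'n) \<times> (real^'n)) measure) \<Otimes>\<^sub>M lborel)"
    by (simp add: borel_prod[symmetric] case_prod_beta')
  then show ?thesis
    unfolding window_integral_def by (rule lborel.borel_measurable_lebesgue_integral)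
qed

section \<open>Inversion\<close>

lemma entire_mult: "entire F \<Longrightarrow> entire G \<Longrightarrow> entire (\<lambda>z. F z * G z)"
  unfolding entire_def
proof
  fix z
  assume "\<forall>z. \<exists>D. (F has_derivative D) (at z) \<and> (\<forall>c v. D (c *s v) = c * D v)"
    and "\<forall>z. \<exists>D. (G has_derivative D) (at z) \<and> (\<forall>c v. D (c *s v) = c * D v)"
  then obtain D E where D: "(F has_derivative D) (at z)" "\<And>c v. D (c *s v) = c * D v"
    and E: "(G has_derivative E) (at z)" "\<And>c v. E (c *s v) = c * E v" by metis
  show "\<exists>D. ((\<lambda>z. F z * G z) has_derivative D) (at z) \<and> (\<forall>c v. D (c *s v) = c * D v)"
    by (rule exI, rule conjI, rule has_derivative_mult[OF D(1) E(1)]) (simp add: D(2) E(2) algebra_simps)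
qed

lemma entire_translate: "entire F \<Longrightarrow> entire (\<lambda>z. F (w + z))"
  unfolding entire_def
proof
  fix z
  assume "\<forall>z. \<exists>D. (F has_derivative D) (at z) \<and> (\<forall>c v. D (c *s v) = c * D v)"
  then obtain D where D: "(F has_derivative D) (at (w + z))" "\<And>c v. D (c *s v) = c * D v" by blast
  have "((\<lambda>z. w + z) has_derivative (\<lambda>v. v)) (at z)"
    by (auto intro!: derivative_eq_intros)
  then have "((\<lambda>z. F (w + z)) has_derivative (\<lambda>v. D v)) (at z)"
    by (rule has_derivative_compose[where g = F and g' = D]) (rule D(1))
  then show "\<exists>D. ((\<lambda>z. F (w + z)) has_derivative D) (at z) \<and> (\<forall>c v. D (c *s v) = c * D v)"
    using D(2) by blast
qed

lemma entire_exp_square: "entire (\<lambda>z::complex^'n. exp (k * (\<Sum>j\<in>UNIV. (z $ j)\<^sup>2)))"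
  unfolding entire_def
proof
  fix z :: "complex^'n"
  have "((\<lambda>z::complex^'n. z $ j) has_derivative (\<lambda>v. v $ j)) (at z)" for j
    by (intro bounded_linear_imp_has_derivative bounded_linear_vec_nth)
  then have "((\<lambda>z::complex^'n. k * (\<Sum>j\<in>UNIV. z $ j * z $ j)) has_derivative
      (\<lambda>v. k * (\<Sum>j\<in>UNIV. z $ j * v $ j + v $ j * z $ j))) (at z)"
    by (intro has_derivative_mult_right has_derivative_sum has_derivative_mult)
  note D = has_derivative_compose[OF this DERIV_exp[unfolded has_field_derivative_def]]
  show "\<exists>D. ((\<lambda>z. exp (k * (\<Sum>j\<in>UNIV. (z $ j)\<^sup>2))) has_derivative D) (at z) \<and> (\<forall>c v. D (c *s v) = c * D v)"
    unfolding power2_eq_square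
    by (rule exI, rule conjI, rule D) (simp add: sum_distrib_left algebra_simps)
qed

lemma continuous_on_gaussian_factor:
  assumes "entire F"
  shows "continuous_on UNIV (\<lambda>p. F (complex_vec (fst p) (snd p)) * of_real (exp (- b * (norm (snd p))\<^sup>2)))"
  by (intro continuous_intros continuous_on_compose2[OF entire_continuous[OF assms] continuous_on_complex_vec]) auto

text \<open>\<open>exp (- \<bar>y\<bar>\<^sup>2 / (2 * a)) * F (x + \<i> * y)\<close> is, up to a constant, the value at \<open>(x, y / a)\<close> of the
  windowed Fourier transform of the distribution that has to be found.\<close>

definition inversion_integral :: "real \<Rightarrow> (complex^'n \<Rightarrow> complex) \<Rightarrow> (real^'n \<Rightarrow> complex) \<Rightarrow> complex" where
  "inversion_integral a F \<psi> = (LINT p|lborel. F (complex_vec (fst p) (snd p)) * of_real (exp (- (1 / (2 * a)) * (norm (snd p))\<^sup>2)) *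
     window_integral (gauss_exp a 0) \<psi> (fst p) ((1 / a) *\<^sub>R snd p))"

text \<open>The exponential growth allowed for \<open>F\<close> cancels exactly against the Gaussian
  factor in \<open>y\<close>, leaving polynomial growth of order \<open>m\<close>. The window
  integral is used with the dimension plus \<open>m\<close> powers of decay in each variable, so
  that an integrable weight remains.\<close>

lemma inversion_integrand_bound:
  fixes F :: "complex^'n \<Rightarrow> complex"
  assumes "a > 0" "entire F" "growth_bound a F"
  shows "\<exists>r. seminorm_dominated r \<and> (\<forall>\<psi>\<in>schwartz. \<forall>p.
    norm (F (complex_vec (fst p) (snd p)) * of_real (exp (- (1 / (2 * a)) * (norm (snd p))\<^sup>2)) *
     window_integral (gauss_exp a 0) \<psi> (fst p) ((1 / a) *\<^sub>R snd p)) \<le> r \<psi> * (decay_weight (fst p) * decay_weight (snd p)))"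
proof -
  let ?n = "CARD('n)"
  obtain m C where C: "\<And>x y. norm (F (complex_vec x y))
      \<le> C * (1 + (norm x)\<^sup>2 + (norm y)\<^sup>2) ^ m * exp (1/2 * inverse a * (norm y)\<^sup>2)"
    using assms(3) unfolding growth_bound_def by blast
  obtain p where p: "seminorm_dominated p" "\<And>\<psi> x v. \<psi> \<in> schwartz \<Longrightarrow>
    (1 + (norm x)\<^sup>2) ^ (m + ?n) * (1 + (norm v)\<^sup>2) ^ (m + ?n) * norm (window_integral (gauss_exp a 0 :: real^'n \<Rightarrow> _) \<psi> x v) \<le> p \<psi>"
    using window_integral_decay[OF gauss_exp_schwartz[OF assms(1)]] by metis
  let ?r = "\<lambda>\<psi>. (\<bar>C\<bar> * (1 + a\<^sup>2) ^ (m + ?n)) * p \<psi>"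
  have "seminorm_dominated ?r"
    by (intro seminorm_dominated_cmult p) auto
  moreover have "norm (F (complex_vec x y) * of_real (exp (- (1 / (2 * a)) * (norm y)\<^sup>2)) *
     window_integral (gauss_exp a 0) \<psi> x ((1 / a) *\<^sub>R y)) \<le> ?r \<psi> * (decay_weight x * decay_weight y)"
    if \<psi>: "\<psi> \<in> schwartz" for \<psi> x y
  proof -
    define X Y v where "X = 1 + (norm x)\<^sup>2" and "Y = 1 + (norm y)\<^sup>2" and "v = (1 / a) *\<^sub>R y"
    define W where "W = norm (window_integral (gauss_exp a 0) \<psi> x v)"
    have XY: "X \<ge> 1" "Y \<ge> 1" by (simp_all add: X_def Y_def)
    have "norm (F (complex_vec x y)) * exp (- (1 / (2 * a)) * (norm y)\<^sup>2)
        \<le> C * (1 + (norm x)\<^sup>2 + (norm y)\<^sup>2) ^ m * exp (1/2 * inverse a * (norm y)\<^sup>2) * exp (- (1 / (2 * a)) * (norm y)\<^sup>2)"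
      by (intro mult_right_mono C) auto
    also have "\<dots> = C * (1 + (norm x)\<^sup>2 + (norm y)\<^sup>2) ^ m * (exp (1/2 * inverse a * (norm y)\<^sup>2) * exp (- (1 / (2 * a)) * (norm y)\<^sup>2))"
      by (rule mult.assoc)
    also have "exp (1/2 * inverse a * (norm y)\<^sup>2) * exp (- (1 / (2 * a)) * (norm y)\<^sup>2) = 1"
      unfolding exp_add[symmetric] using assms(1) by (simp add: field_simps)
    also have "C * (1 + (norm x)\<^sup>2 + (norm y)\<^sup>2) ^ m * 1 = C * (1 + (norm x)\<^sup>2 + (norm y)\<^sup>2) ^ m"
      by simp
    also have "C * (1 + (norm x)\<^sup>2 + (norm y)\<^sup>2) ^ m \<le> \<bar>C\<bar> * (X * Y) ^ m"
    proof (intro mult_mono power_mono)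
      show "1 + (norm x)\<^sup>2 + (norm y)\<^sup>2 \<le> X * Y"
        by (simp add: X_def Y_def algebra_simps)
    qed (use XY in auto)
    finally have 1: "norm (F (complex_vec x y)) * exp (- (1 / (2 * a)) * (norm y)\<^sup>2) \<le> \<bar>C\<bar> * (X * Y) ^ m" .
    \<comment> \<open>The decay is known in \<open>v = y / a\<close>; the factor
      \<open>1 + a\<^sup>2\<close> converts it into decay in \<open>y\<close> for small and large
      \<open>a\<close> alike.\<close>
    have "Y \<le> (1 + a\<^sup>2) * (1 + (norm v)\<^sup>2)"
    proof -
      have "(norm y)\<^sup>2 = a\<^sup>2 * (norm v)\<^sup>2"
        using assms(1) by (simp add: v_def power_divide)
      then show ?thesis by (simp add: Y_def algebra_simps)
    qed
    then have "Y ^ (m + ?n) \<le> ((1 + a\<^sup>2) * (1 + (norm v)\<^sup>2)) ^ (m + ?n)"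
      using XY by (intro power_mono) auto
    then have "X ^ (m + ?n) * Y ^ (m + ?n) * W \<le> X ^ (m + ?n) * ((1 + a\<^sup>2) * (1 + (norm v)\<^sup>2)) ^ (m + ?n) * W"
      using XY by (intro mult_right_mono mult_left_mono) (auto simp: W_def)
    also have "\<dots> = (1 + a\<^sup>2) ^ (m + ?n) * (X ^ (m + ?n) * (1 + (norm v)\<^sup>2) ^ (m + ?n) * W)"
      by (simp add: power_mult_distrib mult_ac)
    also have "\<dots> \<le> (1 + a\<^sup>2) ^ (m + ?n) * p \<psi>"
      unfolding X_def W_def by (intro mult_left_mono p(2) \<psi>) auto
    finally have 2: "X ^ (m + ?n) * Y ^ (m + ?n) * W \<le> (1 + a\<^sup>2) ^ (m + ?n) * p \<psi>" .
    have "norm (F (complex_vec x y)) * exp (- (1 / (2 * a)) * (norm y)\<^sup>2) * W \<le> \<bar>C\<bar> * (X * Y) ^ m * W"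
      by (intro mult_right_mono 1) (simp add: W_def)
    also have "\<dots> = \<bar>C\<bar> * (X ^ (m + ?n) * Y ^ (m + ?n) * W) * (inverse (X ^ ?n) * inverse (Y ^ ?n))"
      using XY by (simp add: power_add power_mult_distrib field_simps)
    also have "\<dots> \<le> \<bar>C\<bar> * ((1 + a\<^sup>2) ^ (m + ?n) * p \<psi>) * (inverse (X ^ ?n) * inverse (Y ^ ?n))"
      using XY by (intro mult_right_mono mult_left_mono 2) auto
    finally show ?thesis
      by (simp add: norm_mult W_def v_def X_def Y_def decay_weight_def mult.assoc)
  qed
  ultimately show ?thesis by (metis (no_types, lifting))
qed

lemma inversion_integrable:
  fixes F :: "complex^'n \<Rightarrow> complex"
  assumes "a > 0" "entire F" "growth_bound a F" "\<psi> \<in> schwartz"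
  shows "integrable lborel (\<lambda>p. F (complex_vec (fst p) (snd p)) * of_real (exp (- (1 / (2 * a)) * (norm (snd p))\<^sup>2)) *
     window_integral (gauss_exp a 0) \<psi> (fst p) ((1 / a) *\<^sub>R snd p))" (is "integrable lborel ?g")
proof -
  obtain r where r: "\<And>\<psi> p. \<psi> \<in> schwartz \<Longrightarrow>
    norm (F (complex_vec (fst p) (snd p)) * of_real (exp (- (1 / (2 * a)) * (norm (snd p))\<^sup>2)) *
     window_integral (gauss_exp a 0) \<psi> (fst p) ((1 / a) *\<^sub>R snd p)) \<le> r \<psi> * (decay_weight (fst p) * decay_weight (snd p))"
    using inversion_integrand_bound[OF assms(1-3)] by blast
  show ?thesis
  proof (rule Bochner_Integration.integrable_bound)
    show "integrable lborel (\<lambda>p::(real^'n) \<times> (real^'n). r \<psi> * (decay_weight (fst p) * decay_weight (snd p)))"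
      by (intro integrable_mult_right integrable_decay_weight_pair)
    have m1: "(\<lambda>p. F (complex_vec (fst p) (snd p)) * of_real (exp (- (1 / (2 * a)) * (norm (snd p))\<^sup>2))) \<in> borel_measurable borel"
      by (rule borel_measurable_continuous_onI[OF continuous_on_gaussian_factor[OF assms(2)]])
    have m2: "(\<lambda>p. window_integral (gauss_exp a 0) \<psi> (fst p) ((1 / a) *\<^sub>R snd p)) \<in> borel_measurable borel"
      by (rule window_integral_measurable[OF gauss_exp_schwartz[OF assms(1)] assms(4)])
    show "?g \<in> borel_measurable lborel"
      using borel_measurable_times[OF m1 m2] by (simp only: measurable_lborel1 measurable_lborel2)
    show "AE p in lborel. norm (?g p) \<le> norm (r \<psi> * (decay_weight (fst p) * decay_weight (snd p)))"
      unfolding real_norm_def by (intro AE_I2 order_trans[OF r[OF assms(4)] abs_ge_self])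
  qed
qed

section \<open>Linearity and continuity of the inverse functional\<close>

lemma window_integral_add:
  assumes "q \<in> schwartz" "\<phi> \<in> schwartz" "\<psi> \<in> schwartz"
  shows "window_integral q (\<lambda>u. \<phi> u + \<psi> u) x v = window_integral q \<phi> x v + window_integral q \<psi> x v"
  unfolding window_integral_def distrib_right
  using integrable_mult_iexp_inner[OF schwartz_window[OF assms(1,2)]] integrable_mult_iexp_inner[OF schwartz_window[OF assms(1,3)]]
  by (rule Bochner_Integration.integral_add)

lemma window_integral_cmult: "window_integral q (\<lambda>u. k * \<psi> u) x v = k * window_integral q \<psi> x v"
  by (simp add: window_integral_def mult.assoc)

lemma tempered_distribution_inversion:
  fixes F :: "complex^'n \<Rightarrow> complex"
  assumes "a > 0" "entire F" "growth_bound a F"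
  shows "tempered_distribution (\<lambda>\<psi>. K * inversion_integral a F \<psi>)"
  unfolding tempered_distribution_iff
proof (intro conjI ballI allI)
  fix \<phi> \<psi> :: "real^'n \<Rightarrow> complex" assume "\<phi> \<in> schwartz" "\<psi> \<in> schwartz"
  then have "inversion_integral a F (\<lambda>u. \<phi> u + \<psi> u) = inversion_integral a F \<phi> + inversion_integral a F \<psi>"
    unfolding inversion_integral_def using inversion_integrable[OF assms]
    by (simp add: window_integral_add gauss_exp_schwartz assms(1) distrib_left)
  then show "K * inversion_integral a F (\<lambda>u. \<phi> u + \<psi> u) = K * inversion_integral a F \<phi> + K * inversion_integral a F \<psi>"
    by (simp add: distrib_left)
next
  fix k and \<phi> :: "real^'n \<Rightarrow> complex" assume "\<phi> \<in> schwartz"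
  show "K * inversion_integral a F (\<lambda>u. k * \<phi> u) = k * (K * inversion_integral a F \<phi>)"
    unfolding inversion_integral_def window_integral_cmult mult.left_commute[of _ k] by simp
next
  obtain r where r: "seminorm_dominated r" "\<And>\<psi> p. \<psi> \<in> schwartz \<Longrightarrow>
    norm (F (complex_vec (fst p) (snd p)) * of_real (exp (- (1 / (2 * a)) * (norm (snd p))\<^sup>2)) *
     window_integral (gauss_exp a 0) \<psi> (fst p) ((1 / a) *\<^sub>R snd p)) \<le> r \<psi> * (decay_weight (fst p) * decay_weight (snd p))"
    using inversion_integrand_bound[OF assms] by blast
  define I where "I = (LINT p|lborel. decay_weight (fst p :: real^'n) * decay_weight (snd p :: real^'n))"
  have I: "I \<ge> 0"
    unfolding I_def using decay_weight_pos by (intro integral_nonneg_AE) (auto intro: less_imp_le mult_nonneg_nonneg)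
  have "norm (K * inversion_integral a F \<psi>) \<le> (norm K * I) * r \<psi>" if \<psi>: "\<psi> \<in> schwartz" for \<psi>
  proof -
    have "norm (inversion_integral a F \<psi>) \<le> (LINT p::(real^'n) \<times> (real^'n)|lborel. r \<psi> * (decay_weight (fst p) * decay_weight (snd p)))"
      unfolding inversion_integral_def
      by (intro Bochner_Integration.integral_norm_bound_integral inversion_integrable assms \<psi> integrable_mult_right
          integrable_decay_weight_pair r(2))
    also have "\<dots> = I * r \<psi>" by (simp add: I_def)
    finally show ?thesis by (simp add: norm_mult mult_left_mono mult.assoc)
  qed
  then show "seminorm_dominated (\<lambda>\<psi>. norm (K * inversion_integral a F \<psi>))"
    using I by (intro seminorm_dominated_mono[OF seminorm_dominated_cmult[OF r(1), of "norm K * I"]]) auto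
qed

text \<open>The two Gaussians in \<open>u\<close> are centred at 0 and at \<open>v\<close>.
  Translation by \<open>v / 2\<close> places the centres symmetrically about the origin, so the
  mixed terms cancel, and a single centred Gaussian with frequency \<open>x - w\<close> remains to
  be integrated.\<close>

lemma window_integral_gauss_exp:
  fixes w x v :: "real^'n"
  assumes "a > 0"
  shows "window_integral (gauss_exp a 0) (gauss_exp a (complex_vec w 0)) x v =
    of_real (sqrt (pi / a) ^ CARD('n)) * exp (of_real (- (a / 4) * (norm v)\<^sup>2 - (norm (x - w))\<^sup>2 / (4 * a)) + \<i> * of_real ((x - w) \<bullet> v / 2))"
proof -
  have cdot: "cdot (complex_vec w 0) u = of_real (w \<bullet> u)" for u
    by (simp add: cdot_def complex_vec_def inner_vec_def)
  have cdot0: "cdot 0 u = 0" for u :: "real^'n" by (simp add: cdot_def)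
  let ?g = "\<lambda>u. gauss_exp a (complex_vec w 0) u * gauss_exp a 0 (u - v) * exp (\<i> * of_real (x \<bullet> u))"
  have shift: "?g (u + (1/2) *\<^sub>R v) = exp (of_real (- (a / 4) * (norm v)\<^sup>2) + \<i> * of_real ((x - w) \<bullet> v / 2)) *
      exp (of_real (- a * (norm u)\<^sup>2) + \<i> * of_real ((x - w) \<bullet> u))" for u
  proof -
    have "u + (1/2) *\<^sub>R v - v = u - (1/2) *\<^sub>R v"
      by (simp add: algebra_simps scaleR_left_distrib[symmetric] flip: scaleR_left.add)
    moreover have "complex_of_real (- (a / 2) * (norm (u + (1/2) *\<^sub>R v))\<^sup>2) + of_real (- (a / 2) * (norm (u - (1/2) *\<^sub>R v))\<^sup>2) =
        of_real (- (a / 4) * (norm v)\<^sup>2) + of_real (- a * (norm u)\<^sup>2)"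
      unfolding of_real_add[symmetric] of_real_eq_iff
      by (simp add: power2_norm_eq_inner inner_diff_left inner_diff_right inner_add_left inner_add_right inner_commute algebra_simps)
    moreover have "complex_of_real (x \<bullet> (u + (1/2) *\<^sub>R v)) - of_real (w \<bullet> (u + (1/2) *\<^sub>R v)) =
        of_real ((x - w) \<bullet> v / 2) + of_real ((x - w) \<bullet> u)"
      unfolding of_real_add[symmetric] of_real_diff[symmetric] of_real_eq_iff
      by (simp add: inner_diff_left inner_add_right field_simps)
    \<comment> \<open>Schematic regroupings of the exponents, so that the equation closes by
      rewriting alone.\<close>
    moreover have "A - \<i> * W + (B - \<i> * 0) + \<i> * X = (A + B) + \<i> * (X - W)"
      "P + \<i> * V + (Q + \<i> * U) = (P + Q) + \<i> * (V + U)" for A B P Q W X V U :: complex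
      by (simp_all add: algebra_simps)
    ultimately show ?thesis
      unfolding gauss_exp_def cdot cdot0 exp_add[symmetric] by (simp only:)
  qed
  have "?g \<in> borel_measurable borel"
    by (intro schwartz_measurable borel_measurable_times gauss_exp_schwartz assms schwartz_window
        borel_measurable_continuous_onI continuous_intros)
  then have "window_integral (gauss_exp a 0) (gauss_exp a (complex_vec w 0)) x v = (LINT u|lborel. ?g (u + (1/2) *\<^sub>R v))"
    unfolding window_integral_def by (intro integral_lborel_preserving[OF lborel_preserving_translate, symmetric])
  also have "\<dots> = exp (of_real (- (a / 4) * (norm v)\<^sup>2) + \<i> * of_real ((x - w) \<bullet> v / 2)) *
      of_real (sqrt (pi / a) ^ CARD('n) * exp (- (norm (x - w))\<^sup>2 / (4 * a)))"
    unfolding shift using integral_gaussian[OF assms, of "x - w"] by simp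
  also have "\<dots> = of_real (sqrt (pi / a) ^ CARD('n)) *
      (exp (of_real (- (a / 4) * (norm v)\<^sup>2) + \<i> * of_real ((x - w) \<bullet> v / 2)) * exp (of_real (- (norm (x - w))\<^sup>2 / (4 * a))))"
    by (simp only: of_real_mult exp_of_real mult_ac)
  also have "exp (of_real (- (a / 4) * (norm v)\<^sup>2) + \<i> * of_real ((x - w) \<bullet> v / 2)) * exp (of_real (- (norm (x - w))\<^sup>2 / (4 * a)))
     = exp (of_real (- (a / 4) * (norm v)\<^sup>2 - (norm (x - w))\<^sup>2 / (4 * a)) + \<i> * of_real ((x - w) \<bullet> v / 2))"
    unfolding exp_add[symmetric] by (simp add: algebra_simps)
  finally show ?thesis .
qed

text \<open>For \<open>z = t + \<i> * y\<close> one has \<open>z \<bullet> z = \<bar>t\<bar>\<^sup>2 - \<bar>y\<bar>\<^sup>2 + 2 * \<i> * (t \<bullet> y)\<close>. Hence the integrand is, after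
  a translation, an entire function times a rotation invariant Gaussian.\<close>

lemma inversion_integrand_gauss_exp:
  fixes F :: "complex^'n \<Rightarrow> complex" and w t y :: "real^'n"
  assumes "a > 0"
  shows "F (complex_vec (t + w) y) * of_real (exp (- (1 / (2 * a)) * (norm y)\<^sup>2)) *
      window_integral (gauss_exp a 0) (gauss_exp a (complex_vec w 0)) (t + w) ((1 / a) *\<^sub>R y) =
    of_real (sqrt (pi / a) ^ CARD('n)) *
      (F (complex_vec w 0 + complex_vec t y) * exp (of_real (1 / (4 * a)) * (\<Sum>j\<in>UNIV. (complex_vec t y $ j)\<^sup>2)) *
        of_real (exp (- (1 / (2 * a)) * (norm (t, y))\<^sup>2)))"
proof -
  have 1: "complex_vec (t + w) y = complex_vec w 0 + complex_vec t y"
    by (simp add: complex_vec_def vec_eq_iff)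
  have 2: "(\<Sum>j\<in>UNIV. (complex_vec t y $ j)\<^sup>2) = of_real ((norm t)\<^sup>2 - (norm y)\<^sup>2) + \<i> * of_real (2 * (t \<bullet> y))"
  proof -
    have n: "(norm u)\<^sup>2 = (\<Sum>i\<in>UNIV. (u $ i)\<^sup>2)" for u :: "real^'n"
      unfolding power2_norm_eq_inner inner_vec_def by (simp add: power2_eq_square)
    have "(complex_vec t y $ j)\<^sup>2 = of_real ((t $ j)\<^sup>2 - (y $ j)\<^sup>2) + \<i> * of_real (2 * (t $ j * y $ j))" for j
      by (simp add: complex_vec_def power2_eq_square algebra_simps)
    then show ?thesis
      by (simp add: n inner_vec_def sum.distrib sum_subtractf sum_distrib_left)
  qed
  have 3: "(norm (t, y))\<^sup>2 = (norm t)\<^sup>2 + (norm y)\<^sup>2"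
    by (simp add: norm_Pair)
  \<comment> \<open>On the left |t|^2 has the coefficient -1/(4a) and |y|^2 the coefficient -3/(4a).
    Their mean -1/(2a) is the invariant part, half their difference 1/(4a) is the factor of z . z,
    and the mixed term 2 i (t . y) then matches as well.\<close>
  have "of_real (- (1 / (2 * a)) * (norm y)\<^sup>2) + (of_real (- (a / 4) * (norm ((1 / a) *\<^sub>R y))\<^sup>2 - (norm t)\<^sup>2 / (4 * a)) +
      \<i> * of_real (t \<bullet> ((1 / a) *\<^sub>R y) / 2))
    = of_real (1 / (4 * a)) * (of_real ((norm t)\<^sup>2 - (norm y)\<^sup>2) + \<i> * of_real (2 * (t \<bullet> y))) +
      complex_of_real (- (1 / (2 * a)) * ((norm t)\<^sup>2 + (norm y)\<^sup>2))" (is "?l = ?r")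
    using assms by (simp add: complex_eq_iff power_divide field_simps power2_eq_square)
  then have "exp ?l = exp ?r" by simp
  then have "of_real (exp (- (1 / (2 * a)) * (norm y)\<^sup>2)) *
      exp (of_real (- (a / 4) * (norm ((1 / a) *\<^sub>R y))\<^sup>2 - (norm t)\<^sup>2 / (4 * a)) + \<i> * of_real (t \<bullet> ((1 / a) *\<^sub>R y) / 2))
    = exp (of_real (1 / (4 * a)) * (\<Sum>j\<in>UNIV. (complex_vec t y $ j)\<^sup>2)) * of_real (exp (- (1 / (2 * a)) * (norm (t, y))\<^sup>2))"
    by (simp only: 2 3 exp_add exp_of_real)
  then show ?thesis
    unfolding window_integral_gauss_exp[OF assms] 1 add_diff_cancel_right' by (simp only: mult.assoc mult.left_commute)
qed

text \<open>The mean value lemma asks for integrability of \<open>H\<close> against the invariant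
  Gaussian. It is inherited from \<open>inversion_integrable\<close> through the translation by
  \<open>(w, 0)\<close>, in place of a separate growth estimate for \<open>H\<close>.\<close>

lemma inversion_integral_gauss_exp:
  fixes F :: "complex^'n \<Rightarrow> complex" and w :: "real^'n"
  assumes "a > 0" "entire F" "growth_bound a F"
  shows "inversion_integral a F (gauss_exp a (complex_vec w 0)) =
    of_real (sqrt (pi / a) ^ CARD('n) * (LINT p::(real^'n) \<times> (real^'n)|lborel. exp (- (1 / (2 * a)) * (norm p)\<^sup>2))) *
    F (complex_vec w 0)"
proof -
  let ?s = "complex_of_real (sqrt (pi / a) ^ CARD('n))"
  let ?g = "\<lambda>p. F (complex_vec (fst p) (snd p)) * of_real (exp (- (1 / (2 * a)) * (norm (snd p))\<^sup>2)) *
     window_integral (gauss_exp a 0) (gauss_exp a (complex_vec w 0)) (fst p) ((1 / a) *\<^sub>R snd p)"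
  define H where "H z = F (complex_vec w 0 + z) * exp (of_real (1 / (4 * a)) * (\<Sum>j\<in>UNIV. (z $ j)\<^sup>2))" for z
  let ?h = "\<lambda>p. H (complex_vec (fst p) (snd p)) * of_real (exp (- (1 / (2 * a)) * (norm p)\<^sup>2))"
  have H: "entire H"
    unfolding H_def[abs_def] by (intro entire_mult entire_translate entire_exp_square assms)
  have int: "integrable lborel ?g"
    by (intro inversion_integrable assms gauss_exp_schwartz)
  have eq: "?g (p + (w, 0)) = ?s * ?h p" for p
    using inversion_integrand_gauss_exp[OF assms(1), of F "fst p" w "snd p"] by (simp add: H_def)
  have s: "?s \<noteq> 0" using assms(1) by simp
  have "integrable lborel (\<lambda>p. ?g (p + (w, 0)))"
    using int by (subst integrable_lborel_preserving[OF lborel_preserving_translate]) (auto dest: borel_measurable_integrable)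
  then have "integrable lborel (\<lambda>p. ?s * ?h p)"
    unfolding eq .
  from integrable_mult_right[OF this, of "1 / ?s"] have h: "integrable lborel ?h"
    using s by simp
  have "inversion_integral a F (gauss_exp a (complex_vec w 0)) = (LINT p|lborel. ?g (p + (w, 0)))"
    unfolding inversion_integral_def using int
    by (intro integral_lborel_preserving[OF lborel_preserving_translate, symmetric]) (auto dest: borel_measurable_integrable)
  also have "\<dots> = ?s * (LINT p|lborel. ?h p)"
    unfolding eq by simp
  also have "(LINT p|lborel. ?h p) = H 0 * of_real (LINT p::(real^'n) \<times> (real^'n)|lborel. exp (- (1 / (2 * a)) * (norm p)\<^sup>2))"
    by (rule gaussian_mean_entire[OF H h])
  also have "H 0 = F (complex_vec w 0)"
    by (simp add: H_def)
  finally show ?thesis by simp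
qed

text \<open>By Fubini the mass is the square of the Gaussian integral over one factor, known from
  \<open>integral_gaussian\<close> at frequency 0. The normalization of the inverse divides by
  it.\<close>

lemma gaussian_mass_nonzero:
  assumes A: "A > 0"
  shows "(LINT p::(real^'n) \<times> (real^'n)|lborel. exp (- A * (norm p)\<^sup>2)) \<noteq> 0"
proof
  assume 0: "(LINT p::(real^'n) \<times> (real^'n)|lborel. exp (- A * (norm p)\<^sup>2)) = 0"
  define z :: "real^'n" where "z = 0"
  have i1: "integrable lborel (\<lambda>u::real^'n. exp (- A * (norm u)\<^sup>2))"
  proof -
    have "gauss_exp (2 * A) (0 :: complex^'n) = (\<lambda>u. of_real (exp (- A * (norm u)\<^sup>2)))"
      by (simp add: fun_eq_iff gauss_exp_def cdot_def exp_of_real[symmetric])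
    then show ?thesis
      using schwartz_integrable[OF gauss_exp_schwartz[of "2 * A" "0 :: complex^'n"]] A
      by (simp only: complex_of_real_integrable_eq)
  qed
  have v: "(LINT u::real^'n|lborel. exp (- A * (norm u)\<^sup>2)) = sqrt (pi / A) ^ CARD('n)" (is "?v = _")
  proof -
    have "complex_of_real ?v = (LINT u::real^'n|lborel. of_real (exp (- A * (norm u)\<^sup>2)))"
      by (rule integral_complex_of_real[symmetric])
    also have "\<dots> = of_real (sqrt (pi / A) ^ CARD('n))"
      using integral_gaussian[OF A, of z] by (simp add: z_def exp_of_real[symmetric])
    finally show ?thesis by (simp only: of_real_eq_iff)
  qed
  have split: "exp (- A * (norm (x, y))\<^sup>2) = exp (- A * (norm x)\<^sup>2) * exp (- A * (norm y)\<^sup>2)" for x y :: "real^'n"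
    by (simp add: norm_Pair exp_add[symmetric] algebra_simps add_divide_distrib)
  have m: "(\<lambda>p::(real^'n) \<times> (real^'n). exp (- A * (norm p)\<^sup>2)) \<in> borel_measurable (lborel \<Otimes>\<^sub>M lborel)"
    unfolding lborel_prod by simp
  have "integrable (lborel \<Otimes>\<^sub>M lborel) (\<lambda>p::(real^'n) \<times> (real^'n). exp (- A * (norm p)\<^sup>2))"
  proof (rule lborel_pair.Fubini_integrable[OF m])
    show "integrable lborel (\<lambda>x::real^'n. LINT y::real^'n|lborel. norm (exp (- A * (norm (x, y))\<^sup>2)))"
      unfolding split using i1 by simp
    show "AE x::real^'n in lborel. integrable lborel (\<lambda>y::real^'n. exp (- A * (norm (x, y))\<^sup>2))"
      unfolding split using i1 by simp
  qed
  from lborel_pair.integral_fst'[OF this]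
  have "(LINT x::real^'n|lborel. LINT y::real^'n|lborel. exp (- A * (norm (x, y))\<^sup>2)) = 0"
    using 0 by (simp add: lborel_prod)
  then have "?v * ?v = 0"
    unfolding split by simp
  then show False
    unfolding v using A by simp
qed

lemma T_transform_surj:
  fixes F :: "complex^'n \<Rightarrow> complex"
  assumes "a > 0" "c > 0" "entire F" "growth_bound a F"
  shows "\<exists>f. tempered_distribution f \<and> (\<forall>x. F (complex_vec x 0) = T_transform c a f x)"
proof -
  define I where "I = (LINT p::(real^'n) \<times> (real^'n)|lborel. exp (- (1 / (2 * a)) * (norm p)\<^sup>2))"
  \<comment> \<open>The constant in front of the transform, the constant of
    \<open>window_integral_gauss_exp\<close> and the mass from the mean value lemma. All three are
    nonzero, the first because \<open>c > 0\<close>.\<close>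
  define k where "k = transform_const c TYPE('n) * (sqrt (pi / a) ^ CARD('n) * I)"
  have k: "k \<noteq> 0"
    using gaussian_mass_nonzero[where 'n = 'n and A = "1 / (2 * a)"] assms(1,2) by (simp add: k_def I_def transform_const_def)
  let ?f = "\<lambda>\<psi>. of_real (1 / k) * inversion_integral a F \<psi>"
  have f: "tempered_distribution ?f"
    by (rule tempered_distribution_inversion[OF assms(1,3,4)])
  have "T_transform c a ?f x = F (complex_vec x 0)" for x
  proof -
    have "T_transform c a ?f x = of_real (transform_const c TYPE('n)) * (of_real (1 / k) *
        (of_real (sqrt (pi / a) ^ CARD('n) * I) * F (complex_vec x 0)))"
      unfolding T_transform_eq[OF f assms(1)] inversion_integral_gauss_exp[OF assms(1,3,4)] I_def ..
    also have "\<dots> = of_real (k / k) * F (complex_vec x 0)"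
      by (simp add: k_def)
    finally show ?thesis using k by simp
  qed
  then show ?thesis using f by metis
qed

theorem theorem5p3:
  fixes a c :: real
  assumes "a > 0" and "c > 0"
  shows "(\<forall>f :: (real^'n \<Rightarrow> complex) \<Rightarrow> complex. tempered_distribution f \<longrightarrow>
           (\<exists>F :: complex^'n \<Rightarrow> complex. entire F \<and>
              (\<forall>x. F (complex_vec x 0) = T_transform c a f x) \<and> growth_bound a F)) \<and>
         (\<forall>F :: complex^'n \<Rightarrow> complex. entire F \<and> growth_bound a F \<longrightarrow>
           (\<exists>f :: (real^'n \<Rightarrow> complex) \<Rightarrow> complex. tempered_distribution f \<and>
              (\<forall>x. F (complex_vec x 0) = T_transform c a f x)))"
  using T_transform_entire_growth[OF _ assms(1)] T_transform_surj[OF assms] by blast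

end
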